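(* Fix a finite field $\mathbb{F}_q$. For each $n\ge1$ let $g$ be chosen uniformly at random from $\mathrm{GL}_n(\mathbb{F}_q)$ and let $k=k(n)$ be a positive integer. Suppose that $$\sum_{\substack{12\log_q n<d\le n\\ \gcd(k,q^d-1)<q^{d/3}}} \frac1d\;\longrightarrow\;\infty\qquad (n\to\infty),$$ where $d$ runs over integers. Then the distribution of $\mathrm{Tr}(g^k)$ tends to the uniform distribution on $\mathbb{F}_q$ as $n\to\infty$.
   Context: $q$ is a fixed prime power; $\mathrm{GL}_n(\mathbb{F}_q)$ carries the uniform probability measure. *)

theory Defs
  imports "HOL-Probability.Probability_Mass_Function" "Jordan_Normal_Form.Matrix"
begin

definition trace_mat :: "'a :: semiring_1 mat \<Rightarrow> 'a" where
  "trace_mat A = (\<Sum>i < dim_row A. A $$ (i, i))"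

definition GL :: "nat \<Rightarrow> 'a :: field mat set" where
  "GL n = {A \<in> carrier_mat n n. invertible_mat A}"

lemma one_mat_in_GL: "(1\<^sub>m n :: 'a :: field mat) \<in> GL n"
proof -
  have "inverts_mat (1\<^sub>m n :: 'a mat) (1\<^sub>m n)"
    by (simp add: inverts_mat_def)
  then have "invertible_mat (1\<^sub>m n :: 'a mat)"
    unfolding invertible_mat_def by auto
  then show ?thesis by (simp add: GL_def)
qed

lemma GL_nonempty: "GL n \<noteq> {}"
  using one_mat_in_GL by blast

lemma finite_GL: "finite (GL n :: 'a :: {field, finite} mat set)"
proof (rule finite_subset)
  let ?I = "{..<n} \<times> {..<n}"
  let ?F = "Pi\<^sub>E ?I (\<lambda>_. UNIV :: 'a set)"
  show "(GL n :: 'a mat set) \<subseteq> (\<lambda>f. mat n n f) ` ?F"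
  proof
    fix A :: "'a mat" assume "A \<in> GL n"
    then have A: "A \<in> carrier_mat n n" by (simp add: GL_def)
    have "A = mat n n (restrict (\<lambda>ij. A $$ ij) ?I)"
      using A by (intro eq_matI) auto
    then show "A \<in> (\<lambda>f. mat n n f) ` ?F" by (rule image_eqI[where x = "restrict (\<lambda>ij. A $$ ij) ?I"]) simp
  qed
  show "finite ((\<lambda>f. mat n n f) ` ?F)"
    by (intro finite_imageI finite_PiE) auto
qed

definition trace_power_pmf :: "nat \<Rightarrow> nat \<Rightarrow> 'a :: {field, finite} pmf" where
  "trace_power_pmf n k = map_pmf (\<lambda>g. trace_mat (g ^\<^sub>m k)) (pmf_of_set (GL n))"

end

theory Submission
  imports Defs "HOL-Algebra.Algebraic_Closure_Type" "Jordan_Normal_Form.Determinant"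
    "HOL-Real_Asymp.Real_Asymp"
begin

text \<open>
  Write \<open>q = CARD('a)\<close> and let \<open>x\<close> be an element of exact degree \<open>d\<close> over the field \<open>F\<close> with \<open>q\<close> elements,
  with companion matrix \<open>C\<close>. For a uniformly random \<open>g\<close> in \<open>GL n\<close>, let \<open>Y x g\<close> count the injective
  \<open>n \<times> d\<close> matrices \<open>A\<close> with \<open>g A = A C\<close>. Conjugating \<open>g\<close> into block triangular form with diagonal blocks
  \<open>C\<close> and \<open>h\<close> in \<open>GL (n - d)\<close> shows that \<open>Y x\<close> has mean 1 and that, after weighting by \<open>Y x\<close>, the trace of \<open>g ^ k\<close> is
  distributed as the trace of \<open>C ^ k\<close>, which is the field trace of \<open>x ^ k\<close>, plus that of \<open>h ^ k\<close>.
  The weight \<open>Y x * Y y\<close> has mean at most 1, unless \<open>x\<close> and \<open>y\<close> are conjugate, where an extra \<open>q ^ d\<close> appears.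
  Hence the sum of \<open>Y x / (d (q ^ d - 1))\<close> over all admissible \<open>d\<close> and all \<open>x\<close> of degree \<open>d\<close> has mean close to
  \<open>L = \<Sum> 1 / d\<close> and variance \<open>O(L)\<close>, so as \<open>L\<close> tends to infinity it is concentrated, and weighting by it does not change
  the limit law of the trace. Under the weighted law the trace is nearly uniform, because
  the field trace of \<open>x ^ k\<close> is: \<open>gcd k (q ^ d - 1) < q powr (d / 3)\<close> makes the group of \<open>k\<close>-th powers large
  enough for a second moment bound.
\<close>



section \<open>Finite extensions of a finite field\<close>

text \<open>\<open>Y x g\<close> is one less than the number of vectors killed by the minimal
  polynomial of \<open>x\<close> evaluated at \<open>g\<close>, so it equals
  \<open>q ^ d - 1\<close> when that kernel has dimension \<open>d\<close>. An irreducible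
  polynomial of degree \<open>d\<close> has \<open>d\<close> roots, so the normalisation
  \<open>1 / (d (q ^ d - 1))\<close> makes the weighted sum a substitute for the number of
  irreducible factors of admissible degree in the characteristic polynomial. Counting injective
  matrices rather than factors gives exact means: \<open>GL n\<close> acts transitively on such
  matrices, so every sum over \<open>g\<close> reduces to a single stabiliser. The scales fit
  together because the error in degree \<open>d\<close>, relative to \<open>q ^ d\<close>, has order
  at most \<open>q powr (d / 3) * q powr (d / 2) / q ^ d\<close>, that is
  \<open>q powr (- d / 6)\<close>. For \<open>d > 12 * log q n\<close> this is at most
  \<open>1 / n\<close>, so over at most \<open>n\<close> degrees the total error stays bounded while
  \<open>L\<close> diverges.\<close>

lemma finite_field_card_gt_1: "CARD('a :: {field, finite}) > 1"
proof -
  have "card {0, 1 :: 'a} \<le> CARD('a)"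
    by (intro card_mono) auto
  then show ?thesis by simp
qed

lemma finite_field_power_card:
  fixes x :: "'a :: {field, finite}"
  shows "x ^ CARD('a) = x"
proof (cases "x = 0")
  case False
  have "(\<Prod>y\<in>UNIV-{0}. x * y) = (\<Prod>y\<in>UNIV-{0::'a}. y)"
    by (rule prod.reindex_bij_witness[of _ "\<lambda>y. y / x" "\<lambda>y. x * y"]) (use False in auto)
  then have "x ^ (CARD('a) - 1) = 1"
    by (simp add: prod.distrib)
  then have "x ^ Suc (CARD('a) - 1) = x"
    unfolding power_Suc by simp
  then show ?thesis by (simp del: power_Suc)
qed auto

text \<open>\<open>(X + 1) ^ q - X ^ q - 1\<close> has degree less than \<open>q\<close> and vanishes on all of the field.\<close>
lemma finite_field_binomial_eq_0:
  assumes "0 < i" "i < CARD('a :: {field, finite})"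
  shows "of_nat (CARD('a) choose i) = (0 :: 'a)"
proof -
  let ?q = "CARD('a)"
  define f :: "'a poly" where "f = (\<Sum>i\<in>{1..<?q}. Polynomial.monom (of_nat (?q choose i)) i)"
  have "poly f x = 0" for x
  proof -
    have "(x + 1) ^ ?q = (\<Sum>i\<le>?q. of_nat (?q choose i) * x ^ i)"
      by (simp add: binomial_ring)
    also have "{..?q} = insert 0 (insert ?q {1..<?q})"
      using finite_field_card_gt_1[where 'a='a] by auto
    also have "(\<Sum>i\<in>\<dots>. of_nat (?q choose i) * x ^ i) = 1 + (x ^ ?q + (\<Sum>i\<in>{1..<?q}. of_nat (?q choose i) * x ^ i))"
      using finite_field_card_gt_1[where 'a='a] by (subst sum.insert; auto)+
    finally have "(\<Sum>i\<in>{1..<?q}. of_nat (?q choose i) * x ^ i) = 0"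
      by (simp add: finite_field_power_card)
    then show ?thesis by (simp add: f_def poly_sum poly_monom)
  qed
  moreover have "Polynomial.degree f < ?q"
    unfolding f_def
    by (intro degree_sum_less) (auto intro: le_less_trans[OF degree_monom_le])
  ultimately have "f = 0"
    using card_poly_roots_bound[of f] by force
  moreover have "Polynomial.coeff f i = of_nat (?q choose i)"
  proof -
    have "Polynomial.coeff f i = (\<Sum>j\<in>{1..<?q}. if j = i then of_nat (?q choose j) else 0)"
      by (simp add: f_def coeff_sum)
    also have "\<dots> = of_nat (?q choose i)"
      using assms by simp
    finally show ?thesis .
  qed
  ultimately show ?thesis by simp
qed

section \<open>Frobenius powers and the finite subfields they fix\<close>

lemma frobenius_add:
  fixes x y :: "'a :: {field, finite} alg_closure"
  shows "(x + y) ^ CARD('a) = x ^ CARD('a) + y ^ CARD('a)"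
proof -
  let ?q = "CARD('a)"
  \<comment> \<open>Working with \<open>q\<close> itself avoids the prime characteristic: the
    coefficients already vanish in the base field, and \<open>to_ac\<close> carries this to the
    closure.\<close>
  have z: "of_nat (?q choose i) = (0 :: 'a alg_closure)" if "i \<in> {1..<?q}" for i
    using finite_field_binomial_eq_0[of i, where 'a='a] that
    by (metis atLeastLessThan_iff less_eq_Suc_le One_nat_def to_ac_0 to_ac_of_nat)
  have "(x + y) ^ ?q = (\<Sum>i\<le>?q. of_nat (?q choose i) * x ^ i * y ^ (?q - i))"
    by (simp add: binomial_ring)
  also have "{..?q} = insert 0 (insert ?q {1..<?q})"
    using finite_field_card_gt_1[where 'a='a] by auto
  also have "(\<Sum>i\<in>\<dots>. of_nat (?q choose i) * x ^ i * y ^ (?q - i))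
      = y ^ ?q + (x ^ ?q + (\<Sum>i\<in>{1..<?q}. of_nat (?q choose i) * x ^ i * y ^ (?q - i)))"
    using finite_field_card_gt_1[where 'a='a] by (subst sum.insert; auto)+
  also have "(\<Sum>i\<in>{1..<?q}. of_nat (?q choose i) * x ^ i * y ^ (?q - i)) = 0"
    by (intro sum.neutral) (use z in auto)
  finally show ?thesis by simp
qed

lemma frobenius_power_add:
  fixes x y :: "'a :: {field, finite} alg_closure"
  shows "(x + y) ^ (CARD('a) ^ d) = x ^ (CARD('a) ^ d) + y ^ (CARD('a) ^ d)"
proof (induction d)
  case (Suc d)
  have "z ^ (CARD('a) ^ Suc d) = (z ^ (CARD('a) ^ d)) ^ CARD('a)" for z :: "'a alg_closure"
    by (simp add: mult.commute flip: power_mult)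
  then show ?case by (simp add: Suc frobenius_add)
qed simp

lemma frobenius_power_sum:
  fixes f :: "'b \<Rightarrow> 'a :: {field, finite} alg_closure"
  shows "(\<Sum>i\<in>I. f i) ^ (CARD('a) ^ d) = (\<Sum>i\<in>I. f i ^ (CARD('a) ^ d))"
  by (induction I rule: infinite_finite_induct) (simp_all add: frobenius_power_add power_0_left)

lemma frobenius_power_diff:
  fixes x y :: "'a :: {field, finite} alg_closure"
  shows "(x - y) ^ (CARD('a) ^ d) = x ^ (CARD('a) ^ d) - y ^ (CARD('a) ^ d)"
  using frobenius_power_add[of "x - y" y d] by simp

lemma frobenius_power_inject:
  fixes x y :: "'a :: {field, finite} alg_closure"
  assumes "x ^ (CARD('a) ^ d) = y ^ (CARD('a) ^ d)"
  shows "x = y"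
  using frobenius_power_diff[of x y d] assms by simp

text \<open>All finite extensions sit inside one algebraic closure as fixed points of a Frobenius
  power, so different degrees can be compared without embeddings. The copy of the base field is
  \<open>ext_field 1\<close>. For \<open>d = 0\<close> the set is the whole closure, hence the
  assumption \<open>d > 0\<close> in the counting results.\<close>

definition ext_field :: "nat \<Rightarrow> 'a :: {field, finite} alg_closure set" where
  "ext_field d = {x. x ^ (CARD('a) ^ d) = x}"

lemma ext_field_iff: "x \<in> ext_field d \<longleftrightarrow> x ^ (CARD('a) ^ d) = x"
  for x :: "'a :: {field, finite} alg_closure"
  by (simp add: ext_field_def)

lemma
  shows zero_in_ext_field [simp]: "0 \<in> ext_field d"
    and one_in_ext_field [simp]: "1 \<in> ext_field d"
    and ext_field_add: "x \<in> ext_field d \<Longrightarrow> y \<in> ext_field d \<Longrightarrow> x + y \<in> ext_field d"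
    and ext_field_diff: "x \<in> ext_field d \<Longrightarrow> y \<in> ext_field d \<Longrightarrow> x - y \<in> ext_field d"
    and ext_field_mult: "x \<in> ext_field d \<Longrightarrow> y \<in> ext_field d \<Longrightarrow> x * y \<in> ext_field d"
    and ext_field_divide: "x \<in> ext_field d \<Longrightarrow> y \<in> ext_field d \<Longrightarrow> x / y \<in> ext_field d"
    and ext_field_power: "x \<in> ext_field d \<Longrightarrow> x ^ j \<in> ext_field d"
  by (auto simp: ext_field_iff frobenius_power_add frobenius_power_diff power_mult_distrib
      power_divide power_0_left simp flip: power_mult simp: power_mult[of x _ j] mult.commute[of j])

lemma to_ac_in_ext_field: "to_ac c \<in> ext_field d" for c :: "'a :: {field, finite}"
proof -
  have "c ^ (CARD('a) ^ d) = c"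
    by (induction d) (simp_all add: power_mult finite_field_power_card)
  then show ?thesis
    by (metis ext_field_iff to_ac_power)
qed

lemma ext_field_sum: "(\<And>i. i \<in> I \<Longrightarrow> f i \<in> ext_field d) \<Longrightarrow> (\<Sum>i\<in>I. f i) \<in> ext_field d"
  by (induction I rule: infinite_finite_induct) (auto intro: ext_field_add)

lemma ext_field_mult_degree: "x \<in> ext_field d \<Longrightarrow> x \<in> ext_field (d * j)"
  by (induction j) (auto simp: ext_field_iff power_add power_mult)

lemma card_power_eq_self_le:
  fixes m :: nat
  assumes "m > 1"
  shows "finite {x :: 'b :: field. x ^ m = x}" "card {x :: 'b. x ^ m = x} \<le> m"
proof -
  define f :: "'b poly" where "f = Polynomial.monom 1 m - Polynomial.monom 1 1"
  have deg: "Polynomial.degree f = m"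
    unfolding f_def diff_conv_add_uminus
    using assms by (subst degree_add_eq_left) (simp_all add: degree_monom_eq)
  then have "f \<noteq> 0" using assms by auto
  moreover have "{x. x ^ m = x} = {x. poly f x = 0}"
    by (auto simp: f_def poly_monom)
  ultimately show "finite {x :: 'b :: field. x ^ m = x}" "card {x :: 'b. x ^ m = x} \<le> m"
    using card_poly_roots_bound[of f] poly_roots_finite[of f] deg by auto
qed

lemma card_power_gt_1: "d > 0 \<Longrightarrow> CARD('a :: {field, finite}) ^ d > 1"
  using finite_field_card_gt_1[where 'a='a] by (metis one_less_power)

lemma finite_ext_field: "d > 0 \<Longrightarrow> finite (ext_field d :: 'a :: {field, finite} alg_closure set)"
  unfolding ext_field_def using card_power_gt_1[of d, where 'a='a] by (intro card_power_eq_self_le)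

text \<open>\<open>X ^ (q ^ d) - X\<close> splits into linear factors over the closure, and its
  derivative is the constant \<open>-1\<close>, so no factor is repeated and there are exactly as
  many roots as the degree.\<close>

lemma card_ext_field:
  assumes "d > 0"
  shows "card (ext_field d :: 'a :: {field, finite} alg_closure set) = CARD('a) ^ d"
proof -
  define m where "m = CARD('a) ^ d"
  have m: "m > 1" using card_power_gt_1[OF assms] by (simp add: m_def)
  define f :: "'a alg_closure poly" where "f = Polynomial.monom 1 m - Polynomial.monom 1 1"
  have deg: "Polynomial.degree f = m"
    unfolding f_def diff_conv_add_uminus
    using m by (subst degree_add_eq_left) (simp_all add: degree_monom_eq)
  then have f0: "f \<noteq> 0" using m by auto
  have lead: "Polynomial.lead_coeff f = 1"
    unfolding deg using m by (simp add: f_def)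
  \<comment> \<open>The case \<open>i = 1\<close> of the vanishing of binomial coefficients.\<close>
  have "of_nat CARD('a) = (0 :: 'a)"
    using finite_field_binomial_eq_0[of 1, where 'a='a] finite_field_card_gt_1[where 'a='a] by simp
  then have "of_nat CARD('a) = (0 :: 'a alg_closure)"
    by (metis to_ac_0 to_ac_of_nat)
  then have "of_nat m = (0 :: 'a alg_closure)"
    using assms by (simp add: m_def)
  then have pd: "pderiv f = -1"
    by (simp add: f_def pderiv_diff pderiv_monom monom_0 one_pCons)
  obtain A where A: "size A = m" "f = (\<Prod>x\<in>#A. [:-x, 1:])"
    using alg_closed_imp_factorization[OF f0] deg lead by auto
  have "count A x \<le> 1" for x
  proof (rule ccontr)
    assume "\<not> count A x \<le> 1"
    then have "count A x \<ge> 2" by simp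
    then have "{#x, x#} \<subseteq># A"
      by (simp add: subseteq_mset_def)
    then obtain B where "A = {#x, x#} + B"
      by (metis mset_subset_eq_exists_conv)
    then have "f = [:-x, 1:] * ([:-x, 1:] * (\<Prod>x\<in>#B. [:-x, 1:]))"
      using A(2) by simp
    then have "poly (pderiv f) x = 0"
      by (simp only: pderiv_mult) simp
    then show False by (simp add: pd)
  qed
  then have "count A x = 1" if "x \<in> set_mset A" for x
    using that by (metis count_greater_eq_one_iff le_antisym)
  then have "card (set_mset A) = m"
    using A(1) by (simp add: size_multiset_overloaded_eq)
  moreover have "set_mset A = {x. poly f x = 0}"
    by (auto simp: A(2) poly_prod_mset)
  moreover have "{x. poly f x = 0} = ext_field d"
    by (auto simp: f_def poly_monom ext_field_def m_def)
  ultimately show ?thesis by (simp add: m_def)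
qed


section \<open>The field trace and the sizes of its fibres\<close>

definition ext_trace :: "nat \<Rightarrow> 'a :: {field, finite} alg_closure \<Rightarrow> 'a alg_closure" where
  "ext_trace d x = (\<Sum>i<d. x ^ (CARD('a) ^ i))"

lemma ext_trace_add: "ext_trace d (x + y) = ext_trace d x + ext_trace d y"
  by (simp add: ext_trace_def frobenius_power_add sum.distrib)

lemma ext_trace_diff: "ext_trace d (x - y) = ext_trace d x - ext_trace d y"
  by (simp add: ext_trace_def frobenius_power_diff sum_subtractf)

lemma ext_trace_scale:
  fixes c :: "'a :: {field, finite} alg_closure"
  assumes "c \<in> ext_field 1"
  shows "ext_trace d (c * x) = c * ext_trace d x"
proof -
  have "c ^ (CARD('a) ^ i) = c" for i
    using ext_field_mult_degree[OF assms, of i] by (simp add: ext_field_iff)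
  then show ?thesis
    by (simp add: ext_trace_def power_mult_distrib sum_distrib_left)
qed

lemma ext_trace_in_ext_field_1:
  fixes x :: "'a :: {field, finite} alg_closure"
  assumes "x \<in> ext_field d"
  shows "ext_trace d x \<in> ext_field 1"
proof -
  have "ext_trace d x ^ CARD('a) = (\<Sum>i<d. (x ^ (CARD('a) ^ i)) ^ CARD('a))"
    unfolding ext_trace_def using frobenius_power_sum[where d=1 and 'a='a] by simp
  also have "\<dots> = (\<Sum>i<d. x ^ (CARD('a) ^ Suc i))"
    by (simp add: mult.commute flip: power_mult)
  also have "\<dots> = (\<Sum>i<Suc d. x ^ (CARD('a) ^ i)) - x"
    by (subst sum.lessThan_Suc_shift) simp
  also have "\<dots> = ext_trace d x"
    using assms by (simp add: ext_trace_def ext_field_iff)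
  finally show ?thesis by (simp add: ext_field_iff)
qed

text \<open>As a polynomial the trace is nonzero of degree below \<open>q ^ d\<close>, so it cannot
  vanish on the whole field. A nonzero value lies in the base field and can be scaled to 1; division
  by \<open>s\<close> then yields \<open>b\<close>.\<close>

lemma ext_trace_surj:
  fixes s :: "'a :: {field, finite} alg_closure"
  assumes "d > 0" "s \<in> ext_field d" "s \<noteq> 0"
  shows "\<exists>b\<in>ext_field d. ext_trace d (b * s) = 1"
proof -
  let ?q = "CARD('a)"
  define f :: "'a alg_closure poly" where "f = (\<Sum>i<d. Polynomial.monom 1 (?q ^ i))"
  have "Polynomial.coeff f 1 = (\<Sum>i<d. if i = 0 then 1 else 0)"
    unfolding f_def coeff_sum coeff_monom using finite_field_card_gt_1[where 'a='a]
    by (intro sum.cong) auto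
  also have "\<dots> = 1" using assms by simp
  finally have "f \<noteq> 0" by auto
  moreover have "Polynomial.degree f < ?q ^ d"
    unfolding f_def using finite_field_card_gt_1[where 'a='a]
    by (intro degree_sum_less) (auto intro!: le_less_trans[OF degree_monom_le] power_strict_increasing)
  ultimately have "card {x. poly f x = 0} < card (ext_field d :: 'a alg_closure set)"
    using card_poly_roots_bound[of f] assms by (simp add: card_ext_field)
  then have "\<not> ext_field d \<subseteq> {x. poly f x = 0}"
    using poly_roots_finite[OF \<open>f \<noteq> 0\<close>] by (meson card_mono leD)
  then obtain x :: "'a alg_closure" where x: "x \<in> ext_field d" "ext_trace d x \<noteq> 0"
    by (auto simp: f_def poly_sum poly_monom ext_trace_def)
  have c: "1 / ext_trace d x \<in> ext_field 1"
    by (intro ext_field_divide ext_trace_in_ext_field_1 x one_in_ext_field)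
  moreover have "1 / ext_trace d x \<in> ext_field d"
    using ext_field_mult_degree[OF c, of d] by simp
  ultimately have "1 / ext_trace d x * x / s \<in> ext_field d"
    using x assms by (intro ext_field_mult ext_field_divide[of _ d s])
  moreover have "ext_trace d (1 / ext_trace d x * x / s * s) = 1"
    using x assms ext_trace_scale[OF c, of d x] by auto
  ultimately show ?thesis by blast
qed

text \<open>Translating by base field multiples of \<open>u\<close> shifts \<open>\<phi>\<close>
  through all base field values, so its fibres over \<open>S\<close> are in bijection.
  \<open>S\<close> is kept general because the argument is applied first to the whole field and then
  inside a trace fibre.\<close>

lemma card_translation_fibre:
  fixes S :: "'a :: {field, finite} alg_closure set"
  assumes S: "finite S" "\<And>b. b \<in> S \<Longrightarrow> \<phi> b \<in> ext_field 1"
    and tr: "\<And>b c. b \<in> S \<Longrightarrow> c \<in> ext_field 1 \<Longrightarrow> b + c * u \<in> S \<and> \<phi> (b + c * u) = \<phi> b + c"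
    and y: "y \<in> ext_field 1"
  shows "CARD('a) * card {b \<in> S. \<phi> b = y} = card S"
proof -
  have *: "card {b \<in> S. \<phi> b = z} = card {b \<in> S. \<phi> b = y}" if z: "z \<in> ext_field 1" for z
  proof (rule bij_betw_same_card, rule bij_betwI[where g = "\<lambda>b. b + (z - y) * u"])
    show "(\<lambda>b. b + (y - z) * u) \<in> {b \<in> S. \<phi> b = z} \<rightarrow> {b \<in> S. \<phi> b = y}"
      "(\<lambda>b. b + (z - y) * u) \<in> {b \<in> S. \<phi> b = y} \<rightarrow> {b \<in> S. \<phi> b = z}"
      using tr[of _ "y - z"] tr[of _ "z - y"] ext_field_diff[OF y z] ext_field_diff[OF z y] by auto
  qed (auto simp: algebra_simps)
  have "S = (\<Union>z\<in>ext_field 1. {b \<in> S. \<phi> b = z})"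
    using S by auto
  then have "card S = card (\<Union>z\<in>ext_field 1. {b \<in> S. \<phi> b = z})"
    by (rule arg_cong[of _ _ card])
  also have "\<dots> = (\<Sum>z\<in>ext_field 1. card {b \<in> S. \<phi> b = z})"
    using S by (intro card_UN_disjoint) (auto intro: finite_ext_field)
  also have "\<dots> = CARD('a) * card {b \<in> S. \<phi> b = y}"
    using * card_ext_field[of 1, where 'a='a] by simp
  finally show ?thesis ..
qed

lemma card_ext_trace_fibre:
  fixes s :: "'a :: {field, finite} alg_closure"
  assumes d: "d > 0" and s: "s \<in> ext_field d" "s \<noteq> 0" and y: "y \<in> ext_field 1"
  shows "CARD('a) * card {b \<in> ext_field d. ext_trace d (b * s) = y} = CARD('a) ^ d"
proof -
  obtain u where u: "u \<in> ext_field d" "ext_trace d (u * s) = 1"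
    using ext_trace_surj[OF d s] by auto
  have "c \<in> ext_field d" if "c \<in> ext_field 1" for c :: "'a alg_closure"
    using ext_field_mult_degree[OF that, of d] by simp
  then have "b + c * u \<in> ext_field d \<and> ext_trace d ((b + c * u) * s) = ext_trace d (b * s) + c"
    if "b \<in> ext_field d" "c \<in> ext_field 1" for b c :: "'a alg_closure"
    using that u by (simp add: ext_field_add ext_field_mult distrib_right ext_trace_add mult.assoc ext_trace_scale)
  moreover have "ext_trace d (b * s) \<in> ext_field 1" if "b \<in> ext_field d" for b
    using that s by (intro ext_trace_in_ext_field_1 ext_field_mult)
  ultimately have "CARD('a) * card {b \<in> ext_field d. ext_trace d (b * s) = y} = card (ext_field d :: 'a alg_closure set)"
    using finite_ext_field[OF d] y by (intro card_translation_fibre[where u = u])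
  then show ?thesis using d by (simp add: card_ext_field)
qed

text \<open>Traces against two elements that are independent over the base field are jointly
  uniform. The proof needs a direction \<open>v\<close> that leaves the trace against
  \<open>s\<close> fixed and moves the trace against \<open>t\<close> by 1; the fibre argument then
  runs inside the fibre of \<open>s\<close>.\<close>

lemma card_ext_trace_fibre_2:
  fixes s t :: "'a :: {field, finite} alg_closure"
  assumes d: "d > 0" and s: "s \<in> ext_field d" "s \<noteq> 0" and t: "t \<in> ext_field d"
    and indep: "\<And>c. c \<in> ext_field 1 \<Longrightarrow> t \<noteq> c * s" and y: "y \<in> ext_field 1"
  shows "CARD('a) ^ 2 * card {b \<in> ext_field d. ext_trace d (b * s) = y \<and> ext_trace d (b * t) = y} = CARD('a) ^ d"
proof -
  have sub: "c \<in> ext_field d" if "c \<in> ext_field 1" for c :: "'a alg_closure"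
    using ext_field_mult_degree[OF that, of d] by simp
  obtain u where u: "u \<in> ext_field d" "ext_trace d (u * s) = 1"
    using ext_trace_surj[OF d s] by auto
  define c where "c = ext_trace d (u * t)"
  have c: "c \<in> ext_field 1"
    unfolding c_def using u t by (intro ext_trace_in_ext_field_1 ext_field_mult)
  have "t - c * s \<in> ext_field d" "t - c * s \<noteq> 0"
    using indep[OF c] s t sub[OF c] by (auto intro!: ext_field_diff ext_field_mult)
  then obtain w where w: "w \<in> ext_field d" "ext_trace d (w * (t - c * s)) = 1"
    using ext_trace_surj[OF d] by blast
  \<comment> \<open>A Gram-Schmidt correction: subtracting a multiple of \<open>u\<close> removes
    the trace against \<open>s\<close>. As \<open>u\<close> has trace \<open>c\<close> against
    \<open>t\<close>, the trace of \<open>v\<close> against \<open>t\<close> is that of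
    \<open>w\<close> against \<open>t - c * s\<close>, namely 1.\<close>
  define v where "v = w - ext_trace d (w * s) * u"
  have tw: "ext_trace d (w * s) \<in> ext_field 1"
    using w s by (intro ext_trace_in_ext_field_1 ext_field_mult)
  have v: "v \<in> ext_field d"
    unfolding v_def using w u sub[OF tw] by (auto intro!: ext_field_diff ext_field_mult)
  have vs: "ext_trace d (v * s) = 0"
    using u by (simp add: v_def left_diff_distrib ext_trace_diff mult.assoc ext_trace_scale[OF tw])
  have "ext_trace d (w * t) - c * ext_trace d (w * s) = 1"
    using w by (simp add: right_diff_distrib ext_trace_diff mult.left_commute[of w] ext_trace_scale[OF c])
  then have vt: "ext_trace d (v * t) = 1"
    by (simp add: v_def left_diff_distrib ext_trace_diff mult.assoc ext_trace_scale[OF tw] c_def[symmetric] mult.commute[of c])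
  define S where "S = {b \<in> ext_field d. ext_trace d (b * s) = y}"
  have "finite S"
    unfolding S_def using finite_ext_field[OF d, where 'a='a] by simp
  moreover have "b + c * v \<in> S \<and> ext_trace d ((b + c * v) * t) = ext_trace d (b * t) + c"
    if "b \<in> S" "c \<in> ext_field 1" for b c :: "'a alg_closure"
    using that v vs vt sub[OF that(2)]
    by (simp add: S_def ext_field_add ext_field_mult distrib_right ext_trace_add mult.assoc ext_trace_scale)
  moreover have "ext_trace d (b * t) \<in> ext_field 1" if "b \<in> S" for b
    using that t unfolding S_def by (intro ext_trace_in_ext_field_1 ext_field_mult) auto
  ultimately have "CARD('a) * card {b \<in> S. ext_trace d (b * t) = y} = card S"
    using y by (intro card_translation_fibre[where u = v])
  moreover have "CARD('a) * card S = CARD('a) ^ d"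
    unfolding S_def by (rule card_ext_trace_fibre[OF d s y])
  moreover have "{b \<in> S. ext_trace d (b * t) = y}
      = {b \<in> ext_field d. ext_trace d (b * s) = y \<and> ext_trace d (b * t) = y}"
    by (auto simp: S_def)
  ultimately show ?thesis by (simp add: power2_eq_square mult.assoc)
qed

section \<open>The trace on \<open>k\<close>-th powers\<close>

lemma card_power_eq_le:
  fixes a :: "'b :: field"
  assumes fin: "finite K" and K: "\<And>x y. x \<in> K \<Longrightarrow> y \<in> K \<Longrightarrow> x / y \<in> K" "0 \<notin> K"
  shows "card {x \<in> K. x ^ k = a} \<le> card {x \<in> K. x ^ k = 1}"
proof (cases "{x \<in> K. x ^ k = a} = {}")
  case False
  then obtain w where w: "w \<in> K" "w ^ k = a" by auto
  then have "w \<noteq> 0" using K by auto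
  \<comment> \<open>Dividing by one solution \<open>w\<close> moves the fibre of the power map into
    its kernel.\<close>
  show ?thesis
    by (rule card_inj_on_le[where f = "\<lambda>x. x / w"])
       (use w \<open>w \<noteq> 0\<close> K fin in \<open>auto simp: inj_on_def power_divide\<close>)
next
  case True
  then show ?thesis by (metis card.empty le0)
qed

text \<open>Bezout combines \<open>x ^ k = 1\<close> with \<open>x ^ (q ^ d - 1) = 1\<close> into
  \<open>x ^ g = 1\<close> for the gcd \<open>g\<close>. The root bound for
  \<open>x ^ Suc g = x\<close> counts 0 as well, which is why 0 is inserted.\<close>

lemma card_ext_field_roots_of_unity_le:
  assumes d: "d > 0" and k: "k > 0"
  shows "card {x \<in> ext_field d - {0 :: 'a :: {field, finite} alg_closure}. x ^ k = 1}
      \<le> gcd k (CARD('a) ^ d - 1)"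
proof -
  define g where "g = gcd k (CARD('a) ^ d - 1)"
  have g: "g > 0" using k by (simp add: g_def)
  have "x ^ g = 1" if "x \<in> ext_field d - {0}" "x ^ k = 1" for x :: "'a alg_closure"
  proof -
    have "x ^ (CARD('a) ^ d - 1) * x = x"
      using that by (simp add: ext_field_iff flip: power_Suc2)
    then have x1: "x ^ (CARD('a) ^ d - 1) = 1"
      using that by simp
    obtain a b where ab: "k * a = (CARD('a) ^ d - 1) * b + g"
      using bezout_nat[of k "CARD('a) ^ d - 1"] k by (auto simp: g_def)
    have "x ^ (k * a) = 1" "x ^ ((CARD('a) ^ d - 1) * b) = 1"
      by (simp_all add: power_mult that x1 del: One_nat_def)
    then show ?thesis unfolding ab power_add by simp
  qed
  then have sub: "insert 0 {x \<in> ext_field d - {0 :: 'a alg_closure}. x ^ k = 1} \<subseteq> {x. x ^ Suc g = x}"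
    by auto
  have "card (insert 0 {x \<in> ext_field d - {0 :: 'a alg_closure}. x ^ k = 1}) \<le> Suc g"
    using card_mono[OF _ sub] card_power_eq_self_le[of "Suc g", where 'b="'a alg_closure"] g by simp
  then show ?thesis
    using finite_ext_field[OF d, where 'a='a] by (simp add: g_def)
qed

text \<open>The number \<open>N b\<close> of nonzero \<open>x\<close> with \<open>ext_trace d (b * x ^ k) = y\<close> is constant on the \<open>k\<close>-th powers
  \<open>b\<close>, of which there are at least \<open>(q ^ d - 1) / m\<close>, so the variance of \<open>N\<close> over all \<open>b\<close> bounds the deviation
  of \<open>N 1\<close> from its mean.\<close>
lemma ext_trace_power_equidistribution:
  fixes y :: "'a :: {field, finite} alg_closure"
  assumes d: "d > 0" and k: "k > 0" and y: "y \<in> ext_field 1"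
  shows "(real (card {x \<in> ext_field d - {0}. ext_trace d (x ^ k) = y}) - (real CARD('a) ^ d - 1) / real CARD('a))\<^sup>2
      \<le> (real (gcd k (CARD('a) ^ d - 1)))\<^sup>2 * real CARD('a) ^ d"
proof -
  define K where "K = (ext_field d :: 'a alg_closure set)"
  define U where "U = K - {0}"
  define q where "q = real CARD('a)"
  define N where "N b = card {x \<in> U. ext_trace d (b * x ^ k) = y}" for b
  define m where "m = card {x \<in> U. x ^ k = 1}"
  have q: "q > 1" unfolding q_def using finite_field_card_gt_1[where 'a='a] by simp
  have fK: "finite K" unfolding K_def using d by (rule finite_ext_field)
  have fU: "finite U" unfolding U_def using fK by simp
  have cK: "real (card K) = q ^ d" unfolding K_def q_def using d by (simp add: card_ext_field)
  have cU: "real (card U) = q ^ d - 1"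
  proof -
    have "0 \<in> K" by (simp add: K_def)
    then have "card K = Suc (card U)"
      unfolding U_def using fK by (metis card.remove)
    then show ?thesis using cK by simp
  qed
  have UK: "x ^ k \<in> K" "x ^ k \<noteq> 0" if "x \<in> U" for x
    using that by (auto simp: U_def K_def intro: ext_field_power)
  have divU: "x / z \<in> U" "x * z \<in> U" if "x \<in> U" "z \<in> U" for x z
    using that by (auto simp: U_def K_def intro: ext_field_divide ext_field_mult)
  have roots: "card {x \<in> U. x ^ k = a} \<le> m" for a
    unfolding m_def using fU divU by (intro card_power_eq_le) (auto simp: U_def)
  have sum1: "(\<Sum>b\<in>K. real (N b)) = card U * (q ^ d / q)"
  proof -
    have "(\<Sum>b\<in>K. real (N b)) = (\<Sum>b\<in>K. \<Sum>x\<in>U. if ext_trace d (b * x ^ k) = y then 1 else 0)"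
      by (simp add: N_def fU sum.If_cases Int_def)
    also have "\<dots> = (\<Sum>x\<in>U. \<Sum>b\<in>K. if ext_trace d (b * x ^ k) = y then 1 else 0)"
      by (rule sum.swap)
    also have "\<dots> = (\<Sum>x\<in>U. real (card {b\<in>K. ext_trace d (b * x ^ k) = y}))"
      by (simp add: fK sum.If_cases Int_def)
    also have "\<dots> = (\<Sum>x\<in>U. q ^ d / q)"
    proof (rule sum.cong)
      fix x assume x: "x \<in> U"
      have "CARD('a) * card {b \<in> K. ext_trace d (b * x ^ k) = y} = CARD('a) ^ d"
        unfolding K_def by (rule card_ext_trace_fibre[OF d _ _ y]) (use UK[OF x] in \<open>simp_all add: K_def\<close>)
      then have "q * real (card {b \<in> K. ext_trace d (b * x ^ k) = y}) = q ^ d"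
        unfolding q_def by (simp only: flip: of_nat_mult of_nat_power)
      then show "real (card {b \<in> K. ext_trace d (b * x ^ k) = y}) = q ^ d / q"
        using q by (simp add: field_simps)
    qed simp
    finally show ?thesis by simp
  qed
  \<comment> \<open>Unless \<open>z ^ k\<close> is a base field multiple of \<open>x ^ k\<close>,
    the two conditions are independent. In the proportional case a single trace fibre is a
    sufficient bound, and the sum over \<open>c\<close> records that case.\<close>
  have pair: "real (card {b\<in>K. ext_trace d (b * x ^ k) = y \<and> ext_trace d (b * z ^ k) = y})
      \<le> q ^ d / q\<^sup>2 + (\<Sum>c\<in>ext_field 1. if z ^ k = c * x ^ k then q ^ d / q else 0)"
    (is "?L \<le> ?R") if x: "x \<in> U" and z: "z \<in> U" for x z
  proof (cases "\<exists>c\<in>ext_field 1. z ^ k = c * x ^ k")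
    case False
    have "CARD('a) ^ 2 * card {b\<in>K. ext_trace d (b * x ^ k) = y \<and> ext_trace d (b * z ^ k) = y} = CARD('a) ^ d"
      unfolding K_def
    proof (rule card_ext_trace_fibre_2[OF d _ _ _ _ y])
      show "z ^ k \<noteq> c * x ^ k" if "c \<in> ext_field 1" for c
        using False that by blast
    qed (use UK[OF x] UK[OF z] in \<open>simp_all add: K_def\<close>)
    then have "q\<^sup>2 * ?L = q ^ d"
      unfolding q_def by (simp only: flip: of_nat_mult of_nat_power)
    then have "?L = q ^ d / q\<^sup>2" using q by (simp add: field_simps)
    also have "\<dots> \<le> ?R" using q by (simp add: sum_nonneg)
    finally show ?thesis .
  next
    case True
    then obtain c where c: "c \<in> ext_field 1" "z ^ k = c * x ^ k" by auto
    have "CARD('a) * card {b \<in> K. ext_trace d (b * x ^ k) = y} = CARD('a) ^ d"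
      unfolding K_def by (rule card_ext_trace_fibre[OF d _ _ y]) (use UK[OF x] in \<open>simp_all add: K_def\<close>)
    then have "q * real (card {b \<in> K. ext_trace d (b * x ^ k) = y}) = q ^ d"
      unfolding q_def by (simp only: flip: of_nat_mult of_nat_power)
    then have e: "real (card {b \<in> K. ext_trace d (b * x ^ k) = y}) = q ^ d / q"
      using q by (simp add: field_simps)
    have "?L \<le> real (card {b \<in> K. ext_trace d (b * x ^ k) = y})"
      using fK by (intro of_nat_mono card_mono) auto
    also have "\<dots> = (if z ^ k = c * x ^ k then q ^ d / q else 0)"
      using c e by simp
    also have "\<dots> \<le> (\<Sum>c\<in>ext_field 1. if z ^ k = c * x ^ k then q ^ d / q else 0)"
      using c q finite_ext_field[of 1, where 'a='a]
      by (intro member_le_sum[where f = "\<lambda>c. if z ^ k = c * x ^ k then q ^ d / q else 0"]) auto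
    also have "\<dots> \<le> ?R" using q by simp
    finally show ?thesis .
  qed
  \<comment> \<open>For each \<open>x\<close> and each of the \<open>q\<close> scalars
    \<open>c\<close>, at most \<open>m\<close> values of \<open>z\<close> are proportional in this
    way; the factor \<open>q\<close> cancels the one in \<open>q ^ d / q\<close>.\<close>
  have deg: "(\<Sum>x\<in>U. \<Sum>z\<in>U. \<Sum>c\<in>ext_field 1. if z ^ k = c * x ^ k then q ^ d / q else 0) \<le> card U * (m * q ^ d)"
  proof -
    have "(\<Sum>x\<in>U. \<Sum>z\<in>U. \<Sum>c\<in>ext_field 1. if z ^ k = c * x ^ k then q ^ d / q else 0)
        = (\<Sum>x\<in>U. \<Sum>c\<in>ext_field 1. \<Sum>z\<in>U. if z ^ k = c * x ^ k then q ^ d / q else 0)"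
      by (intro sum.cong refl sum.swap)
    also have "\<dots> \<le> (\<Sum>x\<in>U. \<Sum>c\<in>(ext_field 1 :: 'a alg_closure set). m * (q ^ d / q))"
    proof (intro sum_mono)
      fix x c :: "'a alg_closure"
      have "(\<Sum>z\<in>U. if z ^ k = c * x ^ k then q ^ d / q else 0) = card {z \<in> U. z ^ k = c * x ^ k} * (q ^ d / q)"
        by (simp add: fU sum.If_cases Int_def)
      also have "\<dots> \<le> m * (q ^ d / q)"
        using roots q by (intro mult_right_mono) auto
      finally show "(\<Sum>z\<in>U. if z ^ k = c * x ^ k then q ^ d / q else 0) \<le> m * (q ^ d / q)" .
    qed
    also have "\<dots> = card U * (m * q ^ d)"
      using q by (simp add: card_ext_field q_def)
    finally show ?thesis .
  qed
  have sum2: "(\<Sum>b\<in>K. (real (N b))\<^sup>2) \<le> (card U)\<^sup>2 * (q ^ d / q\<^sup>2) + card U * (m * q ^ d)"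
  proof -
    have "(\<Sum>b\<in>K. (real (N b))\<^sup>2) = (\<Sum>b\<in>K. (\<Sum>x\<in>U. if ext_trace d (b * x ^ k) = y then 1 else 0)\<^sup>2)"
      by (simp add: N_def fU sum.If_cases Int_def)
    also have "\<dots> = (\<Sum>b\<in>K. \<Sum>x\<in>U. \<Sum>z\<in>U. if ext_trace d (b * x ^ k) = y \<and> ext_trace d (b * z ^ k) = y then 1 else 0)"
      unfolding power2_eq_square sum_product by (intro sum.cong) auto
    also have "\<dots> = (\<Sum>x\<in>U. \<Sum>z\<in>U. \<Sum>b\<in>K. if ext_trace d (b * x ^ k) = y \<and> ext_trace d (b * z ^ k) = y then 1 else 0)"
      by (subst sum.swap, rule sum.cong, rule refl, rule sum.swap)
    also have "\<dots> = (\<Sum>x\<in>U. \<Sum>z\<in>U. real (card {b\<in>K. ext_trace d (b * x ^ k) = y \<and> ext_trace d (b * z ^ k) = y}))"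
      by (simp add: fK sum.If_cases Int_def)
    also have "\<dots> \<le> (\<Sum>x\<in>U. \<Sum>z\<in>U. q ^ d / q\<^sup>2 + (\<Sum>c\<in>ext_field 1. if z ^ k = c * x ^ k then q ^ d / q else 0))"
      by (intro sum_mono pair)
    also have "\<dots> = (card U)\<^sup>2 * (q ^ d / q\<^sup>2) + (\<Sum>x\<in>U. \<Sum>z\<in>U. \<Sum>c\<in>ext_field 1. if z ^ k = c * x ^ k then q ^ d / q else 0)"
      by (simp add: sum.distrib power2_eq_square)
    finally show ?thesis using deg by simp
  qed
  have var: "(\<Sum>b\<in>K. (real (N b) - card U / q)\<^sup>2) \<le> card U * (m * q ^ d)"
  proof -
    define u where "u = real (card U)"
    have "(\<Sum>b\<in>K. (real (N b) - u / q)\<^sup>2) = (\<Sum>b\<in>K. (real (N b))\<^sup>2 - 2 * (u / q) * real (N b) + (u / q)\<^sup>2)"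
      by (intro sum.cong refl) (simp add: power2_eq_square algebra_simps)
    also have "\<dots> = (\<Sum>b\<in>K. (real (N b))\<^sup>2) - 2 * (u / q) * (\<Sum>b\<in>K. real (N b)) + card K * (u / q)\<^sup>2"
      by (simp only: sum.distrib sum_subtractf sum_constant flip: sum_distrib_left)
    also have "\<dots> = (\<Sum>b\<in>K. (real (N b))\<^sup>2) + (q ^ d * (u / q)\<^sup>2 - 2 * (u / q) * (u * (q ^ d / q)))"
      by (simp add: sum1 cK u_def)
    \<comment> \<open>This is the negative of the main term of \<open>sum2\<close>, so only the
      proportional pairs survive in the variance.\<close>
    also have "q ^ d * (u / q)\<^sup>2 - 2 * (u / q) * (u * (q ^ d / q)) = - (u\<^sup>2 * (q ^ d / q\<^sup>2))"
      by (simp add: power2_eq_square)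
    finally show ?thesis
      using sum2 by (simp add: u_def)
  qed
  define H where "H = (\<lambda>x. x ^ k) ` U"
  have H: "finite H" "H \<subseteq> K" using UK fU by (auto simp: H_def)
  have NH: "N b = N 1" if b: "b \<in> H" for b
  proof -
    obtain w where w: "w \<in> U" "b = w ^ k" using b by (auto simp: H_def)
    then have "w \<noteq> 0" by (auto simp: U_def)
    \<comment> \<open>The substitution replacing \<open>x\<close> by \<open>w * x\<close> absorbs
      \<open>b = w ^ k\<close> into the \<open>k\<close>-th power.\<close>
    show ?thesis unfolding N_def
      by (rule bij_betw_same_card[OF bij_betwI[where f = "\<lambda>x. w * x" and g = "\<lambda>x. x / w"]])
         (use w \<open>w \<noteq> 0\<close> divU in \<open>auto simp: power_mult_distrib power_divide\<close>)
  qed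
  have "card U = (\<Sum>b\<in>H. card {x \<in> U. x ^ k = b})"
  proof -
    have "U = (\<Union>b\<in>H. {x \<in> U. x ^ k = b})" by (auto simp: H_def)
    then have "card U = card (\<Union>b\<in>H. {x \<in> U. x ^ k = b})" by (rule arg_cong[of _ _ card])
    also have "\<dots> = (\<Sum>b\<in>H. card {x \<in> U. x ^ k = b})"
      using H fU by (intro card_UN_disjoint) auto
    finally show ?thesis .
  qed
  also have "\<dots> \<le> (\<Sum>b\<in>H. m)" by (intro sum_mono roots)
  finally have "card U \<le> card H * m" by simp
  then have UH: "real (card U) \<le> real (card H) * real m"
    using of_nat_mono[of "card U" "card H * m", where 'a=real] by simp
  have "1 \<in> U" by (simp add: U_def K_def)
  then have "1 \<in> H" unfolding H_def by (metis imageI power_one)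
  then have H0: "card H > 0" using H card_gt_0_iff by blast
  \<comment> \<open>The deviation at 1 occurs \<open>card H\<close> times in the variance. Dividing
    by \<open>card H\<close> and using \<open>card U \<le> card H * m\<close> leaves
    \<open>m\<^sup>2 * q ^ d\<close>.\<close>
  have "card H * (real (N 1) - card U / q)\<^sup>2 = (\<Sum>b\<in>H. (real (N b) - card U / q)\<^sup>2)"
    using NH by simp
  also have "\<dots> \<le> (\<Sum>b\<in>K. (real (N b) - card U / q)\<^sup>2)"
    using H fK by (intro sum_mono2) auto
  also have "\<dots> \<le> (card H * m) * (m * q ^ d)"
    using var mult_right_mono[OF UH, of "m * q ^ d"] q by simp
  finally have "(real (N 1) - card U / q)\<^sup>2 \<le> m\<^sup>2 * q ^ d"
    using H0 by (simp add: power2_eq_square mult_ac)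
  also have "\<dots> \<le> (real (gcd k (CARD('a) ^ d - 1)))\<^sup>2 * q ^ d"
    using card_ext_field_roots_of_unity_le[OF d k, where 'a='a] q
    by (intro mult_right_mono power_mono) (auto simp: m_def U_def K_def)
  finally show ?thesis
    unfolding cU by (simp add: N_def U_def K_def q_def)
qed


section \<open>Elements of exact degree and their conjugates\<close>

text \<open>Excluding 0 matters for \<open>d = 1\<close> and makes every companion matrix considered
  below invertible.\<close>

definition ext_gen :: "nat \<Rightarrow> 'a :: {field, finite} alg_closure set" where
  "ext_gen d = {x \<in> ext_field d. x \<noteq> 0 \<and> (\<forall>e. 0 < e \<and> e < d \<longrightarrow> x \<notin> ext_field e)}"

lemma ext_genD:
  assumes "x \<in> ext_gen d"
  shows "x \<in> ext_field d" "x \<noteq> 0" "0 < e \<Longrightarrow> e < d \<Longrightarrow> x \<notin> ext_field e"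
  using assms by (auto simp: ext_gen_def)

lemma ext_field_mod:
  fixes x :: "'a :: {field, finite} alg_closure"
  assumes "x \<in> ext_field d" "x \<in> ext_field e"
  shows "x \<in> ext_field (d mod e)"
proof -
  let ?q = "CARD('a)"
  have "?q ^ d = ?q ^ (e * (d div e)) * ?q ^ (d mod e)"
    by (simp flip: power_add)
  then have "x = (x ^ (?q ^ (e * (d div e)))) ^ (?q ^ (d mod e))"
    using assms(1) by (simp add: ext_field_iff flip: power_mult)
  also have "x ^ (?q ^ (e * (d div e))) = x"
    using ext_field_mult_degree[OF assms(2), of "d div e"] by (simp add: ext_field_iff)
  finally show ?thesis by (simp add: ext_field_iff)
qed

text \<open>The least positive \<open>e\<close> with \<open>x\<close> in \<open>ext_field e\<close>
  divides \<open>d\<close>, by reduction modulo \<open>e\<close>; being a proper divisor it is at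
  most \<open>d div 2\<close>.\<close>

lemma ext_field_proper_if_not_gen:
  fixes x :: "'a :: {field, finite} alg_closure"
  assumes d: "d > 0" and x: "x \<in> ext_field d - {0} - ext_gen d"
  shows "\<exists>e\<in>{1..d div 2}. x \<in> ext_field e"
proof -
  let ?P = "\<lambda>e. 0 < e \<and> x \<in> ext_field e"
  define e where "e = (LEAST e. ?P e)"
  obtain c where c: "?P c" "c < d"
    using x by (auto simp: ext_gen_def)
  have e: "?P e" unfolding e_def using c(1) by (rule LeastI)
  have "e \<le> c" unfolding e_def using c(1) by (rule Least_le)
  have "d mod e = 0"
  proof (rule ccontr)
    assume "d mod e \<noteq> 0"
    then have "?P (d mod e)" using ext_field_mod[of x d e] x e by auto
    then have "e \<le> d mod e" unfolding e_def by (rule Least_le)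
    then show False using e mod_less_divisor[of e d] by linarith
  qed
  then obtain j where j: "d = e * j" by auto
  moreover have "j \<noteq> 0" "j \<noteq> 1" using j d \<open>e \<le> c\<close> \<open>c < d\<close> by auto
  ultimately have "2 * e \<le> d" by (cases j) auto
  then show ?thesis using e by (intro bexI[of _ e]) auto
qed

text \<open>The union is taken over all degrees up to \<open>d div 2\<close>, not just divisors of
  \<open>d\<close>; since \<open>q \<ge> 2\<close>, the geometric sum is at most twice its last
  term.\<close>

lemma card_non_ext_gen_le:
  assumes d: "d > 0"
  shows "card (ext_field d - {0} - ext_gen d :: 'a :: {field, finite} alg_closure set) \<le> 2 * CARD('a) ^ (d div 2)"
proof -
  let ?q = "CARD('a)"
  have geo: "(\<Sum>e=1..h. ?q ^ e) \<le> 2 * ?q ^ h" for h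
  proof (induction h)
    case (Suc h)
    have "2 * ?q ^ h \<le> ?q * ?q ^ h"
      using finite_field_card_gt_1[where 'a='a] by (intro mult_right_mono) auto
    moreover have "(\<Sum>e=1..Suc h. ?q ^ e) = (\<Sum>e=1..h. ?q ^ e) + ?q * ?q ^ h" by simp
    ultimately show ?case using Suc unfolding power_Suc by linarith
  qed simp
  have "card (ext_field d - {0} - ext_gen d :: 'a alg_closure set)
      \<le> card (\<Union>e\<in>{1..d div 2}. ext_field e :: 'a alg_closure set)"
    using ext_field_proper_if_not_gen[OF d] by (intro card_mono finite_UN_I) (auto intro!: finite_ext_field)
  also have "\<dots> \<le> (\<Sum>e=1..d div 2. card (ext_field e :: 'a alg_closure set))"
    by (rule card_UN_le) simp
  also have "\<dots> = (\<Sum>e=1..d div 2. ?q ^ e)"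
    by (intro sum.cong) (auto simp: card_ext_field)
  also have "\<dots> \<le> 2 * ?q ^ (d div 2)" by (rule geo)
  finally show ?thesis .
qed

lemma inj_on_conjugates:
  fixes x :: "'a :: {field, finite} alg_closure"
  assumes x: "x \<in> ext_gen d"
  shows "inj_on (\<lambda>i. x ^ (CARD('a) ^ i)) {..<d}"
proof -
  let ?q = "CARD('a)"
  have "x ^ (?q ^ i) \<noteq> x ^ (?q ^ j)" if "i < j" "j < d" for i j
  proof
    assume eq: "x ^ (?q ^ i) = x ^ (?q ^ j)"
    have "?q ^ j = ?q ^ (j - i) * ?q ^ i" using that by (simp flip: power_add)
    then have "x ^ (?q ^ i) = (x ^ (?q ^ (j - i))) ^ (?q ^ i)"
      using eq by (simp flip: power_mult)
    then have "x = x ^ (?q ^ (j - i))" by (rule frobenius_power_inject)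
    then have "x \<in> ext_field (j - i)" by (simp add: ext_field_iff)
    then show False using ext_genD(3)[OF x, of "j - i"] that by auto
  qed
  then show ?thesis
    by (intro inj_onI) (metis lessThan_iff linorder_neqE_nat)
qed

section \<open>Coordinate vectors and minimal polynomials\<close>

lemma vec_eq_if_diff_eq_0:
  fixes u v :: "'a :: group_add vec"
  assumes "u \<in> carrier_vec d" "v \<in> carrier_vec d" "u - v = 0\<^sub>v d"
  shows "u = v"
proof (rule eq_vecI)
  fix i assume "i < dim_vec v"
  then have "vec_index (u - v) i = vec_index u i - vec_index v i" "vec_index (0\<^sub>v d) i = (0 :: 'a)"
    using assms(2) by auto
  then show "vec_index u i = vec_index v i" by (simp add: assms(3))
qed (use assms in auto)

text \<open>The vector is read as the coefficient list of a polynomial over the base field. For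
  \<open>x\<close> of degree \<open>d\<close> this gives coordinates on \<open>ext_field d\<close>
  in the basis of powers of \<open>x\<close>, in which multiplication by \<open>x\<close> becomes a
  matrix.\<close>

definition vec_eval :: "'a :: field vec \<Rightarrow> 'a alg_closure \<Rightarrow> 'a alg_closure" where
  "vec_eval z x = (\<Sum>j<dim_vec z. to_ac (z $ j) * x ^ j)"

lemma vec_eval_diff:
  "u \<in> carrier_vec d \<Longrightarrow> v \<in> carrier_vec d \<Longrightarrow> vec_eval (u - v) x = vec_eval u x - vec_eval v x"
  by (simp add: vec_eval_def left_diff_distrib sum_subtractf)

lemma vec_eval_add:
  "u \<in> carrier_vec d \<Longrightarrow> v \<in> carrier_vec d \<Longrightarrow> vec_eval (u + v) x = vec_eval u x + vec_eval v x"
  by (simp add: vec_eval_def distrib_right sum.distrib)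

lemma vec_eval_smult: "vec_eval (c \<cdot>\<^sub>v u) x = to_ac c * vec_eval u x"
  by (simp add: vec_eval_def sum_distrib_left mult.assoc)

lemma vec_eval_zero [simp]: "vec_eval (0\<^sub>v d) x = 0"
  by (simp add: vec_eval_def)

lemma vec_eval_in_ext_field: "x \<in> ext_field d \<Longrightarrow> vec_eval z x \<in> ext_field d"
  unfolding vec_eval_def by (intro ext_field_sum ext_field_mult ext_field_power to_ac_in_ext_field)

lemma vec_eval_frobenius:
  fixes x :: "'a :: {field, finite} alg_closure"
  shows "vec_eval z (x ^ (CARD('a) ^ i)) = vec_eval z x ^ (CARD('a) ^ i)"
proof -
  have "to_ac (z $ j) ^ (CARD('a) ^ i) = to_ac (z $ j)" for j
    using to_ac_in_ext_field[of "z $ j" i] by (simp add: ext_field_iff)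
  then show ?thesis
    unfolding vec_eval_def frobenius_power_sum
    by (simp add: power_mult_distrib mult.commute flip: power_mult)
qed

lemma poly_of_coeffs:
  fixes c :: "nat \<Rightarrow> 'b :: field" and d :: nat
  defines "f \<equiv> (\<Sum>j<d. Polynomial.monom (c j) j)"
  shows "poly f x = (\<Sum>j<d. c j * x ^ j)" "Polynomial.coeff f i = (if i < d then c i else 0)"
    "d > 0 \<Longrightarrow> Polynomial.degree f < d"
proof -
  show "poly f x = (\<Sum>j<d. c j * x ^ j)"
    by (simp add: f_def poly_sum poly_monom)
  have "Polynomial.coeff f i = (\<Sum>j<d. if j = i then c j else 0)"
    by (simp add: f_def coeff_sum)
  then show "Polynomial.coeff f i = (if i < d then c i else 0)"
    by simp
  show "d > 0 \<Longrightarrow> Polynomial.degree f < d"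
    unfolding f_def by (intro degree_sum_less) (auto intro: le_less_trans[OF degree_monom_le])
qed

text \<open>A nonzero polynomial of degree below \<open>d\<close> has fewer than \<open>d\<close>
  roots. This replaces Vandermonde determinants, both for the independence of the powers of
  \<open>x\<close> and for the invertibility of the matrix formed from its conjugates.\<close>

lemma sum_powers_eq_0:
  fixes c :: "nat \<Rightarrow> 'b :: field"
  assumes S: "finite S" "card S \<ge> d" and z: "\<And>x. x \<in> S \<Longrightarrow> (\<Sum>j<d. c j * x ^ j) = 0" and i: "i < d"
  shows "c i = 0"
proof (rule ccontr)
  assume "c i \<noteq> 0"
  define f where "f = (\<Sum>j<d. Polynomial.monom (c j) j)"
  have "Polynomial.coeff f i \<noteq> 0"
    using i \<open>c i \<noteq> 0\<close> by (simp add: f_def poly_of_coeffs(2))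
  then have "f \<noteq> 0" by auto
  have "S \<subseteq> {x. poly f x = 0}"
    using z by (auto simp: f_def poly_of_coeffs(1))
  then have "d \<le> card {x. poly f x = 0}"
    using S card_mono[OF poly_roots_finite[OF \<open>f \<noteq> 0\<close>]] by (meson le_trans)
  also have "\<dots> \<le> Polynomial.degree f" using \<open>f \<noteq> 0\<close> by (rule card_poly_roots_bound)
  also have "\<dots> < d" using i unfolding f_def by (intro poly_of_coeffs(3)) auto
  finally show False by simp
qed

text \<open>A relation with base field coefficients passes to all \<open>d\<close> conjugates of
  \<open>x\<close>, too many roots for degree below \<open>d\<close>.\<close>

lemma vec_eval_eq_0:
  fixes x :: "'a :: {field, finite} alg_closure"
  assumes x: "x \<in> ext_gen d" and z: "z \<in> carrier_vec d" "vec_eval z x = 0"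
  shows "z = 0\<^sub>v d"
proof -
  define S where "S = (\<lambda>i. x ^ (CARD('a) ^ i)) ` {..<d}"
  have "card S = d" unfolding S_def by (simp add: card_image inj_on_conjugates[OF x])
  have "vec_eval z y = 0" if "y \<in> S" for y
    using that z(2) by (auto simp: S_def vec_eval_frobenius power_0_left)
  then have "to_ac (z $ i) = 0" if "i < d" for i
    using sum_powers_eq_0[of S d "\<lambda>i. to_ac (z $ i)" i] that z(1) \<open>card S = d\<close>
    by (simp add: vec_eval_def S_def)
  then show ?thesis using z(1) by (intro eq_vecI) auto
qed

lemma card_carrier_vec: "card (carrier_vec d :: 'a :: finite vec set) = CARD('a) ^ d"
  and finite_carrier_vec: "finite (carrier_vec d :: 'a :: finite vec set)"
proof -
  have *: "bij_betw (\<lambda>f. vec d f) (Pi\<^sub>E {..<d} (\<lambda>_. UNIV :: 'a set)) (carrier_vec d)"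
  proof (rule bij_betwI[where g = "\<lambda>v. restrict (vec_index v) {..<d}"])
    fix f :: "nat \<Rightarrow> 'a" assume "f \<in> Pi\<^sub>E {..<d} (\<lambda>_. UNIV)"
    then show "restrict (vec_index (vec d f)) {..<d} = f"
      by (auto simp: restrict_def PiE_def extensional_def)
  qed auto
  have "card (Pi\<^sub>E {..<d} (\<lambda>_. UNIV :: 'a set)) = CARD('a) ^ d"
    by (simp add: card_PiE)
  then show "card (carrier_vec d :: 'a vec set) = CARD('a) ^ d"
    using bij_betw_same_card[OF *] by simp
  show "finite (carrier_vec d :: 'a vec set)"
    using bij_betw_finite[OF *] by (simp add: finite_PiE)
qed

lemma bij_betw_vec_eval:
  fixes x :: "'a :: {field, finite} alg_closure"
  assumes d: "d > 0" and x: "x \<in> ext_gen d"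
  shows "bij_betw (\<lambda>z. vec_eval z x) (carrier_vec d) (ext_field d)"
proof -
  have inj: "inj_on (\<lambda>z. vec_eval z x) (carrier_vec d)"
  proof (rule inj_onI)
    fix u v :: "'a vec" assume uv: "u \<in> carrier_vec d" "v \<in> carrier_vec d" "vec_eval u x = vec_eval v x"
    then have "u - v = 0\<^sub>v d"
      by (intro vec_eval_eq_0[OF x]) (auto simp: vec_eval_diff[of _ d])
    then show "u = v" by (rule vec_eq_if_diff_eq_0[OF uv(1,2)])
  qed
  moreover have "(\<lambda>z. vec_eval z x) ` carrier_vec d = ext_field d"
    using inj d ext_genD(1)[OF x]
    by (intro card_subset_eq)
       (auto simp: card_image card_carrier_vec card_ext_field intro: finite_ext_field vec_eval_in_ext_field)
  ultimately show ?thesis by (simp add: bij_betw_def)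
qed

text \<open>Up to sign, the lower coefficients of the minimal polynomial of \<open>x\<close>,
  obtained as the coordinates of \<open>x ^ d\<close>.\<close>

definition gen_coeffs :: "nat \<Rightarrow> 'a :: {field, finite} alg_closure \<Rightarrow> 'a vec" where
  "gen_coeffs d x = (SOME z. z \<in> carrier_vec d \<and> vec_eval z x = x ^ d)"

lemma gen_coeffs:
  assumes d: "d > 0" and x: "x \<in> ext_gen d"
  shows "gen_coeffs d x \<in> carrier_vec d" "vec_eval (gen_coeffs d x) x = x ^ d"
proof -
  have "x ^ d \<in> ext_field d" using ext_genD(1)[OF x] by (rule ext_field_power)
  then have "\<exists>z. z \<in> carrier_vec d \<and> vec_eval z x = x ^ d"
    using bij_betw_vec_eval[OF d x] by (force simp: bij_betw_def image_iff)
  from someI_ex[OF this] show "gen_coeffs d x \<in> carrier_vec d" "vec_eval (gen_coeffs d x) x = x ^ d"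
    by (auto simp: gen_coeffs_def)
qed

text \<open>The \<open>d\<close> conjugates are already roots of this monic polynomial of degree
  \<open>d\<close>; one more root would force its leading coefficient 1 to vanish.\<close>

lemma conjugate_if_min_poly_root:
  fixes x y :: "'a :: {field, finite} alg_closure"
  assumes d: "d > 0" and x: "x \<in> ext_gen d" and y: "y ^ d = vec_eval (gen_coeffs d x) y"
  shows "y \<in> (\<lambda>i. x ^ (CARD('a) ^ i)) ` {..<d}"
proof (rule ccontr)
  define S where "S = (\<lambda>i. x ^ (CARD('a) ^ i)) ` {..<d}"
  assume "y \<notin> (\<lambda>i. x ^ (CARD('a) ^ i)) ` {..<d}"
  then have "y \<notin> S" by (simp add: S_def)
  moreover have "card S = d" unfolding S_def by (simp add: card_image inj_on_conjugates[OF x])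
  ultimately have c: "card (insert y S) = Suc d" by (simp add: S_def)
  define c where "c j = (if j < d then - to_ac (gen_coeffs d x $ j) else 1)" for j
  have ev: "(\<Sum>j<Suc d. c j * z ^ j) = z ^ d - vec_eval (gen_coeffs d x) z" for z
    using gen_coeffs(1)[OF d x] by (simp add: c_def vec_eval_def sum_negf)
  have "z ^ d = vec_eval (gen_coeffs d x) z" if z: "z \<in> S" for z
  proof -
    obtain i where i: "z = x ^ (CARD('a) ^ i)" using z by (auto simp: S_def)
    show ?thesis
      unfolding i vec_eval_frobenius gen_coeffs(2)[OF d x] by (simp add: mult.commute flip: power_mult)
  qed
  then have "c d = 0"
    using y c sum_powers_eq_0[of "insert y S" "Suc d" c d] ev by (auto simp: S_def)
  then show False by (simp add: c_def)
qed

text \<open>Frobenius is injective and commutes with its own powers, so conjugates lie in the same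
  subfields. In the second moment this confines the conjugate pairs to equal degrees.\<close>

lemma ext_gen_conjugate_degree:
  fixes x y :: "'a :: {field, finite} alg_closure"
  assumes d: "d > 0" "e > 0" and x: "x \<in> ext_gen d" and y: "y \<in> ext_gen e" and xy: "y = x ^ (CARD('a) ^ i)"
  shows "e = d"
proof -
  have "y \<in> ext_field d" unfolding xy by (rule ext_field_power[OF ext_genD(1)[OF x]])
  moreover have "x \<in> ext_field e"
  proof -
    have "(x ^ (CARD('a) ^ e)) ^ (CARD('a) ^ i) = (x ^ (CARD('a) ^ i)) ^ (CARD('a) ^ e)"
      by (simp only: mult.commute flip: power_mult)
    also have "\<dots> = x ^ (CARD('a) ^ i)"
      using ext_genD(1)[OF y] unfolding ext_field_iff xy .
    finally have "(x ^ (CARD('a) ^ e)) ^ (CARD('a) ^ i) = x ^ (CARD('a) ^ i)" .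
    then show ?thesis unfolding ext_field_iff by (rule frobenius_power_inject)
  qed
  ultimately show ?thesis
    using ext_genD(3)[OF x d(2)] ext_genD(3)[OF y d(1)] by (cases e d rule: linorder_cases) auto
qed


section \<open>Counting matrices with a given invariant subspace\<close>

lemma mult_mat_vec_index:
  assumes "A \<in> carrier_mat n d" "v \<in> carrier_vec d" "i < n"
  shows "vec_index (A *\<^sub>v v) i = (\<Sum>j<d. A $$ (i, j) * vec_index v j)"
  using assms by (auto simp: scalar_prod_def atLeast0LessThan intro!: sum.cong)

lemma mult_mat_index:
  assumes "A \<in> carrier_mat n d" "B \<in> carrier_mat d m" "i < n" "j < m"
  shows "(A * B) $$ (i, j) = (\<Sum>l<d. A $$ (i, l) * B $$ (l, j))"
  using assms by (auto simp: scalar_prod_def atLeast0LessThan intro!: sum.cong)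

lemma trace_mat_comm:
  fixes A B :: "'b :: comm_semiring_1 mat"
  assumes "A \<in> carrier_mat n m" "B \<in> carrier_mat m n"
  shows "trace_mat (A * B) = trace_mat (B * A)"
proof -
  have "trace_mat (A * B) = (\<Sum>i<n. \<Sum>l<m. A $$ (i, l) * B $$ (l, i))"
    unfolding trace_mat_def using assms by (intro sum.cong) (auto simp: mult_mat_index simp del: index_mult_mat(1))
  also have "\<dots> = (\<Sum>l<m. \<Sum>i<n. B $$ (l, i) * A $$ (i, l))"
    by (subst sum.swap) (simp add: mult.commute)
  also have "\<dots> = trace_mat (B * A)"
    unfolding trace_mat_def using assms by (intro sum.cong) (auto simp: mult_mat_index simp del: index_mult_mat(1))
  finally show ?thesis .
qed

lemma trace_mat_similar:
  fixes A B :: "'b :: comm_ring_1 mat"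
  assumes "similar_mat_wit A B P Q"
  shows "trace_mat A = trace_mat B"
proof -
  define n where "n = dim_row A"
  note w = similar_mat_witD[OF n_def assms]
  have "trace_mat A = trace_mat (P * (B * Q))"
    using w by simp
  also have "\<dots> = trace_mat (B * Q * P)"
    using w by (intro trace_mat_comm) auto
  also have "B * Q * P = B"
    using w by (simp add: assoc_mult_mat[of B n n Q n P n])
  finally show ?thesis .
qed

lemma GL_iff_det: "A \<in> GL n \<longleftrightarrow> A \<in> carrier_mat n n \<and> det A \<noteq> 0"
proof
  assume A: "A \<in> GL n"
  then have c: "A \<in> carrier_mat n n" by (simp add: GL_def)
  obtain B where B: "inverts_mat A B" "inverts_mat B A"
    using A by (auto simp: GL_def invertible_mat_def)
  then have "A * B = 1\<^sub>m n" using c by (simp add: inverts_mat_def)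
  moreover have "B \<in> carrier_mat n n"
    using B c unfolding inverts_mat_def
    by (metis carrier_matD carrier_matI index_mult_mat(2,3) index_one_mat(2,3))
  ultimately have "det A * det B = 1" using c by (metis det_mult det_one)
  then show "A \<in> carrier_mat n n \<and> det A \<noteq> 0" using c by auto
next
  assume A: "A \<in> carrier_mat n n \<and> det A \<noteq> 0"
  then have "A \<in> Units (ring_mat TYPE('a) n ())"
    by (intro det_non_zero_imp_unit) auto
  then obtain B where "B \<in> carrier_mat n n" "B * A = 1\<^sub>m n" "A * B = 1\<^sub>m n"
    by (auto simp: Units_def ring_mat_def)
  then show "A \<in> GL n" using A
    by (auto simp: GL_def invertible_mat_def inverts_mat_def square_mat.simps)
qed

lemma GL_carrier: "A \<in> GL n \<Longrightarrow> A \<in> carrier_mat n n"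
  by (simp add: GL_def)

lemma GL_mult: "A \<in> GL n \<Longrightarrow> B \<in> GL n \<Longrightarrow> A * B \<in> GL n"
  by (auto simp: GL_iff_det det_mult)

lemma GL_inverse:
  assumes "A \<in> GL n"
  obtains B where "B \<in> GL n" "A * B = 1\<^sub>m n" "B * A = 1\<^sub>m n"
proof -
  have A: "A \<in> carrier_mat n n" "det A \<noteq> 0" using assms by (auto simp: GL_iff_det)
  then have "A \<in> Units (ring_mat TYPE('a) n ())"
    by (intro det_non_zero_imp_unit) auto
  then obtain B where B: "B \<in> carrier_mat n n" "B * A = 1\<^sub>m n" "A * B = 1\<^sub>m n"
    by (auto simp: Units_def ring_mat_def)
  then have "det A * det B = 1" using A by (metis det_mult det_one)
  then have "det B \<noteq> 0" by auto
  then show ?thesis using B that[of B] by (auto simp: GL_iff_det)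
qed

lemma finite_carrier_mat: "finite (carrier_mat n m :: 'a :: finite mat set)"
proof -
  let ?F = "Pi\<^sub>E ({..<n} \<times> {..<m}) (\<lambda>_. UNIV :: 'a set)"
  have "(carrier_mat n m :: 'a mat set) \<subseteq> (\<lambda>f. mat n m f) ` ?F"
  proof
    fix A :: "'a mat" assume A: "A \<in> carrier_mat n m"
    have "A = mat n m (restrict (\<lambda>ij. A $$ ij) ({..<n} \<times> {..<m}))"
      using A by (intro eq_matI) auto
    then show "A \<in> (\<lambda>f. mat n m f) ` ?F"
      by (rule image_eqI[where x = "restrict (\<lambda>ij. A $$ ij) ({..<n} \<times> {..<m})"]) simp
  qed
  then show ?thesis
    by (rule finite_subset) (intro finite_imageI finite_PiE; simp)
qed

section \<open>Injective matrices and the transitive action of \<open>GL n\<close>\<close>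

definition inj_mats :: "nat \<Rightarrow> nat \<Rightarrow> 'a :: field mat set" where
  "inj_mats n d = {A \<in> carrier_mat n d. \<forall>v\<in>carrier_vec d. A *\<^sub>v v = 0\<^sub>v n \<longrightarrow> v = 0\<^sub>v d}"

lemma finite_inj_mats: "finite (inj_mats n d :: 'a :: {field, finite} mat set)"
  by (rule finite_subset[OF _ finite_carrier_mat]) (auto simp: inj_mats_def)

lemma inj_mats_square: "inj_mats n n = GL n"
proof (rule Set.set_eqI)
  fix A :: "'a mat"
  show "A \<in> inj_mats n n \<longleftrightarrow> A \<in> GL n"
    unfolding inj_mats_def GL_iff_det using det_0_iff_vec_prod_zero_field[of A n] by blast
qed

lemma inj_mats_inj_on:
  assumes "A \<in> inj_mats n d"
  shows "inj_on (\<lambda>v. A *\<^sub>v v) (carrier_vec d)"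
proof (rule inj_onI)
  fix u v assume uv: "u \<in> carrier_vec d" "v \<in> carrier_vec d" "A *\<^sub>v u = A *\<^sub>v v"
  have A: "A \<in> carrier_mat n d" using assms by (simp add: inj_mats_def)
  have "A *\<^sub>v (u - v) = A *\<^sub>v u - A *\<^sub>v v"
    using A uv by (intro mult_minus_distrib_mat_vec) auto
  also have "\<dots> = 0\<^sub>v n" using A uv by (metis minus_cancel_vec mult_mat_vec_carrier)
  finally have "u - v = 0\<^sub>v d" using assms uv unfolding inj_mats_def by auto
  then show "u = v" by (rule vec_eq_if_diff_eq_0[OF uv(1,2)])
qed

lemma inj_mats_dim_le:
  fixes A :: "'a :: {field, finite} mat"
  assumes "A \<in> inj_mats n d"
  shows "d \<le> n"
proof -
  have "card (carrier_vec d :: 'a vec set) \<le> card (carrier_vec n :: 'a vec set)"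
    using inj_mats_inj_on[OF assms] assms
    by (intro card_inj_on_le[where f = "\<lambda>v. A *\<^sub>v v"])
       (auto simp: inj_mats_def finite_carrier_vec)
  then show ?thesis
    using finite_field_card_gt_1[where 'a='a] by (simp add: card_carrier_vec)
qed

text \<open>Encoded with empty lower blocks so that the multiplication rules for block matrices
  apply.\<close>

definition hcat :: "'a :: zero mat \<Rightarrow> 'a mat \<Rightarrow> 'a mat" where
  "hcat A B = four_block_mat A B (0\<^sub>m 0 (dim_col A)) (0\<^sub>m 0 (dim_col B))"

lemma hcat_carrier: "A \<in> carrier_mat n d \<Longrightarrow> B \<in> carrier_mat n e \<Longrightarrow> hcat A B \<in> carrier_mat n (d + e)"
  unfolding hcat_def by (metis add.right_neutral four_block_carrier_mat zero_carrier_mat carrier_matD(2))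

lemma hcat_mult_vec:
  fixes A B :: "'a :: comm_ring_1 mat"
  assumes A: "A \<in> carrier_mat n d" and B: "B \<in> carrier_mat n e" and u: "u \<in> carrier_vec d" and v: "v \<in> carrier_vec e"
  shows "hcat A B *\<^sub>v (u @\<^sub>v v) = A *\<^sub>v u + B *\<^sub>v v"
proof -
  have "hcat A B *\<^sub>v (u @\<^sub>v v) = (A *\<^sub>v u + B *\<^sub>v v) @\<^sub>v (0\<^sub>m 0 d *\<^sub>v u + 0\<^sub>m 0 e *\<^sub>v v)"
    unfolding hcat_def using A B u v by (subst four_block_mat_mult_vec[of _ n d _ e _ 0]) auto
  also have "\<dots> = A *\<^sub>v u + B *\<^sub>v v"
    using A B by (intro eq_vecI) auto
  finally show ?thesis .
qed

text \<open>The image of \<open>A\<close> has at most \<open>q ^ d < q ^ n\<close> elements, so some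
  vector lies outside it and can serve as a new column.\<close>

lemma inj_mats_extend:
  fixes A :: "'a :: {field, finite} mat"
  assumes A: "A \<in> inj_mats n d" and d: "d < n"
  shows "\<exists>B\<in>carrier_mat n 1. hcat A B \<in> inj_mats n (d + 1)"
proof -
  have Ac: "A \<in> carrier_mat n d" using A by (simp add: inj_mats_def)
  have "card ((\<lambda>v. A *\<^sub>v v) ` carrier_vec d) \<le> CARD('a) ^ d"
    using card_image_le[OF finite_carrier_vec, of "\<lambda>v. A *\<^sub>v v" d] by (simp add: card_carrier_vec)
  also have "\<dots> < card (carrier_vec n :: 'a vec set)"
    using d finite_field_card_gt_1[where 'a='a] by (simp add: card_carrier_vec)
  finally have "\<not> carrier_vec n \<subseteq> (\<lambda>v. A *\<^sub>v v) ` carrier_vec d"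
    using finite_carrier_vec by (metis card_mono finite_imageI leD)
  then obtain b where b: "b \<in> carrier_vec n" "b \<notin> (\<lambda>v. A *\<^sub>v v) ` carrier_vec d" by auto
  define B where "B = mat n 1 (\<lambda>(i, j). vec_index b i)"
  have B: "B \<in> carrier_mat n 1" by (simp add: B_def)
  have Bv: "B *\<^sub>v v = vec_index v 0 \<cdot>\<^sub>v b" if "v \<in> carrier_vec 1" for v
    using b that B by (intro eq_vecI) (auto simp: scalar_prod_def B_def)
  have "hcat A B \<in> inj_mats n (d + 1)"
    unfolding inj_mats_def
  proof (intro CollectI conjI ballI impI)
    show "hcat A B \<in> carrier_mat n (d + 1)" by (rule hcat_carrier[OF Ac B])
    fix w :: "'a vec" assume w: "w \<in> carrier_vec (d + 1)" "hcat A B *\<^sub>v w = 0\<^sub>v n"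
    obtain u v where uv: "u \<in> carrier_vec d" "v \<in> carrier_vec 1" "w = u @\<^sub>v v"
      using w(1) by (metis vec_first_carrier vec_first_last_append vec_last_carrier)
    have eq: "A *\<^sub>v u + vec_index v 0 \<cdot>\<^sub>v b = 0\<^sub>v n"
      using w(2) hcat_mult_vec[OF Ac B uv(1,2)] Bv[OF uv(2)] uv(3) by simp
    have v0: "vec_index v 0 = 0"
    proof (rule ccontr)
      assume n0: "vec_index v 0 \<noteq> 0"
      define c where "c = - 1 / vec_index v 0"
      have "A *\<^sub>v (c \<cdot>\<^sub>v u) = c \<cdot>\<^sub>v (A *\<^sub>v u)"
        using Ac uv by (simp add: mult_mat_vec)
      also have "\<dots> = b"
      proof (rule eq_vecI)
        fix i assume i: "i < dim_vec b"
        then have "i < n" using b by auto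
        then have "vec_index (A *\<^sub>v u + vec_index v 0 \<cdot>\<^sub>v b) i = vec_index (A *\<^sub>v u) i + vec_index v 0 * vec_index b i"
          using Ac b uv(1) by (simp del: index_mult_mat_vec)
        then have "vec_index (A *\<^sub>v u) i + vec_index v 0 * vec_index b i = 0"
          using eq \<open>i < n\<close> by (metis index_zero_vec(1))
        then have "vec_index (A *\<^sub>v u) i = - (vec_index v 0 * vec_index b i)"
          by (simp only: eq_neg_iff_add_eq_0)
        then show "vec_index (c \<cdot>\<^sub>v (A *\<^sub>v u)) i = vec_index b i"
          using Ac \<open>i < n\<close> n0 by (simp add: c_def del: index_mult_mat_vec)
      qed (use Ac b in auto)
      finally show False using b(2) uv(1) by (metis image_eqI smult_carrier_vec)
    qed
    have "A *\<^sub>v u = 0\<^sub>v n"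
    proof -
      have "A *\<^sub>v u + vec_index v 0 \<cdot>\<^sub>v b = A *\<^sub>v u"
        using v0 b Ac by (intro eq_vecI) auto
      then show ?thesis using eq by simp
    qed
    then have "u = 0\<^sub>v d" using A uv(1) by (auto simp: inj_mats_def)
    moreover have "v = 0\<^sub>v 1" using v0 uv(2) by (intro eq_vecI) auto
    ultimately show "w = 0\<^sub>v (d + 1)" using uv(3) by (intro eq_vecI) auto
  qed
  then show ?thesis using B by auto
qed

text \<open>The base point of the action: an equation
  \<open>g * std_inj n d = std_inj n d * C\<close> describes block triangular \<open>g\<close> with
  \<open>C\<close> in the top left corner.\<close>

definition std_inj :: "nat \<Rightarrow> nat \<Rightarrow> 'a :: field mat" where
  "std_inj n d = mat n d (\<lambda>(i, j). if i = j then 1 else 0)"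

lemma std_inj_carrier [simp]: "std_inj n d \<in> carrier_mat n d"
  by (simp add: std_inj_def)

lemma std_inj_dim [simp]: "dim_row (std_inj n d) = n" "dim_col (std_inj n d) = d"
  by (simp_all add: std_inj_def)

lemma mult_std_inj_index:
  assumes "d \<le> n" "A \<in> carrier_mat m n" "i < m" "j < d"
  shows "(A * std_inj n d) $$ (i, j) = A $$ (i, j)"
proof -
  have "(A * std_inj n d) $$ (i, j) = (\<Sum>l<n. A $$ (i, l) * (if l = j then 1 else 0))"
    using assms by (subst mult_mat_index[of _ m n _ d]) (auto simp: std_inj_def intro!: sum.cong)
  also have "\<dots> = A $$ (i, j)"
    using assms by (subst sum.cong[OF refl, of _ _ "\<lambda>l. if l = j then A $$ (i, l) else 0"]) auto
  finally show ?thesis .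
qed

lemma std_inj_mult_index:
  assumes "d \<le> n" "C \<in> carrier_mat d e" "i < n" "j < e"
  shows "(std_inj n d * C) $$ (i, j) = (if i < d then C $$ (i, j) else 0)"
proof -
  have "(std_inj n d * C) $$ (i, j) = (\<Sum>l<d. std_inj n d $$ (i, l) * C $$ (l, j))"
    using assms by (intro mult_mat_index) auto
  also have "\<dots> = (\<Sum>l<d. if l = i then C $$ (l, j) else 0)"
    using assms by (intro sum.cong) (auto simp: std_inj_def)
  also have "\<dots> = (if i < d then C $$ (i, j) else 0)"
    by simp
  finally show ?thesis .
qed

text \<open>Columns are added until the matrix is square, where injective means invertible. The
  induction tracks entrywise agreement on the first \<open>d\<close> columns, since \<open>d\<close>
  itself varies.\<close>

lemma inj_mats_transitive:
  fixes A :: "'a :: {field, finite} mat"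
  assumes "A \<in> inj_mats n d"
  shows "\<exists>x\<in>GL n. x * std_inj n d = A"
proof -
  have "\<exists>x\<in>GL n. \<forall>i<n. \<forall>j<d. x $$ (i, j) = A $$ (i, j)"
    using assms
  proof (induction "n - d" arbitrary: d A)
    case 0
    then have "d = n" using inj_mats_dim_le[of A n d] by simp
    then show ?case using 0 by (auto simp: inj_mats_square)
  next
    case (Suc m)
    then have d: "d < n" by simp
    obtain B where B: "B \<in> carrier_mat n 1" "hcat A B \<in> inj_mats n (d + 1)"
      using inj_mats_extend[OF Suc.prems d] by auto
    have "m = n - (d + 1)" using Suc.hyps(2) by simp
    from Suc.hyps(1)[OF this B(2)]
    obtain x where x: "x \<in> GL n" "\<forall>i<n. \<forall>j<d+1. x $$ (i, j) = hcat A B $$ (i, j)"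
      by auto
    have "hcat A B $$ (i, j) = A $$ (i, j)" if "i < n" "j < d" for i j
      using that Suc.prems B by (auto simp: hcat_def inj_mats_def)
    then show ?case using x by (intro bexI[of _ x]) auto
  qed
  then obtain x where x: "x \<in> GL n" "\<forall>i<n. \<forall>j<d. x $$ (i, j) = A $$ (i, j)" by auto
  have A: "A \<in> carrier_mat n d" using assms by (simp add: inj_mats_def)
  have "x * std_inj n d = A"
  proof (rule eq_matI)
    fix i j assume "i < dim_row A" "j < dim_col A"
    then have "i < n" "j < d" using A by auto
    then show "(x * std_inj n d) $$ (i, j) = A $$ (i, j)"
      using x inj_mats_dim_le[OF assms] GL_carrier[OF x(1)] by (subst mult_std_inj_index[of d n _ n]) auto
  qed (use A GL_carrier[OF x(1)] in \<open>auto simp: std_inj_def\<close>)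
  then show ?thesis using x by auto
qed

lemma GL_mult_inj_mats:
  assumes x: "x \<in> GL n" and A: "A \<in> inj_mats n d"
  shows "x * A \<in> inj_mats n d"
proof -
  have c: "x \<in> carrier_mat n n" "A \<in> carrier_mat n d"
    using x A by (auto simp: GL_def inj_mats_def)
  have "v = 0\<^sub>v d" if v: "v \<in> carrier_vec d" "x * A *\<^sub>v v = 0\<^sub>v n" for v
  proof -
    have "x *\<^sub>v (A *\<^sub>v v) = 0\<^sub>v n" using v c by (metis assoc_mult_mat_vec)
    moreover have "A *\<^sub>v v \<in> carrier_vec n" using c v by simp
    ultimately have "A *\<^sub>v v = 0\<^sub>v n" using x unfolding inj_mats_square[symmetric] inj_mats_def by auto
    then show ?thesis using A v by (auto simp: inj_mats_def)
  qed
  then show ?thesis using c by (auto simp: inj_mats_def)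
qed

lemma std_inj_in_inj_mats:
  assumes "d \<le> n"
  shows "std_inj n d \<in> inj_mats n d"
proof -
  have "v = 0\<^sub>v d" if v: "v \<in> carrier_vec d" "std_inj n d *\<^sub>v v = 0\<^sub>v n" for v :: "'a vec"
  proof (rule eq_vecI)
    fix i assume "i < dim_vec (0\<^sub>v d :: 'a vec)"
    then have i: "i < d" "i < n" using assms by auto
    have "vec_index (std_inj n d *\<^sub>v v) i = (\<Sum>j<d. (if i = j then 1 else 0) * vec_index v j)"
      using i v by (subst mult_mat_vec_index[of _ n d]) (auto simp: std_inj_def intro!: sum.cong)
    also have "\<dots> = (\<Sum>j<d. if j = i then vec_index v j else 0)"
      by (intro sum.cong) auto
    also have "\<dots> = vec_index v i" using i by simp
    finally show "vec_index v i = vec_index (0\<^sub>v d) i" using v(2) i by simp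
  qed (use v in auto)
  then show ?thesis by (auto simp: inj_mats_def)
qed


section \<open>Block triangular matrices and the trace of their powers\<close>

lemma mult_four_block_lower_zero:
  fixes C C' :: "'a :: comm_ring_1 mat"
  assumes "C \<in> carrier_mat d d" "C' \<in> carrier_mat d d" "B \<in> carrier_mat d m" "B' \<in> carrier_mat d m"
    "h \<in> carrier_mat m m" "h' \<in> carrier_mat m m"
  shows "four_block_mat C B (0\<^sub>m m d) h * four_block_mat C' B' (0\<^sub>m m d) h'
    = four_block_mat (C * C') (C * B' + B * h') (0\<^sub>m m d) (h * h')"
proof -
  have "four_block_mat C B (0\<^sub>m m d) h * four_block_mat C' B' (0\<^sub>m m d) h'
    = four_block_mat (C * C' + B * 0\<^sub>m m d) (C * B' + B * h') (0\<^sub>m m d * C' + h * 0\<^sub>m m d) (0\<^sub>m m d * B' + h * h')"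
    using assms by (intro mult_four_block_mat[where ?nr1.0 = d and ?nr2.0 = m and ?n1.0 = d and ?n2.0 = m]) auto
  then show ?thesis using assms by simp
qed

text \<open>The upper right block of a power mixes \<open>C\<close>, \<open>B\<close> and
  \<open>h\<close>, but the trace does not see it, so it is left existential.\<close>

lemma pow_four_block_lower_zero:
  fixes C :: "'a :: comm_ring_1 mat"
  assumes C: "C \<in> carrier_mat d d" and B: "B \<in> carrier_mat d m" and h: "h \<in> carrier_mat m m"
  shows "\<exists>B'\<in>carrier_mat d m. four_block_mat C B (0\<^sub>m m d) h ^\<^sub>m k
    = four_block_mat (C ^\<^sub>m k) B' (0\<^sub>m m d) (h ^\<^sub>m k)"
proof (induction k)
  case 0
  then show ?case using C B h by (intro bexI[of _ "0\<^sub>m d m"]) auto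
next
  case (Suc k)
  then obtain B' where B': "B' \<in> carrier_mat d m"
    "four_block_mat C B (0\<^sub>m m d) h ^\<^sub>m k = four_block_mat (C ^\<^sub>m k) B' (0\<^sub>m m d) (h ^\<^sub>m k)" by auto
  have "four_block_mat C B (0\<^sub>m m d) h ^\<^sub>m Suc k
      = four_block_mat (C ^\<^sub>m Suc k) (C ^\<^sub>m k * B + B' * h) (0\<^sub>m m d) (h ^\<^sub>m Suc k)"
    using C B h B' by (simp add: mult_four_block_lower_zero)
  moreover have "C ^\<^sub>m k * B + B' * h \<in> carrier_mat d m"
    using C B h B' by auto
  ultimately show ?case by blast
qed

lemma trace_four_block:
  fixes A :: "'a :: semiring_1 mat"
  assumes "A \<in> carrier_mat d d" "D \<in> carrier_mat m m"
  shows "trace_mat (four_block_mat A B C D) = trace_mat A + trace_mat D"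
proof -
  have split: "(\<Sum>i<d + m. f i) = (\<Sum>i<d. f i) + (\<Sum>i<m. f (d + i))" for f :: "nat \<Rightarrow> 'a"
    by (induction m) (simp_all add: add.assoc)
  have "trace_mat (four_block_mat A B C D) = (\<Sum>i<d + m. four_block_mat A B C D $$ (i, i))"
    using assms by (simp add: trace_mat_def)
  also have "\<dots> = (\<Sum>i<d. four_block_mat A B C D $$ (i, i)) + (\<Sum>i<m. four_block_mat A B C D $$ (d + i, d + i))"
    by (rule split)
  also have "\<dots> = trace_mat A + trace_mat D"
    using assms by (auto simp: trace_mat_def)
  finally show ?thesis .
qed

lemma trace_pow_four_block_lower_zero:
  fixes C :: "'a :: comm_ring_1 mat"
  assumes C: "C \<in> carrier_mat d d" and B: "B \<in> carrier_mat d m" and h: "h \<in> carrier_mat m m"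
  shows "trace_mat (four_block_mat C B (0\<^sub>m m d) h ^\<^sub>m k) = trace_mat (C ^\<^sub>m k) + trace_mat (h ^\<^sub>m k)"
proof -
  obtain B' where "four_block_mat C B (0\<^sub>m m d) h ^\<^sub>m k = four_block_mat (C ^\<^sub>m k) B' (0\<^sub>m m d) (h ^\<^sub>m k)"
    using pow_four_block_lower_zero[OF assms, of k] by auto
  then show ?thesis using C h by (simp add: trace_four_block[of _ d _ m])
qed

lemma four_block_in_GL_iff:
  fixes C :: "'a :: field mat"
  assumes "C \<in> GL d" "B \<in> carrier_mat d m" "h \<in> carrier_mat m m"
  shows "four_block_mat C B (0\<^sub>m m d) h \<in> GL (d + m) \<longleftrightarrow> h \<in> GL m"
  using assms det_four_block_mat_lower_left_zero[of C d B m "0\<^sub>m m d" h] by (auto simp: GL_iff_det)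

text \<open>The intertwining equation fixes the first \<open>d\<close> columns of \<open>g\<close>
  to be \<open>C\<close> above zeros. The other columns are free, except that invertibility of
  \<open>g\<close> forces the lower right block into \<open>GL m\<close>.\<close>

lemma bij_betw_four_block:
  fixes C :: "'a :: {field, finite} mat"
  assumes C: "C \<in> GL d"
  shows "bij_betw (\<lambda>(B, h). four_block_mat C B (0\<^sub>m m d) h) (carrier_mat d m \<times> GL m)
    {g \<in> GL (d + m). g * std_inj (d + m) d = std_inj (d + m) d * C}"
proof -
  let ?n = "d + m" and ?J = "std_inj (d + m) d :: 'a mat"
  have Cc: "C \<in> carrier_mat d d" using C by (rule GL_carrier)
  have J: "?J \<in> carrier_mat ?n d" by simp
  have eq_iff: "g * ?J = ?J * C \<longleftrightarrow> (\<forall>i<?n. \<forall>j<d. g $$ (i, j) = (if i < d then C $$ (i, j) else 0))"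
    if g: "g \<in> carrier_mat ?n ?n" for g
  proof -
    have dims: "dim_row (g * ?J) = ?n" "dim_col (g * ?J) = d" "dim_row (?J * C) = ?n" "dim_col (?J * C) = d"
      using g Cc J by auto
    have "g * ?J = ?J * C \<longleftrightarrow> (\<forall>i<?n. \<forall>j<d. (g * ?J) $$ (i, j) = (?J * C) $$ (i, j))"
      unfolding mat_eq_iff using dims by auto
    also have "\<dots> \<longleftrightarrow> (\<forall>i<?n. \<forall>j<d. g $$ (i, j) = (if i < d then C $$ (i, j) else 0))"
      using g Cc mult_std_inj_index[of d ?n g ?n] std_inj_mult_index[of d ?n C d] by auto
    finally show ?thesis .
  qed
  show ?thesis
    unfolding bij_betw_def
  proof
    show "inj_on (\<lambda>(B, h). four_block_mat C B (0\<^sub>m m d) h) (carrier_mat d m \<times> GL m)"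
    proof (rule inj_onI, clarify)
      fix B h B' h' assume B: "B \<in> carrier_mat d m" "B' \<in> carrier_mat d m" "h \<in> GL m" "h' \<in> GL m"
        and eq: "four_block_mat C B (0\<^sub>m m d) h = four_block_mat C B' (0\<^sub>m m d) h'"
      have "B = B'"
      proof (rule eq_matI)
        fix i j assume "i < dim_row B'" "j < dim_col B'"
        then show "B $$ (i, j) = B' $$ (i, j)"
          using arg_cong[OF eq, of "\<lambda>M. M $$ (i, d + j)"] B Cc GL_carrier[OF B(3)] GL_carrier[OF B(4)] by auto
      qed (use B in auto)
      moreover have "h = h'"
      proof (rule eq_matI)
        fix i j assume "i < dim_row h'" "j < dim_col h'"
        then show "h $$ (i, j) = h' $$ (i, j)"
          using arg_cong[OF eq, of "\<lambda>M. M $$ (d + i, d + j)"] B Cc GL_carrier[OF B(3)] GL_carrier[OF B(4)] by auto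
      qed (use GL_carrier[OF B(3)] GL_carrier[OF B(4)] in auto)
      ultimately show "B = B' \<and> h = h'" by simp
    qed
    show "(\<lambda>(B, h). four_block_mat C B (0\<^sub>m m d) h) ` (carrier_mat d m \<times> GL m)
      = {g \<in> GL ?n. g * ?J = ?J * C}" (is "?L = ?R")
    proof (intro equalityI subsetI)
      fix g assume "g \<in> ?L"
      then obtain B h where Bh: "B \<in> carrier_mat d m" "h \<in> GL m" "g = four_block_mat C B (0\<^sub>m m d) h" by auto
      have hc: "h \<in> carrier_mat m m" using Bh(2) by (rule GL_carrier)
      have gGL: "g \<in> GL ?n" using four_block_in_GL_iff[OF C Bh(1) hc] Bh by simp
      moreover have "g * ?J = ?J * C"
        unfolding eq_iff[OF GL_carrier[OF gGL]] using Bh(1,3) hc Cc by auto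
      ultimately show "g \<in> ?R" by simp
    next
      fix g assume "g \<in> ?R"
      then have g: "g \<in> GL ?n" "g * ?J = ?J * C" by auto
      have gc: "g \<in> carrier_mat ?n ?n" using g(1) by (rule GL_carrier)
      obtain A1 A2 A3 A4 where sb: "split_block g d d = (A1, A2, A3, A4)"
        by (metis prod_cases4)
      note sp = split_block[OF sb, of m m]
      have dims: "dim_row g = d + m" "dim_col g = d + m" using gc by auto
      note A = sp[OF dims]
      have idx: "\<forall>i<?n. \<forall>j<d. g $$ (i, j) = (if i < d then C $$ (i, j) else 0)"
        using eq_iff[OF gc] g(2) by simp
      have "A1 = C"
      proof (rule eq_matI)
        fix i j assume "i < dim_row C" "j < dim_col C"
        then have ij: "i < d" "j < d" using Cc by auto
        then have "g $$ (i, j) = A1 $$ (i, j)"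
          using A by (subst A(5)) auto
        moreover have "g $$ (i, j) = C $$ (i, j)" using idx ij by auto
        ultimately show "A1 $$ (i, j) = C $$ (i, j)" by simp
      qed (use A Cc in auto)
      moreover have "A3 = 0\<^sub>m m d"
      proof (rule eq_matI)
        fix i j assume ij: "i < dim_row (0\<^sub>m m d :: 'a mat)" "j < dim_col (0\<^sub>m m d :: 'a mat)"
        then have "g $$ (d + i, j) = A3 $$ (i, j)"
          using A by (subst A(5)) auto
        moreover have "g $$ (d + i, j) = 0" using idx ij by auto
        ultimately show "A3 $$ (i, j) = (0\<^sub>m m d :: 'a mat) $$ (i, j)" using ij by simp
      qed (use A in auto)
      ultimately have g_eq: "g = four_block_mat C A2 (0\<^sub>m m d) A4" using A(5) by simp
      then have "A4 \<in> GL m" using four_block_in_GL_iff[OF C A(2) A(4)] g(1) by simp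
      then show "g \<in> ?L" using g_eq A(2) by (intro image_eqI[of _ _ "(A2, A4)"]) auto
    qed
  qed
qed

text \<open>The summand does not depend on the upper right block, which therefore contributes only a
  factor counting its choices.\<close>

lemma sum_stabilizer:
  fixes C :: "'a :: {field, finite} mat" and F :: "'a \<Rightarrow> real"
  assumes C: "C \<in> GL d"
  shows "(\<Sum>g\<in>{g \<in> GL (d + m). g * std_inj (d + m) d = std_inj (d + m) d * C}. F (trace_mat (g ^\<^sub>m k)))
    = card (carrier_mat d m :: 'a mat set) * (\<Sum>h\<in>GL m. F (trace_mat (C ^\<^sub>m k) + trace_mat (h ^\<^sub>m k)))"
proof -
  have "(\<Sum>g\<in>{g \<in> GL (d + m). g * std_inj (d + m) d = std_inj (d + m) d * C}. F (trace_mat (g ^\<^sub>m k)))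
      = (\<Sum>(B, h)\<in>carrier_mat d m \<times> GL m. F (trace_mat (four_block_mat C B (0\<^sub>m m d) h ^\<^sub>m k)))"
    using sum.reindex_bij_betw[OF bij_betw_four_block[OF C, of m], of "\<lambda>g. F (trace_mat (g ^\<^sub>m k))"]
    by (simp add: case_prod_unfold)
  also have "\<dots> = (\<Sum>(B, h)\<in>(carrier_mat d m :: 'a mat set) \<times> GL m. F (trace_mat (C ^\<^sub>m k) + trace_mat (h ^\<^sub>m k)))"
    using GL_carrier[OF C]
    by (intro sum.cong[OF refl]) (auto simp: trace_pow_four_block_lower_zero dest: GL_carrier)
  also have "\<dots> = real (card (carrier_mat d m :: 'a mat set)) * (\<Sum>h\<in>GL m. F (trace_mat (C ^\<^sub>m k) + trace_mat (h ^\<^sub>m k)))"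
    by (subst sum.cartesian_product[symmetric]) simp
  finally show ?thesis .
qed

section \<open>Conjugation and orbit counting in \<open>GL n\<close>\<close>

lemma mat_cancel_left:
  fixes x y g :: "'a :: semiring_1 mat"
  assumes "x \<in> carrier_mat n n" "y \<in> carrier_mat n n" "g \<in> carrier_mat n m" "x * y = 1\<^sub>m n"
  shows "x * (y * g) = g"
  using assms assoc_mult_mat[of x n n y n g m] by simp

lemma trace_pow_conjugate:
  fixes x y g :: "'a :: field mat"
  assumes "x \<in> carrier_mat n n" "y \<in> carrier_mat n n" "x * y = 1\<^sub>m n" "y * x = 1\<^sub>m n" "g \<in> carrier_mat n n"
  shows "trace_mat ((x * g * y) ^\<^sub>m k) = trace_mat (g ^\<^sub>m k)"
proof -
  have "similar_mat_wit (x * g * y) g x y"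
    using assms by (intro similar_mat_witI[of _ _ n]) auto
  then show ?thesis using similar_mat_wit_pow trace_mat_similar by blast
qed

text \<open>Writing \<open>A\<close> as \<open>x\<close> times the standard injection and
  conjugating by \<open>x\<close> carries one index set to the other, and traces of powers are
  invariant under conjugation.\<close>

lemma sum_intertwiners_std:
  fixes C :: "'a :: {field, finite} mat" and F :: "'a \<Rightarrow> real"
  assumes C: "C \<in> GL d" and A: "A \<in> inj_mats n d"
  shows "(\<Sum>g\<in>{g \<in> GL n. g * A = A * C}. F (trace_mat (g ^\<^sub>m k)))
    = (\<Sum>g\<in>{g \<in> GL n. g * std_inj n d = std_inj n d * C}. F (trace_mat (g ^\<^sub>m k)))"
proof -
  let ?J = "std_inj n d :: 'a mat"
  obtain x where x: "x \<in> GL n" "x * ?J = A" using inj_mats_transitive[OF A] by auto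
  obtain y where y: "y \<in> GL n" "x * y = 1\<^sub>m n" "y * x = 1\<^sub>m n" using GL_inverse[OF x(1)] by auto
  note c = GL_carrier[OF x(1)] GL_carrier[OF y(1)] GL_carrier[OF C]
  have J: "?J \<in> carrier_mat n d" by simp
  have yA: "y * A = ?J"
    using mat_cancel_left[OF c(2,1) J y(3)] x(2) by simp
  have Ac: "A \<in> carrier_mat n d" using A by (simp add: inj_mats_def)
  have inv: "y * (x * g * y) * x = g" "x * (y * g * x) * y = g" if g: "g \<in> carrier_mat n n" for g
  proof -
    have "y * (x * g * y) * x = (y * x) * g * (y * x)" "x * (y * g * x) * y = (x * y) * g * (x * y)"
      using c g by (simp_all add: assoc_mult_mat[of _ n n _ n _ n])
    then show "y * (x * g * y) * x = g" "x * (y * g * x) * y = g" using g y by auto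
  qed
  show ?thesis
  proof (rule sum.reindex_bij_witness[of _ "\<lambda>g. x * g * y" "\<lambda>g. y * g * x"])
    fix g assume g: "g \<in> {g \<in> GL n. g * A = A * C}"
    then have gc: "g \<in> carrier_mat n n" by (auto dest: GL_carrier)
    show "x * (y * g * x) * y = g" by (rule inv(2)[OF gc])
    have "y * g * x * ?J = y * (g * (x * ?J))"
      using c gc J by (simp add: assoc_mult_mat[of _ n n _ n _ n] assoc_mult_mat[of _ n n _ n _ d])
    also have "\<dots> = y * (A * C)" using g x(2) by simp
    also have "\<dots> = ?J * C" using assoc_mult_mat[OF c(2) Ac c(3)] yA by simp
    finally show "y * g * x \<in> {g \<in> GL n. g * ?J = ?J * C}"
      using g x y by (auto intro: GL_mult)
    show "F (trace_mat ((y * g * x) ^\<^sub>m k)) = F (trace_mat (g ^\<^sub>m k))"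
      using trace_pow_conjugate[of y n x g k] c y gc by simp
  next
    fix g assume g: "g \<in> {g \<in> GL n. g * ?J = ?J * C}"
    then have gc: "g \<in> carrier_mat n n" by (auto dest: GL_carrier)
    show "y * (x * g * y) * x = g" by (rule inv(1)[OF gc])
    have "x * g * y * A = x * (g * (y * A))"
      using c gc Ac by (simp add: assoc_mult_mat[of _ n n _ n _ n] assoc_mult_mat[of _ n n _ n _ d])
    also have "\<dots> = x * (?J * C)" using g yA by simp
    also have "\<dots> = A * C" using assoc_mult_mat[OF c(1) J c(3)] x(2) by simp
    finally show "x * g * y \<in> {g \<in> GL n. g * A = A * C}"
      using g x y by (auto intro: GL_mult)
  qed
qed

text \<open>Orbit and stabiliser for the transitive action. The stabiliser is written with the
  identity in the role of \<open>C\<close>, so that the block parametrisation also counts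
  it.\<close>

lemma card_GL_inj_mats:
  assumes d: "d \<le> n"
  shows "card (GL n :: 'a :: {field, finite} mat set)
    = card (inj_mats n d :: 'a mat set) * card {x \<in> GL n. x * std_inj n d = std_inj n d * (1\<^sub>m d :: 'a mat)}"
proof -
  let ?J = "std_inj n d :: 'a mat"
  define S where "S = {x \<in> GL n. x * ?J = ?J * 1\<^sub>m d}"
  have J: "?J \<in> carrier_mat n d" by simp
  have J1: "?J * 1\<^sub>m d = ?J" by (rule right_mult_one_mat[OF J])
  have fib: "card {x \<in> GL n. x * ?J = A} = card S" if A: "A \<in> inj_mats n d" for A
  proof -
    obtain x where x: "x \<in> GL n" "x * ?J = A" using inj_mats_transitive[OF A] by auto
    obtain y where y: "y \<in> GL n" "x * y = 1\<^sub>m n" "y * x = 1\<^sub>m n" using GL_inverse[OF x(1)] by auto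
    note c = GL_carrier[OF x(1)] GL_carrier[OF y(1)]
    show ?thesis
    proof (rule bij_betw_same_card, rule bij_betwI[where f = "\<lambda>g. y * g" and g = "\<lambda>g. x * g"])
      show "(\<lambda>g. y * g) \<in> {x \<in> GL n. x * ?J = A} \<rightarrow> S"
      proof
        fix g assume g: "g \<in> {x \<in> GL n. x * ?J = A}"
        then have gc: "g \<in> carrier_mat n n" by (auto dest: GL_carrier)
        have "y * g * ?J = y * (x * ?J)" using g x gc c J by (simp add: assoc_mult_mat[of _ n n _ n _ d])
        also have "\<dots> = ?J" by (rule mat_cancel_left[OF c(2,1) J y(3)])
        finally show "y * g \<in> S" using g y unfolding S_def J1 by (auto intro: GL_mult)
      qed
      show "(\<lambda>g. x * g) \<in> S \<rightarrow> {x \<in> GL n. x * ?J = A}"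
      proof
        fix g assume g: "g \<in> S"
        then have gc: "g \<in> carrier_mat n n" by (auto simp: S_def dest: GL_carrier)
        have "x * g * ?J = x * (g * ?J)" using gc c J by (simp add: assoc_mult_mat[of _ n n _ n _ d])
        also have "\<dots> = A" using g x unfolding S_def J1 by simp
        finally show "x * g \<in> {x \<in> GL n. x * ?J = A}" using g x unfolding S_def by (auto intro: GL_mult)
      qed
      show "x * (y * g) = g" if "g \<in> {x \<in> GL n. x * ?J = A}" for g
        using that c y by (intro mat_cancel_left[of _ n]) (auto dest: GL_carrier)
      show "y * (x * g) = g" if "g \<in> S" for g
        using that c y unfolding S_def by (intro mat_cancel_left[of _ n]) (auto dest: GL_carrier)
    qed
  qed
  have "(GL n :: 'a mat set) = (\<Union>A\<in>inj_mats n d. {x \<in> GL n. x * ?J = A})"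
    using GL_mult_inj_mats std_inj_in_inj_mats[OF d] by auto
  then have "card (GL n :: 'a mat set) = card (\<Union>A\<in>inj_mats n d. {x \<in> GL n. x * ?J = A})"
    by (rule arg_cong[of _ _ card])
  also have "\<dots> = (\<Sum>A\<in>inj_mats n d. card {x \<in> GL n. x * ?J = A})"
    by (intro card_UN_disjoint) (auto simp: finite_inj_mats finite_GL)
  also have "\<dots> = card (inj_mats n d :: 'a mat set) * card S"
    using fib by simp
  finally show ?thesis unfolding S_def .
qed

text \<open>Pairs \<open>(g, A)\<close> are counted twice. Every \<open>A\<close> gives the same
  stabiliser sum, and orbit counting shows that the number of \<open>A\<close> times the number of
  free blocks is the quotient of the two group orders. Multiplying out by \<open>card (GL m)\<close>
  avoids any formula for these orders.\<close>

lemma sum_intertwiners: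
  fixes C :: "'a :: {field, finite} mat" and F :: "'a \<Rightarrow> real"
  assumes C: "C \<in> GL d"
  shows "(\<Sum>g\<in>GL (d + m). card {A \<in> inj_mats (d + m) d. g * A = A * C} * F (trace_mat (g ^\<^sub>m k))) * card (GL m :: 'a mat set)
    = card (GL (d + m) :: 'a mat set) * (\<Sum>h\<in>GL m. F (trace_mat (C ^\<^sub>m k) + trace_mat (h ^\<^sub>m k)))"
proof -
  let ?n = "d + m"
  let ?J = "std_inj ?n d :: 'a mat"
  let ?I = "inj_mats ?n d :: 'a mat set"
  define M where "M = real (card (carrier_mat d m :: 'a mat set))"
  define W where "W = (\<Sum>h\<in>GL m. F (trace_mat (C ^\<^sub>m k) + trace_mat (h ^\<^sub>m k)))"
  have "(\<Sum>g\<in>GL ?n. card {A \<in> ?I. g * A = A * C} * F (trace_mat (g ^\<^sub>m k)))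
      = (\<Sum>g\<in>GL ?n. \<Sum>A\<in>?I. if g * A = A * C then F (trace_mat (g ^\<^sub>m k)) else 0)"
    by (simp add: sum.If_cases finite_inj_mats Int_def)
  also have "\<dots> = (\<Sum>A\<in>?I. \<Sum>g\<in>GL ?n. if g * A = A * C then F (trace_mat (g ^\<^sub>m k)) else 0)"
    by (rule sum.swap)
  also have "\<dots> = (\<Sum>A\<in>?I. \<Sum>g\<in>{g \<in> GL ?n. g * A = A * C}. F (trace_mat (g ^\<^sub>m k)))"
    by (simp add: sum.If_cases finite_GL Int_def)
  also have "\<dots> = (\<Sum>A\<in>?I. \<Sum>g\<in>{g \<in> GL ?n. g * ?J = ?J * C}. F (trace_mat (g ^\<^sub>m k)))"
    by (intro sum.cong refl sum_intertwiners_std[OF C])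
  also have "\<dots> = card ?I * (M * W)"
    by (simp add: sum_stabilizer[OF C] M_def W_def)
  finally have 1: "(\<Sum>g\<in>GL ?n. card {A \<in> ?I. g * A = A * C} * F (trace_mat (g ^\<^sub>m k))) = card ?I * (M * W)" .
  have "real (card {x \<in> GL ?n. x * ?J = ?J * 1\<^sub>m d}) = M * card (GL m :: 'a mat set)"
    using sum_stabilizer[OF one_mat_in_GL, where d = d and m = m and F = "\<lambda>_ :: 'a. 1" and k = 0] by (simp add: M_def)
  then have "real (card (GL ?n :: 'a mat set)) = card ?I * (M * card (GL m :: 'a mat set))"
    using card_GL_inj_mats[of d ?n, where 'a='a] by simp
  then show ?thesis unfolding 1 W_def[symmetric] by simp
qed


section \<open>Companion matrices\<close>

text \<open>Multiplication by a root \<open>y\<close> of \<open>y ^ d = vec_eval c y\<close> in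
  terms of the powers of \<open>y\<close>: all columns but the last shift the exponent, and the last
  one rewrites \<open>y ^ d\<close>.\<close>

definition companion :: "'a :: field vec \<Rightarrow> 'a mat" where
  "companion c = mat (dim_vec c) (dim_vec c)
    (\<lambda>(i, j). if Suc j < dim_vec c then if i = Suc j then 1 else 0 else vec_index c i)"

lemma companion_carrier: "c \<in> carrier_vec d \<Longrightarrow> companion c \<in> carrier_mat d d"
  by (auto simp: companion_def)

text \<open>The row of powers of \<open>y\<close> is a left eigenvector with eigenvalue
  \<open>y\<close>. Any root is allowed, so each conjugate of \<open>x\<close> supplies an
  eigenvector.\<close>

lemma companion_col_eval:
  assumes c: "c \<in> carrier_vec d" and y: "y ^ d = vec_eval c y" and j: "j < d"
  shows "(\<Sum>i<d. to_ac (companion c $$ (i, j)) * y ^ i) = y ^ Suc j"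
proof (cases "Suc j < d")
  case True
  have "(\<Sum>i<d. to_ac (companion c $$ (i, j)) * y ^ i) = (\<Sum>i<d. if i = Suc j then y ^ i else 0)"
    using c j True by (intro sum.cong) (auto simp: companion_def)
  then show ?thesis using True by simp
next
  case False
  then have "d = Suc j" using j by simp
  have "(\<Sum>i<d. to_ac (companion c $$ (i, j)) * y ^ i) = (\<Sum>i<d. to_ac (vec_index c i) * y ^ i)"
    using c j False by (intro sum.cong) (auto simp: companion_def)
  also have "\<dots> = y ^ d" using c by (simp add: y vec_eval_def)
  finally show ?thesis using \<open>d = Suc j\<close> by simp
qed

lemma vec_eval_companion:
  assumes c: "c \<in> carrier_vec d" and y: "y ^ d = vec_eval c y" and z: "z \<in> carrier_vec d"
  shows "vec_eval (companion c *\<^sub>v z) y = y * vec_eval z y"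
proof -
  note C = companion_carrier[OF c]
  have "vec_eval (companion c *\<^sub>v z) y = (\<Sum>i<d. (\<Sum>j<d. to_ac (companion c $$ (i, j)) * to_ac (vec_index z j)) * y ^ i)"
    using C z by (simp add: vec_eval_def mult_mat_vec_index[OF C z] to_ac_sum del: index_mult_mat_vec)
  also have "\<dots> = (\<Sum>i<d. \<Sum>j<d. to_ac (vec_index z j) * (to_ac (companion c $$ (i, j)) * y ^ i))"
    by (simp add: sum_distrib_left sum_distrib_right mult_ac)
  also have "\<dots> = (\<Sum>j<d. \<Sum>i<d. to_ac (vec_index z j) * (to_ac (companion c $$ (i, j)) * y ^ i))"
    by (rule sum.swap)
  also have "\<dots> = (\<Sum>j<d. to_ac (vec_index z j) * y ^ Suc j)"
    by (intro sum.cong refl) (simp add: companion_col_eval[OF c y] del: power_Suc flip: sum_distrib_left)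
  also have "\<dots> = y * vec_eval z y"
    using z by (simp add: vec_eval_def sum_distrib_left mult_ac)
  finally show ?thesis .
qed

definition gen_mat :: "nat \<Rightarrow> 'a :: {field, finite} alg_closure \<Rightarrow> 'a mat" where
  "gen_mat d x = companion (gen_coeffs d x)"

lemma gen_mat_carrier: "d > 0 \<Longrightarrow> x \<in> ext_gen d \<Longrightarrow> gen_mat d x \<in> carrier_mat d d"
  unfolding gen_mat_def by (intro companion_carrier gen_coeffs)

lemma vec_eval_gen_mat:
  assumes "d > 0" "x \<in> ext_gen d" "z \<in> carrier_vec d"
  shows "vec_eval (gen_mat d x *\<^sub>v z) x = x * vec_eval z x"
  unfolding gen_mat_def using assms by (intro vec_eval_companion) (auto simp: gen_coeffs)

text \<open>In coordinates the matrix acts as multiplication by the nonzero element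
  \<open>x\<close>, hence has trivial kernel.\<close>

lemma gen_mat_in_GL:
  assumes d: "d > 0" and x: "x \<in> ext_gen d"
  shows "gen_mat d x \<in> GL d"
proof -
  have "z = 0\<^sub>v d" if z: "z \<in> carrier_vec d" "gen_mat d x *\<^sub>v z = 0\<^sub>v d" for z
    using vec_eval_gen_mat[OF d x z(1)] z ext_genD(2)[OF x] by (intro vec_eval_eq_0[OF x]) auto
  then show ?thesis
    using gen_mat_carrier[OF d x] unfolding inj_mats_square[symmetric] inj_mats_def by auto
qed

lemma diag_mat_pow:
  fixes a :: "nat \<Rightarrow> 'b :: comm_ring_1" and d :: nat
  defines "D \<equiv> mat d d (\<lambda>(i, j). if i = j then a i else 0)"
  shows "D ^\<^sub>m k = mat d d (\<lambda>(i, j). if i = j then a i ^ k else 0)"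
proof (induction k)
  case 0
  show ?case by (intro eq_matI) (auto simp: D_def)
next
  case (Suc k)
  let ?E = "mat d d (\<lambda>(i, j). if i = j then a i ^ k else 0)"
  have "?E * D = mat d d (\<lambda>(i, j). if i = j then a i ^ Suc k else 0)"
  proof (rule eq_matI)
    fix i j assume "i < dim_row (mat d d (\<lambda>(i, j). if i = j then a i ^ Suc k else 0))"
      "j < dim_col (mat d d (\<lambda>(i, j). if i = j then a i ^ Suc k else 0))"
    then have ij: "i < d" "j < d" by auto
    have "(?E * D) $$ (i, j) = (\<Sum>l<d. ?E $$ (i, l) * D $$ (l, j))"
      using ij by (intro mult_mat_index) (auto simp: D_def)
    also have "\<dots> = (\<Sum>l<d. if l = i then a i ^ k * D $$ (i, j) else 0)"
      using ij by (intro sum.cong) auto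
    also have "\<dots> = a i ^ k * D $$ (i, j)" using ij by simp
    finally show "(?E * D) $$ (i, j) = mat d d (\<lambda>(i, j). if i = j then a i ^ Suc k else 0) $$ (i, j)"
      using ij by (simp add: D_def)
  qed (auto simp: D_def)
  then show ?case by (simp add: Suc)
qed

text \<open>The Vandermonde matrix of the conjugates of \<open>x\<close> diagonalises \<open>gen_mat d x\<close> over the algebraic closure.\<close>
lemma trace_gen_mat_pow:
  fixes x :: "'a :: {field, finite} alg_closure"
  assumes d: "d > 0" and x: "x \<in> ext_gen d"
  shows "to_ac (trace_mat (gen_mat d x ^\<^sub>m k)) = ext_trace d (x ^ k)"
proof -
  interpret to_ac: semiring_hom "to_ac :: 'a \<Rightarrow> 'a alg_closure"
    by unfold_locales auto
  let ?y = "\<lambda>i. x ^ (CARD('a) ^ i)"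
  define c where "c = gen_coeffs d x"
  have c: "c \<in> carrier_vec d" unfolding c_def by (rule gen_coeffs[OF d x])
  define C where "C = map_mat to_ac (gen_mat d x)"
  define V where "V = mat d d (\<lambda>(i, j). ?y i ^ j)"
  define D where "D = mat d d (\<lambda>(i, j). if i = j then ?y i else 0)"
  have gc: "gen_mat d x \<in> carrier_mat d d" by (rule gen_mat_carrier[OF d x])
  have carr: "C \<in> carrier_mat d d" "V \<in> carrier_mat d d" "D \<in> carrier_mat d d"
    using gc by (auto simp: C_def V_def D_def)
  have root: "?y i ^ d = vec_eval c (?y i)" for i
    unfolding vec_eval_frobenius c_def gen_coeffs(2)[OF d x] by (simp add: mult.commute flip: power_mult)
  \<comment> \<open>Row \<open>i\<close> of \<open>V\<close> lists the powers of the
    \<open>i\<close>-th conjugate, a left eigenvector of \<open>C\<close>.\<close>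
  have VC: "V * C = D * V"
  proof (rule eq_matI)
    fix i j assume "i < dim_row (D * V)" "j < dim_col (D * V)"
    then have ij: "i < d" "j < d" using carr by auto
    have "(V * C) $$ (i, j) = (\<Sum>l<d. V $$ (i, l) * C $$ (l, j))"
      using ij carr by (intro mult_mat_index)
    also have "\<dots> = (\<Sum>l<d. to_ac (companion c $$ (l, j)) * ?y i ^ l)"
      using ij gc by (intro sum.cong) (auto simp: V_def C_def gen_mat_def c_def)
    also have "\<dots> = ?y i ^ Suc j"
      by (rule companion_col_eval[OF c root ij(2)])
    also have "\<dots> = (\<Sum>l<d. if l = i then ?y i * V $$ (i, j) else 0)"
      using ij by (simp add: V_def)
    also have "\<dots> = (\<Sum>l<d. D $$ (i, l) * V $$ (l, j))"
      using ij by (intro sum.cong) (auto simp: D_def)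
    also have "\<dots> = (D * V) $$ (i, j)"
      using ij carr by (intro mult_mat_index[symmetric])
    finally show "(V * C) $$ (i, j) = (D * V) $$ (i, j)" .
  qed (use carr in auto)
  \<comment> \<open>A kernel vector would be the coefficient list of a polynomial of degree below
    \<open>d\<close> vanishing at \<open>d\<close> distinct conjugates.\<close>
  have "V \<in> inj_mats d d"
    unfolding inj_mats_def
  proof (intro CollectI conjI ballI impI carr)
    fix v assume v: "v \<in> carrier_vec d" "V *\<^sub>v v = 0\<^sub>v d"
    have "(\<Sum>j<d. vec_index v j * y ^ j) = 0" if y: "y \<in> ?y ` {..<d}" for y
    proof -
      obtain i where i: "i < d" "y = ?y i" using y by auto
      have "vec_index (V *\<^sub>v v) i = (\<Sum>j<d. V $$ (i, j) * vec_index v j)"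
        using i carr v by (intro mult_mat_vec_index)
      also have "\<dots> = (\<Sum>j<d. vec_index v j * y ^ j)"
        using i by (intro sum.cong) (auto simp: V_def)
      finally show ?thesis using v(2) i(1) by simp
    qed
    moreover have "card (?y ` {..<d}) = d" by (simp add: card_image inj_on_conjugates[OF x])
    ultimately have "vec_index v i = 0" if "i < d" for i
      using sum_powers_eq_0[of "?y ` {..<d}" d "vec_index v" i] that by simp
    then show "v = 0\<^sub>v d" using v(1) by (intro eq_vecI) auto
  qed
  then have V: "V \<in> GL d" by (simp add: inj_mats_square)
  then obtain W where W: "W \<in> GL d" "V * W = 1\<^sub>m d" "W * V = 1\<^sub>m d"
    by (rule GL_inverse)
  have Wc: "W \<in> carrier_mat d d" using W(1) by (rule GL_carrier)
  have "C = W * D * V"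
    using mat_cancel_left[OF Wc carr(2,1) W(3)] VC carr Wc by (simp add: assoc_mult_mat[of W d d D d V d])
  then have "similar_mat_wit C D W V"
    using carr Wc W by (intro similar_mat_witI[of _ _ d])
  then have "trace_mat (C ^\<^sub>m k) = trace_mat (D ^\<^sub>m k)"
    using similar_mat_wit_pow trace_mat_similar by blast
  also have "\<dots> = (\<Sum>i<d. ?y i ^ k)"
    unfolding D_def diag_mat_pow by (simp add: trace_mat_def)
  also have "\<dots> = ext_trace d (x ^ k)"
    by (simp add: ext_trace_def mult.commute flip: power_mult)
  also have "C ^\<^sub>m k = map_mat to_ac (gen_mat d x ^\<^sub>m k)"
    unfolding C_def by (rule to_ac.mat_hom_pow[OF gc, symmetric])
  also have "trace_mat (map_mat to_ac (gen_mat d x ^\<^sub>m k)) = to_ac (trace_mat (gen_mat d x ^\<^sub>m k))"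
    unfolding trace_mat_def to_ac_sum using gc by (intro sum.cong) auto
  finally show ?thesis .
qed

section \<open>Linear relations between two intertwiners of the same matrix\<close>

context
  fixes n d e :: nat and x y :: "'a :: {field, finite} alg_closure" and g A B :: "'a mat"
  assumes d: "d > 0" and x: "x \<in> ext_gen d" and e: "e > 0" and y: "y \<in> ext_gen e"
    and g: "g \<in> carrier_mat n n"
    and A: "A \<in> inj_mats n d" "g * A = A * gen_mat d x"
    and B: "B \<in> inj_mats n e" "g * B = B * gen_mat e y"
begin

text \<open>The kernel of \<open>hcat A B\<close>, kept as pairs so that each component can be
  evaluated at its own generator. Its stability under both companion matrices at once makes it a
  module over polynomials.\<close>

definition relations :: "('a vec \<times> 'a vec) set" where
  "relations = {(u, v). u \<in> carrier_vec d \<and> v \<in> carrier_vec e \<and> A *\<^sub>v u + B *\<^sub>v v = 0\<^sub>v n}"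

private lemma AB: "A \<in> carrier_mat n d" "B \<in> carrier_mat n e"
  using A B by (auto simp: inj_mats_def)

lemma relations_shift:
  assumes "(u, v) \<in> relations"
  shows "(gen_mat d x *\<^sub>v u, gen_mat e y *\<^sub>v v) \<in> relations"
proof -
  have uv: "u \<in> carrier_vec d" "v \<in> carrier_vec e" "A *\<^sub>v u + B *\<^sub>v v = 0\<^sub>v n"
    using assms by (auto simp: relations_def)
  note C = gen_mat_carrier[OF d x] gen_mat_carrier[OF e y]
  have "A *\<^sub>v (gen_mat d x *\<^sub>v u) = g *\<^sub>v (A *\<^sub>v u)" "B *\<^sub>v (gen_mat e y *\<^sub>v v) = g *\<^sub>v (B *\<^sub>v v)"
    using assoc_mult_mat_vec[OF AB(1) C(1) uv(1)] assoc_mult_mat_vec[OF g AB(1) uv(1)]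
      assoc_mult_mat_vec[OF AB(2) C(2) uv(2)] assoc_mult_mat_vec[OF g AB(2) uv(2)] A(2) B(2) by simp_all
  then have "A *\<^sub>v (gen_mat d x *\<^sub>v u) + B *\<^sub>v (gen_mat e y *\<^sub>v v) = g *\<^sub>v (A *\<^sub>v u + B *\<^sub>v v)"
    using mult_add_distrib_mat_vec[OF g, of "A *\<^sub>v u" "B *\<^sub>v v"] AB uv(1,2) by simp
  also have "\<dots> = 0\<^sub>v n" using uv g by (auto intro!: eq_vecI simp: scalar_prod_def)
  finally show ?thesis using C uv by (auto simp: relations_def)
qed

lemma relations_lin:
  assumes "(u, v) \<in> relations" "(u', v') \<in> relations"
  shows "(a \<cdot>\<^sub>v u + u', a \<cdot>\<^sub>v v + v') \<in> relations"
proof -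
  have uv: "u \<in> carrier_vec d" "v \<in> carrier_vec e" "A *\<^sub>v u + B *\<^sub>v v = 0\<^sub>v n"
    "u' \<in> carrier_vec d" "v' \<in> carrier_vec e" "A *\<^sub>v u' + B *\<^sub>v v' = 0\<^sub>v n"
    using assms by (auto simp: relations_def)
  have c: "A *\<^sub>v u \<in> carrier_vec n" "A *\<^sub>v u' \<in> carrier_vec n" "B *\<^sub>v v \<in> carrier_vec n" "B *\<^sub>v v' \<in> carrier_vec n"
    using AB uv by auto
  have "A *\<^sub>v (a \<cdot>\<^sub>v u + u') = a \<cdot>\<^sub>v (A *\<^sub>v u) + A *\<^sub>v u'" "B *\<^sub>v (a \<cdot>\<^sub>v v + v') = a \<cdot>\<^sub>v (B *\<^sub>v v) + B *\<^sub>v v'"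
    using AB uv by (simp_all add: mult_add_distrib_mat_vec[of A n d] mult_add_distrib_mat_vec[of B n e] mult_mat_vec[of A n d] mult_mat_vec[of B n e])
  then have "A *\<^sub>v (a \<cdot>\<^sub>v u + u') + B *\<^sub>v (a \<cdot>\<^sub>v v + v')
      = a \<cdot>\<^sub>v (A *\<^sub>v u + B *\<^sub>v v) + (A *\<^sub>v u' + B *\<^sub>v v')"
    using c AB by (intro eq_vecI) (auto simp: algebra_simps simp del: index_mult_mat_vec)
  also have "\<dots> = 0\<^sub>v n" using uv by auto
  finally show ?thesis using uv by (auto simp: relations_def)
qed

lemma relations_zero: "(0\<^sub>v d, 0\<^sub>v e) \<in> relations"
  using AB by (auto simp: relations_def)

text \<open>A polynomial with coefficients \<open>a\<close> acts on both components at once, through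
  its value at \<open>x\<close> on one and at \<open>y\<close> on the other. The induction is
  Horner's scheme, splitting off the constant coefficient.\<close>

lemma relations_poly:
  assumes uv: "(u, v) \<in> relations"
  shows "\<exists>(u', v') \<in> relations. vec_eval u' x = (\<Sum>j<m. to_ac (a j) * x ^ j) * vec_eval u x
    \<and> vec_eval v' y = (\<Sum>j<m. to_ac (a j) * y ^ j) * vec_eval v y"
proof (induction m arbitrary: a)
  case 0
  show ?case using relations_zero by (intro bexI[of _ "(0\<^sub>v d, 0\<^sub>v e)"]) auto
next
  case (Suc m)
  obtain u' v' where uv': "(u', v') \<in> relations"
    "vec_eval u' x = (\<Sum>j<m. to_ac (a (Suc j)) * x ^ j) * vec_eval u x"
    "vec_eval v' y = (\<Sum>j<m. to_ac (a (Suc j)) * y ^ j) * vec_eval v y"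
    using Suc[of "\<lambda>j. a (Suc j)"] by auto
  have c: "u \<in> carrier_vec d" "v \<in> carrier_vec e" "u' \<in> carrier_vec d" "v' \<in> carrier_vec e"
    using uv uv' by (auto simp: relations_def)
  note C = gen_mat_carrier[OF d x] gen_mat_carrier[OF e y]
  have "(a 0 \<cdot>\<^sub>v u + gen_mat d x *\<^sub>v u', a 0 \<cdot>\<^sub>v v + gen_mat e y *\<^sub>v v') \<in> relations"
    by (intro relations_lin relations_shift uv uv')
  moreover have "vec_eval (a 0 \<cdot>\<^sub>v u + gen_mat d x *\<^sub>v u') x = to_ac (a 0) * vec_eval u x + x * vec_eval u' x"
    "vec_eval (a 0 \<cdot>\<^sub>v v + gen_mat e y *\<^sub>v v') y = to_ac (a 0) * vec_eval v y + y * vec_eval v' y"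
    using c C by (simp_all add: vec_eval_add[of _ d] vec_eval_add[of _ e] vec_eval_smult vec_eval_gen_mat[OF d x] vec_eval_gen_mat[OF e y])
  moreover have "(\<Sum>j<Suc m. to_ac (a j) * z ^ j) = to_ac (a 0) + z * (\<Sum>j<m. to_ac (a (Suc j)) * z ^ j)" for z
    by (subst sum.lessThan_Suc_shift) (simp add: sum_distrib_left mult_ac)
  ultimately show ?case
    by (intro bexI[of _ "(a 0 \<cdot>\<^sub>v u + gen_mat d x *\<^sub>v u', a 0 \<cdot>\<^sub>v v + gen_mat e y *\<^sub>v v')"])
       (simp_all only: uv' case_prod_conv, simp_all add: algebra_simps)
qed

lemma obtain_relation:
  assumes "hcat A B \<notin> inj_mats n (d + e)"
  obtains u v where "(u, v) \<in> relations" "v \<noteq> 0\<^sub>v e"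
proof -
  obtain w where w: "w \<in> carrier_vec (d + e)" "hcat A B *\<^sub>v w = 0\<^sub>v n" "w \<noteq> 0\<^sub>v (d + e)"
    using assms hcat_carrier[OF AB] by (auto simp: inj_mats_def)
  obtain u v where uv: "u \<in> carrier_vec d" "v \<in> carrier_vec e" "w = u @\<^sub>v v"
    using w(1) by (metis vec_first_carrier vec_first_last_append vec_last_carrier)
  have eq: "A *\<^sub>v u + B *\<^sub>v v = 0\<^sub>v n"
    using w(2) hcat_mult_vec[OF AB uv(1,2)] uv(3) by simp
  moreover have "v \<noteq> 0\<^sub>v e"
  proof
    assume v: "v = 0\<^sub>v e"
    have "B *\<^sub>v v = 0\<^sub>v n" using AB v by (auto intro!: eq_vecI)
    then have "A *\<^sub>v u = 0\<^sub>v n" using eq AB uv by simp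
    then have "u = 0\<^sub>v d" using A uv by (auto simp: inj_mats_def)
    then show False using w(3) uv(3) v by (auto intro!: eq_vecI)
  qed
  ultimately show ?thesis using that uv by (auto simp: relations_def)
qed

text \<open>Applying the minimal polynomial of \<open>x\<close> to a relation kills its first
  component. Injectivity of \<open>B\<close> then kills the second, and since
  \<open>vec_eval v y\<close> is nonzero, the polynomial must vanish at \<open>y\<close>.\<close>

lemma conjugate_if_dependent:
  assumes "hcat A B \<notin> inj_mats n (d + e)"
  shows "y \<in> (\<lambda>i. x ^ (CARD('a) ^ i)) ` {..<d}"
proof -
  obtain u v where uv: "(u, v) \<in> relations" "v \<noteq> 0\<^sub>v e" by (rule obtain_relation[OF assms])
  define c where "c = gen_coeffs d x"
  note c = gen_coeffs[OF d x, folded c_def]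
  define a where "a j = (if j < d then - vec_index c j else 1)" for j
  have ev: "(\<Sum>j<Suc d. to_ac (a j) * z ^ j) = z ^ d - vec_eval c z" for z
    using c(1) by (simp add: a_def vec_eval_def sum_negf)
  obtain u' v' where uv': "(u', v') \<in> relations" "vec_eval u' x = 0" "vec_eval v' y = (y ^ d - vec_eval c y) * vec_eval v y"
    using relations_poly[OF uv(1), where m = "Suc d" and a = a] c(2) unfolding ev by auto
  have cc: "u' \<in> carrier_vec d" "v' \<in> carrier_vec e" "A *\<^sub>v u' + B *\<^sub>v v' = 0\<^sub>v n" "v \<in> carrier_vec e"
    using uv' uv by (auto simp: relations_def)
  have "u' = 0\<^sub>v d" by (rule vec_eval_eq_0[OF x cc(1) uv'(2)])
  then have "A *\<^sub>v u' = 0\<^sub>v n" using AB by (auto intro!: eq_vecI)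
  then have "B *\<^sub>v v' = 0\<^sub>v n" using cc AB by simp
  then have "v' = 0\<^sub>v e" using B cc by (auto simp: inj_mats_def)
  then have "(y ^ d - vec_eval c y) * vec_eval v y = 0" using uv'(3) by simp
  moreover have "vec_eval v y \<noteq> 0" using vec_eval_eq_0[OF y cc(4)] uv(2) by auto
  ultimately have "y ^ d = vec_eval c y" by simp
  then show ?thesis unfolding c_def by (rule conjugate_if_min_poly_root[OF d x])
qed

text \<open>The inverse of \<open>vec_eval v y\<close> is a polynomial in \<open>y\<close>; acting
  with it turns the second component into the unit vector that represents 1. So the first column of
  \<open>B\<close> lies in the image of \<open>A\<close>, which limits the choices of
  \<open>B\<close>.\<close>

lemma dependent_imp_unit_vec_relation:
  assumes "hcat A B \<notin> inj_mats n (d + e)"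
  shows "\<exists>u\<in>carrier_vec d. A *\<^sub>v u + B *\<^sub>v unit_vec e 0 = 0\<^sub>v n"
proof -
  obtain u v where uv: "(u, v) \<in> relations" "v \<noteq> 0\<^sub>v e" by (rule obtain_relation[OF assms])
  then have v: "v \<in> carrier_vec e" by (auto simp: relations_def)
  then have "vec_eval v y \<noteq> 0" using vec_eval_eq_0[OF y] uv(2) by auto
  have "1 / vec_eval v y \<in> ext_field e"
    using ext_genD(1)[OF y] by (intro ext_field_divide vec_eval_in_ext_field one_in_ext_field)
  then obtain z where z: "z \<in> carrier_vec e" "vec_eval z y = 1 / vec_eval v y"
    using bij_betw_vec_eval[OF e y] by (force simp: bij_betw_def image_iff)
  obtain u' v' where uv': "(u', v') \<in> relations" "vec_eval v' y = vec_eval z y * vec_eval v y"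
    using relations_poly[OF uv(1), where m = e and a = "vec_index z"] z(1) by (auto simp: vec_eval_def)
  have "vec_eval (unit_vec e 0) y = (\<Sum>j<e. if j = 0 then 1 else 0)"
    unfolding vec_eval_def by (intro sum.cong) auto
  then have "vec_eval v' y = vec_eval (unit_vec e 0) y"
    using uv'(2) z(2) \<open>vec_eval v y \<noteq> 0\<close> e by simp
  moreover have "v' \<in> carrier_vec e" using uv' by (auto simp: relations_def)
  ultimately have "v' = unit_vec e 0"
    using bij_betw_vec_eval[OF e y] unit_vec_carrier[of e 0] unfolding bij_betw_def inj_on_def by blast
  then show ?thesis using uv' by (auto simp: relations_def)
qed

end


section \<open>Moments\<close>

definition intertwiners :: "nat \<Rightarrow> nat \<Rightarrow> 'a :: field mat \<Rightarrow> 'a mat \<Rightarrow> 'a mat set" where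
  "intertwiners n d C g = {A \<in> inj_mats n d. g * A = A * C}"

lemma finite_intertwiners: "finite (intertwiners n d C g :: 'a :: {field, finite} mat set)"
  unfolding intertwiners_def using finite_inj_mats[of n d, where 'a='a] by simp

lemma card_GL_pos: "card (GL n :: 'a :: {field, finite} mat set) > 0"
  using GL_nonempty[of n, where 'a='a] finite_GL[of n, where 'a='a] by (simp add: card_gt_0_iff)

lemma sum_card_intertwiners:
  fixes C :: "'a :: {field, finite} mat"
  assumes C: "C \<in> GL d" and d: "d \<le> n"
  shows "(\<Sum>g\<in>GL n. real (card (intertwiners n d C g))) = card (GL n :: 'a mat set)"
proof -
  obtain m where n: "n = d + m" using d by (metis le_add_diff_inverse)
  show ?thesis
    using sum_intertwiners[OF C, of m "\<lambda>_. 1" 0] card_GL_pos[of m, where 'a='a]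
    unfolding n intertwiners_def by simp
qed

text \<open>Intertwiners with more columns than rows do not exist. This case arises for pairs of
  degrees whose sum exceeds \<open>n\<close>.\<close>

lemma sum_card_intertwiners_le:
  fixes C :: "'a :: {field, finite} mat"
  assumes C: "C \<in> GL d"
  shows "(\<Sum>g\<in>GL n. real (card (intertwiners n d C g))) \<le> card (GL n :: 'a mat set)"
proof (cases "d \<le> n")
  case True
  then show ?thesis using sum_card_intertwiners[OF C True] by simp
next
  case False
  then have "intertwiners n d C g = {}" for g
    using inj_mats_dim_le by (force simp: intertwiners_def)
  then show ?thesis by simp
qed

lemma hcat_intertwines:
  fixes g :: "'a :: field mat"
  assumes A: "A \<in> carrier_mat n d" "g * A = A * C" and B: "B \<in> carrier_mat n e" "g * B = B * C'"
    and g: "g \<in> carrier_mat n n" and C: "C \<in> carrier_mat d d" "C' \<in> carrier_mat e e"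
  shows "g * hcat A B = hcat A B * four_block_mat C (0\<^sub>m d e) (0\<^sub>m e d) C'"
proof -
  \<comment> \<open>Padding \<open>g\<close> with empty blocks brings it into the shape required by
    the block product formula.\<close>
  have "g = four_block_mat g (0\<^sub>m n 0) (0\<^sub>m 0 n) (0\<^sub>m 0 0)"
    using g by (intro eq_matI) auto
  then have "g * hcat A B = four_block_mat g (0\<^sub>m n 0) (0\<^sub>m 0 n) (0\<^sub>m 0 0) * four_block_mat A B (0\<^sub>m 0 d) (0\<^sub>m 0 e)"
    using A B by (simp add: hcat_def)
  also have "\<dots> = four_block_mat (g * A + 0\<^sub>m n 0 * 0\<^sub>m 0 d) (g * B + 0\<^sub>m n 0 * 0\<^sub>m 0 e)
      (0\<^sub>m 0 n * A + 0\<^sub>m 0 0 * 0\<^sub>m 0 d) (0\<^sub>m 0 n * B + 0\<^sub>m 0 0 * 0\<^sub>m 0 e)"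
    using A B g by (intro mult_four_block_mat[where ?nr1.0 = n and ?nr2.0 = 0 and ?n1.0 = n and ?n2.0 = 0]) auto
  also have "\<dots> = four_block_mat (A * C + B * 0\<^sub>m e d) (A * 0\<^sub>m d e + B * C')
      (0\<^sub>m 0 d * C + 0\<^sub>m 0 e * 0\<^sub>m e d) (0\<^sub>m 0 d * 0\<^sub>m d e + 0\<^sub>m 0 e * C')"
    using A B g C by (intro cong_four_block_mat) (auto intro!: eq_matI)
  also have "\<dots> = four_block_mat A B (0\<^sub>m 0 d) (0\<^sub>m 0 e) * four_block_mat C (0\<^sub>m d e) (0\<^sub>m e d) C'"
    using A B C
    by (intro mult_four_block_mat[symmetric, where ?nr1.0 = n and ?nr2.0 = 0 and ?n1.0 = d and ?n2.0 = e]) auto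
  also have "\<dots> = hcat A B * four_block_mat C (0\<^sub>m d e) (0\<^sub>m e d) C'"
    using A B by (simp add: hcat_def)
  finally show ?thesis .
qed

lemma hcat_inject:
  assumes "A \<in> carrier_mat n d" "A' \<in> carrier_mat n d" "B \<in> carrier_mat n e" "B' \<in> carrier_mat n e"
    and eq: "hcat A B = hcat A' B'"
  shows "A = A'" "B = B'"
proof -
  show "A = A'"
  proof (rule eq_matI)
    fix i j assume "i < dim_row A'" "j < dim_col A'"
    then show "A $$ (i, j) = A' $$ (i, j)"
      using arg_cong[OF eq, of "\<lambda>M. M $$ (i, j)"] assms by (auto simp: hcat_def)
  qed (use assms in auto)
  show "B = B'"
  proof (rule eq_matI)
    fix i j assume "i < dim_row B'" "j < dim_col B'"
    then show "B $$ (i, j) = B' $$ (i, j)"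
      using arg_cong[OF eq, of "\<lambda>M. M $$ (i, d + j)"] assms by (auto simp: hcat_def)
  qed (use assms in auto)
qed

lemma mult_mat_unit_vec:
  fixes A :: "'a :: field mat"
  assumes "A \<in> carrier_mat n e" "i < n" "j < e"
  shows "vec_index (A *\<^sub>v unit_vec e j) i = A $$ (i, j)"
proof -
  have "vec_index (A *\<^sub>v unit_vec e j) i = (\<Sum>l<e. A $$ (i, l) * vec_index (unit_vec e j) l)"
    using assms by (intro mult_mat_vec_index) auto
  also have "\<dots> = (\<Sum>l<e. if l = j then A $$ (i, l) else 0)"
    using assms by (intro sum.cong) auto
  finally show ?thesis using assms by simp
qed

lemma gen_mat_unit_vec:
  assumes e: "e > 0" and y: "y \<in> ext_gen e" and j: "Suc j < e"
  shows "gen_mat e y *\<^sub>v unit_vec e j = unit_vec e (Suc j)"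
proof (rule eq_vecI)
  fix i assume "i < dim_vec (unit_vec e (Suc j) :: 'a vec)"
  then have i: "i < e" by simp
  have "vec_index (gen_mat e y *\<^sub>v unit_vec e j) i = gen_mat e y $$ (i, j)"
    using gen_mat_carrier[OF e y] i j by (intro mult_mat_unit_vec) auto
  also have "\<dots> = vec_index (unit_vec e (Suc j)) i"
    using i j gen_coeffs(1)[OF e y] by (auto simp: gen_mat_def companion_def)
  finally show "vec_index (gen_mat e y *\<^sub>v unit_vec e j) i = vec_index (unit_vec e (Suc j)) i" .
qed (use gen_mat_carrier[OF e y] in auto)

text \<open>The first unit vector is cyclic for the companion matrix, so its image determines every
  further column by applying \<open>g\<close>.\<close>

lemma intertwiner_eq_if_unit_vec_eq:
  fixes A B :: "'a :: {field, finite} mat"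
  assumes e: "e > 0" and y: "y \<in> ext_gen e" and g: "g \<in> carrier_mat n n"
    and A: "A \<in> carrier_mat n e" "g * A = A * gen_mat e y"
    and B: "B \<in> carrier_mat n e" "g * B = B * gen_mat e y"
    and eq: "A *\<^sub>v unit_vec e 0 = B *\<^sub>v unit_vec e 0"
  shows "A = B"
proof -
  have step: "M *\<^sub>v unit_vec e (Suc j) = g *\<^sub>v (M *\<^sub>v unit_vec e j)"
    if "M \<in> carrier_mat n e" "g * M = M * gen_mat e y" "Suc j < e" for M j
    using assoc_mult_mat_vec[OF that(1) gen_mat_carrier[OF e y] unit_vec_carrier[of e j]]
      assoc_mult_mat_vec[OF g that(1) unit_vec_carrier[of e j]] that(2) gen_mat_unit_vec[OF e y that(3)] by simp
  have cols: "A *\<^sub>v unit_vec e j = B *\<^sub>v unit_vec e j" if "j < e" for j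
    using that
  proof (induction j)
    case 0
    show ?case by (rule eq)
  next
    case (Suc j)
    then show ?case using step[OF A Suc.prems] step[OF B Suc.prems] by simp
  qed
  show ?thesis
  proof (rule eq_matI)
    fix i j assume "i < dim_row B" "j < dim_col B"
    then have ij: "i < n" "j < e" using B by auto
    have "A $$ (i, j) = vec_index (A *\<^sub>v unit_vec e j) i" using mult_mat_unit_vec[OF A(1) ij] by simp
    also have "\<dots> = B $$ (i, j)" unfolding cols[OF ij(2)] using mult_mat_unit_vec[OF B(1) ij] by simp
    finally show "A $$ (i, j) = B $$ (i, j)" .
  qed (use A B in auto)
qed

lemma vec_add_right_cancel:
  fixes u :: "'a :: group_add vec"
  assumes "u \<in> carrier_vec n" "v \<in> carrier_vec n" "w \<in> carrier_vec n" "u + v = u + w"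
  shows "v = w"
proof (rule eq_vecI)
  fix i assume "i < dim_vec w"
  then have "vec_index (u + v) i = vec_index u i + vec_index v i" "vec_index (u + w) i = vec_index u i + vec_index w i"
    using assms(1-3) by auto
  then show "vec_index v i = vec_index w i" by (simp add: assms(4))
qed (use assms in auto)

text \<open>Independent pairs concatenate to intertwiners of the block diagonal matrix. Dependent
  pairs require conjugate \<open>x\<close> and \<open>y\<close>; then the first column of
  \<open>B\<close> is \<open>- A u\<close> for one of \<open>q ^ d\<close> vectors \<open>u\<close>,
  and it determines \<open>B\<close>.\<close>

lemma card_intertwiners_pair_le:
  fixes x y :: "'a :: {field, finite} alg_closure"
  assumes d: "d > 0" and x: "x \<in> ext_gen d" and e: "e > 0" and y: "y \<in> ext_gen e" and g: "g \<in> GL n"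
  shows "real (card (intertwiners n d (gen_mat d x) g)) * real (card (intertwiners n e (gen_mat e y) g))
    \<le> card (intertwiners n (d + e) (four_block_mat (gen_mat d x) (0\<^sub>m d e) (0\<^sub>m e d) (gen_mat e y)) g)
      + (if y \<in> (\<lambda>i. x ^ (CARD('a) ^ i)) ` {..<d} then real CARD('a) ^ d else 0) * card (intertwiners n d (gen_mat d x) g)"
proof -
  let ?I = "intertwiners n d (gen_mat d x) g" and ?I' = "intertwiners n e (gen_mat e y) g"
  let ?C = "four_block_mat (gen_mat d x) (0\<^sub>m d e) (0\<^sub>m e d) (gen_mat e y)"
  let ?conj = "y \<in> (\<lambda>i. x ^ (CARD('a) ^ i)) ` {..<d}"
  define P where "P = {(A, B) \<in> ?I \<times> ?I'. hcat A B \<in> inj_mats n (d + e)}"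
  define N where "N A = {B \<in> ?I'. hcat A B \<notin> inj_mats n (d + e)}" for A
  have gc: "g \<in> carrier_mat n n" using g by (rule GL_carrier)
  have fin: "finite ?I" "finite ?I'" by (rule finite_intertwiners)+
  have finN: "finite (N A)" for A unfolding N_def using fin by simp
  have "?I \<times> ?I' = P \<union> Sigma ?I N" by (auto simp: P_def N_def)
  from arg_cong[OF this, of card] have "card ?I * card ?I' = card (P \<union> Sigma ?I N)"
    by (simp only: card_cartesian_product)
  also have "\<dots> \<le> card P + card (Sigma ?I N)" by (rule card_Un_le)
  also have "card (Sigma ?I N) = (\<Sum>A\<in>?I. card (N A))" using fin finN by simp
  finally have "real (card ?I * card ?I') \<le> real (card P + (\<Sum>A\<in>?I. card (N A)))"
    by (rule of_nat_mono)
  then have prod_le: "real (card ?I) * real (card ?I') \<le> real (card P) + (\<Sum>A\<in>?I. real (card (N A)))"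
    by simp
  have P_le: "card P \<le> card (intertwiners n (d + e) ?C g)"
  proof (rule card_inj_on_le[where f = "\<lambda>(A, B). hcat A B"])
    show "inj_on (\<lambda>(A, B). hcat A B) P"
    proof (rule inj_onI, clarify)
      fix A B A' B' assume h: "(A, B) \<in> P" "(A', B') \<in> P" "hcat A B = hcat A' B'"
      then have c: "A \<in> carrier_mat n d" "A' \<in> carrier_mat n d" "B \<in> carrier_mat n e" "B' \<in> carrier_mat n e"
        by (auto simp: P_def intertwiners_def inj_mats_def)
      show "A = A' \<and> B = B'" using hcat_inject[OF c h(3)] by simp
    qed
    show "(\<lambda>(A, B). hcat A B) ` P \<subseteq> intertwiners n (d + e) ?C g"
    proof clarify
      fix A B assume "(A, B) \<in> P"
      then have h: "A \<in> carrier_mat n d" "g * A = A * gen_mat d x" "B \<in> carrier_mat n e" "g * B = B * gen_mat e y"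
        "hcat A B \<in> inj_mats n (d + e)"
        by (auto simp: P_def intertwiners_def inj_mats_def)
      show "hcat A B \<in> intertwiners n (d + e) ?C g"
        using hcat_intertwines[OF h(1-4) gc gen_mat_carrier[OF d x] gen_mat_carrier[OF e y]] h(5)
        by (simp add: intertwiners_def)
    qed
  qed (rule finite_intertwiners)
  have N_le: "(\<Sum>A\<in>?I. real (card (N A))) \<le> (\<Sum>A\<in>?I. if ?conj then real CARD('a) ^ d else 0)"
  proof (rule sum_mono)
    fix A assume A: "A \<in> ?I"
    then have A': "A \<in> inj_mats n d" "g * A = A * gen_mat d x" by (auto simp: intertwiners_def)
    have Ac: "A \<in> carrier_mat n d" using A' by (simp add: inj_mats_def)
    have conj: "?conj" if "B \<in> N A" for B
      using conjugate_if_dependent[OF d x e y gc A'] that by (auto simp: N_def intertwiners_def)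
    have "card (N A) \<le> CARD('a) ^ d"
    proof -
      have "\<exists>u. u \<in> carrier_vec d \<and> A *\<^sub>v u + B *\<^sub>v unit_vec e 0 = 0\<^sub>v n" if "B \<in> N A" for B
        using dependent_imp_unit_vec_relation[OF d x e y gc A'] that by (auto simp: N_def intertwiners_def)
      then obtain f where f: "\<And>B. B \<in> N A \<Longrightarrow> f B \<in> carrier_vec d \<and> A *\<^sub>v f B + B *\<^sub>v unit_vec e 0 = 0\<^sub>v n"
        by metis
      have "inj_on f (N A)"
      proof (rule inj_onI)
        fix B B' assume BB: "B \<in> N A" "B' \<in> N A" "f B = f B'"
        have c: "B \<in> carrier_mat n e" "g * B = B * gen_mat e y" "B' \<in> carrier_mat n e" "g * B' = B' * gen_mat e y"
          using BB by (auto simp: N_def intertwiners_def inj_mats_def)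
        have "B *\<^sub>v unit_vec e 0 = B' *\<^sub>v unit_vec e 0"
          by (rule vec_add_right_cancel[of "A *\<^sub>v f B" n])
             (use f[OF BB(1)] f[OF BB(2)] BB(3) c Ac in auto)
        then show "B = B'" by (rule intertwiner_eq_if_unit_vec_eq[OF e y gc c])
      qed
      then have "card (N A) \<le> card (carrier_vec d :: 'a vec set)"
        using f by (intro card_inj_on_le[of f]) (auto simp: finite_carrier_vec)
      then show ?thesis by (simp add: card_carrier_vec)
    qed
    then have "real (card (N A)) \<le> real CARD('a) ^ d"
      using of_nat_mono[of "card (N A)" "CARD('a) ^ d", where 'a=real] by simp
    moreover have "N A = {}" if "\<not> ?conj" using conj that by auto
    ultimately show "real (card (N A)) \<le> (if ?conj then real CARD('a) ^ d else 0)" by auto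
  qed
  have "(\<Sum>A\<in>?I. if ?conj then real CARD('a) ^ d else 0) = (if ?conj then real CARD('a) ^ d else 0) * card ?I"
    by simp
  then show ?thesis using prod_le of_nat_mono[OF P_le, where 'a=real] N_le by linarith
qed

lemma sum_card_intertwiners_pair_le:
  fixes x y :: "'a :: {field, finite} alg_closure"
  assumes d: "d > 0" and x: "x \<in> ext_gen d" and e: "e > 0" and y: "y \<in> ext_gen e"
  shows "(\<Sum>g\<in>GL n. real (card (intertwiners n d (gen_mat d x) g)) * real (card (intertwiners n e (gen_mat e y) g)))
    \<le> card (GL n :: 'a mat set) * (1 + (if y \<in> (\<lambda>i. x ^ (CARD('a) ^ i)) ` {..<d} then real CARD('a) ^ d else 0))"
proof -
  let ?C = "four_block_mat (gen_mat d x) (0\<^sub>m d e) (0\<^sub>m e d) (gen_mat e y)"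
  let ?q = "if y \<in> (\<lambda>i. x ^ (CARD('a) ^ i)) ` {..<d} then real CARD('a) ^ d else 0"
  have "?C \<in> GL (d + e)"
    using gen_mat_in_GL[OF e y] by (subst four_block_in_GL_iff[OF gen_mat_in_GL[OF d x]]) (auto dest: GL_carrier)
  note C = sum_card_intertwiners_le[OF this, of n] sum_card_intertwiners_le[OF gen_mat_in_GL[OF d x], of n]
  have "(\<Sum>g\<in>GL n. real (card (intertwiners n d (gen_mat d x) g)) * real (card (intertwiners n e (gen_mat e y) g)))
    \<le> (\<Sum>g\<in>GL n. real (card (intertwiners n (d + e) ?C g)) + ?q * card (intertwiners n d (gen_mat d x) g))"
    by (intro sum_mono card_intertwiners_pair_le assms)
  also have "\<dots> = (\<Sum>g\<in>GL n. real (card (intertwiners n (d + e) ?C g)))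
      + ?q * (\<Sum>g\<in>GL n. real (card (intertwiners n d (gen_mat d x) g)))"
    by (simp only: sum.distrib sum_distrib_left)
  also have "\<dots> \<le> card (GL n :: 'a mat set) + ?q * card (GL n :: 'a mat set)"
    using C by (intro add_mono mult_left_mono) auto
  finally show ?thesis by (simp add: algebra_simps)
qed


section \<open>Generators: their number, their traces and their weighted count\<close>

lemma finite_ext_gen: "d > 0 \<Longrightarrow> finite (ext_gen d :: 'a :: {field, finite} alg_closure set)"
  by (rule finite_subset[OF _ finite_ext_field]) (auto simp: ext_gen_def)

lemma card_ext_field_units:
  assumes "d > 0"
  shows "real (card (ext_field d - {0 :: 'a :: {field, finite} alg_closure})) = real CARD('a) ^ d - 1"
proof -
  have "card (ext_field d :: 'a alg_closure set) = Suc (card (ext_field d - {0 :: 'a alg_closure}))"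
    by (rule card.remove[OF finite_ext_field[OF assms] zero_in_ext_field])
  then have "CARD('a) ^ d = Suc (card (ext_field d - {0 :: 'a alg_closure}))"
    using assms by (simp add: card_ext_field)
  then have "real (CARD('a) ^ d) = real (Suc (card (ext_field d - {0 :: 'a alg_closure})))"
    by (rule arg_cong[of _ _ real])
  then show ?thesis by simp
qed

lemma card_ext_gen_bounds:
  assumes "d > 0"
  shows "real (card (ext_gen d :: 'a :: {field, finite} alg_closure set)) \<le> real CARD('a) ^ d - 1"
    and "real CARD('a) ^ d - 1 \<le> real (card (ext_gen d :: 'a alg_closure set)) + 2 * sqrt (real CARD('a) ^ d)"
    and "real (card (ext_field d - {0} - ext_gen d :: 'a alg_closure set)) \<le> 2 * sqrt (real CARD('a) ^ d)"
proof -
  let ?U = "ext_field d - {0} :: 'a alg_closure set"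
  have fin: "finite ?U" using finite_ext_field[OF assms, where 'a='a] by simp
  have sub: "ext_gen d \<subseteq> ?U" by (auto simp: ext_gen_def)
  show "real (card (ext_gen d :: 'a alg_closure set)) \<le> real CARD('a) ^ d - 1"
    using card_mono[OF fin sub] card_ext_field_units[OF assms, where 'a='a] by simp
  have "(real CARD('a) ^ (d div 2))\<^sup>2 \<le> real CARD('a) ^ d"
    using finite_field_card_gt_1[where 'a='a] unfolding power_mult[symmetric] by (intro power_increasing) auto
  then have "real CARD('a) ^ (d div 2) \<le> sqrt (real CARD('a) ^ d)"
    by (rule real_le_rsqrt)
  moreover have "real (card (?U - ext_gen d)) \<le> 2 * real CARD('a) ^ (d div 2)"
    using of_nat_mono[OF card_non_ext_gen_le[OF assms, where 'a='a], where 'a=real] by simp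
  ultimately show *: "real (card (?U - ext_gen d)) \<le> 2 * sqrt (real CARD('a) ^ d)" by linarith
  have "real (card ?U) = real (card (ext_gen d :: 'a alg_closure set)) + real (card (?U - ext_gen d))"
    using card_Un_disjoint[of "ext_gen d" "?U - ext_gen d"] fin sub finite_subset[OF sub fin]
    by (simp add: Un_absorb1)
  then show "real CARD('a) ^ d - 1 \<le> real (card (ext_gen d :: 'a alg_closure set)) + 2 * sqrt (real CARD('a) ^ d)"
    using * card_ext_field_units[OF assms, where 'a='a] by linarith
qed

text \<open>Two errors add up: the summand with the gcd is the deviation over all nonzero field
  elements, and the 2 pays for discarding elements of smaller degree.\<close>

lemma trace_gen_mat_equidistribution:
  fixes s :: "'a :: {field, finite}"
  assumes d: "d > 0" and k: "k > 0"
  shows "\<bar>real (card {x \<in> ext_gen d. trace_mat (gen_mat d x ^\<^sub>m k) = s}) - (real CARD('a) ^ d - 1) / real CARD('a)\<bar>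
    \<le> (real (gcd k (CARD('a) ^ d - 1)) + 2) * sqrt (real CARD('a) ^ d)"
proof -
  let ?U = "ext_field d - {0} :: 'a alg_closure set"
  let ?m = "(real CARD('a) ^ d - 1) / real CARD('a)"
  define N where "N = {x \<in> ?U. ext_trace d (x ^ k) = to_ac s}"
  define G where "G = {x \<in> ext_gen d. trace_mat (gen_mat d x ^\<^sub>m k) = s}"
  have fin: "finite ?U" using finite_ext_field[OF d, where 'a='a] by simp
  have G: "G = {x \<in> ext_gen d. ext_trace d (x ^ k) = to_ac s}"
    unfolding G_def by (rule Collect_cong) (metis trace_gen_mat_pow[OF d] to_ac_eq_iff)
  have GN: "G \<subseteq> N" unfolding G N_def by (auto simp: ext_gen_def)
  have finN: "finite N" unfolding N_def using fin by simp
  have "N - G \<subseteq> ?U - ext_gen d" unfolding G N_def by auto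
  then have "card (N - G) \<le> card (?U - ext_gen d)"
    using fin by (intro card_mono) auto
  moreover have "card N = card G + card (N - G)"
    using card_Un_disjoint[of G "N - G"] GN finN finite_subset[OF GN finN] by (simp add: Un_absorb1)
  ultimately have NG: "\<bar>real (card G) - real (card N)\<bar> \<le> 2 * sqrt (real CARD('a) ^ d)"
    using card_ext_gen_bounds(3)[OF d, where 'a='a] by linarith
  have "(real (card N) - ?m)\<^sup>2 \<le> (real (gcd k (CARD('a) ^ d - 1)))\<^sup>2 * real CARD('a) ^ d"
    unfolding N_def by (intro ext_trace_power_equidistribution d k to_ac_in_ext_field)
  then have "\<bar>real (card N) - ?m\<bar> \<le> sqrt ((real (gcd k (CARD('a) ^ d - 1)))\<^sup>2 * real CARD('a) ^ d)"
    by (intro real_le_rsqrt) simp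
  also have "\<dots> = real (gcd k (CARD('a) ^ d - 1)) * sqrt (real CARD('a) ^ d)"
    by (simp add: real_sqrt_mult)
  finally show ?thesis
    using NG unfolding G_def[symmetric] by (simp add: algebra_simps abs_le_iff)
qed

text \<open>Normalised by all nonzero elements of \<open>ext_field d\<close>, not only the
  generators; the small shortfall of the resulting mean from \<open>1 / d\<close> is estimated
  separately.\<close>

definition weight :: "real \<Rightarrow> nat \<Rightarrow> real" where
  "weight q d = 1 / (real d * (q ^ d - 1))"

definition gen_count :: "nat \<Rightarrow> nat set \<Rightarrow> 'a :: {field, finite} mat \<Rightarrow> real" where
  "gen_count n D g = (\<Sum>(d, x)\<in>Sigma D ext_gen. weight (real CARD('a)) d * real (card (intertwiners n d (gen_mat d x) g)))"

lemma sum_gen_count: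
  assumes D: "finite D" "\<And>d. d \<in> D \<Longrightarrow> 0 < d \<and> d \<le> n"
  shows "(\<Sum>g\<in>GL n. gen_count n D (g :: 'a :: {field, finite} mat))
    = card (GL n :: 'a mat set) * (\<Sum>(d, x)\<in>Sigma D (ext_gen :: nat \<Rightarrow> 'a alg_closure set). weight (real CARD('a)) d)"
proof -
  have "(\<Sum>g\<in>GL n. gen_count n D (g :: 'a mat))
      = (\<Sum>(d, x)\<in>Sigma D ext_gen. weight (real CARD('a)) d * (\<Sum>g\<in>(GL n :: 'a mat set). real (card (intertwiners n d (gen_mat d x) g))))"
    unfolding gen_count_def by (subst sum.swap) (simp add: case_prod_unfold sum_distrib_left)
  also have "\<dots> = (\<Sum>(d, x)\<in>Sigma D (ext_gen :: nat \<Rightarrow> 'a alg_closure set). weight (real CARD('a)) d * card (GL n :: 'a mat set))"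
    by (intro sum.cong[OF refl]) (use D in \<open>auto simp: sum_card_intertwiners gen_mat_in_GL\<close>)
  also have "\<dots> = card (GL n :: 'a mat set) * (\<Sum>(d, x)\<in>Sigma D (ext_gen :: nat \<Rightarrow> 'a alg_closure set). weight (real CARD('a)) d)"
    by (simp add: sum_distrib_left case_prod_unfold mult.commute)
  finally show ?thesis .
qed

lemma weight_bounds:
  assumes "d > 0"
  shows "weight (real CARD('a :: {field, finite})) d > 0"
    "weight (real CARD('a)) d * (real CARD('a) ^ d - 1) = 1 / real d"
    "weight (real CARD('a)) d * real CARD('a) ^ d \<le> 2 / real d"
proof -
  have q: "real CARD('a) ^ d \<ge> 2"
    using of_nat_mono[of 2 "CARD('a) ^ d", where 'a=real] card_power_gt_1[OF assms, where 'a='a] by simp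
  then show "weight (real CARD('a)) d > 0" "weight (real CARD('a)) d * (real CARD('a) ^ d - 1) = 1 / real d"
    using assms by (auto simp: weight_def)
  have "weight (real CARD('a)) d * real CARD('a) ^ d \<le> weight (real CARD('a)) d * (2 * (real CARD('a) ^ d - 1))"
    using q \<open>weight (real CARD('a)) d > 0\<close> by (intro mult_left_mono) auto
  also have "\<dots> = 2 * (weight (real CARD('a)) d * (real CARD('a) ^ d - 1))"
    by (rule mult.left_commute)
  also have "\<dots> = 2 / real d"
    unfolding \<open>weight (real CARD('a)) d * (real CARD('a) ^ d - 1) = 1 / real d\<close> by simp
  finally show "weight (real CARD('a)) d * real CARD('a) ^ d \<le> 2 / real d" .
qed

lemma sum_conjugate_weights:
  fixes x :: "'a :: {field, finite} alg_closure"
  assumes D: "finite D" "\<And>d. d \<in> D \<Longrightarrow> 0 < d" and d: "d \<in> D" and x: "x \<in> ext_gen d"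
  shows "(\<Sum>(e, y)\<in>Sigma D ext_gen. if y \<in> (\<lambda>i. x ^ (CARD('a) ^ i)) ` {..<d} then weight (real CARD('a)) e else 0)
    \<le> real d * weight (real CARD('a)) d"
proof -
  let ?c = "(\<lambda>i. x ^ (CARD('a) ^ i)) ` {..<d}"
  let ?w = "weight (real CARD('a))"
  have d0: "d > 0" using D d by auto
  have fin: "finite (Sigma D (ext_gen :: nat \<Rightarrow> 'a alg_closure set))"
    using D by (intro finite_SigmaI) (auto intro: finite_ext_gen)
  have deg: "e = d" if "e \<in> D" "y \<in> ext_gen e" "y \<in> ?c" for e y
    using that D(2)[OF that(1)] by (auto intro: ext_gen_conjugate_degree[OF d0 _ x])
  have "(\<Sum>(e, y)\<in>Sigma D ext_gen. if y \<in> ?c then ?w e else 0)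
      = (\<Sum>p\<in>Sigma D ext_gen. if p \<in> {p. snd p \<in> ?c} then ?w (fst p) else 0)"
    by (intro sum.cong) auto
  also have "\<dots> = (\<Sum>p\<in>Sigma D ext_gen \<inter> {p. snd p \<in> ?c}. ?w (fst p))"
    using fin by (simp add: sum.inter_restrict)
  also have "\<dots> = (\<Sum>p\<in>Sigma D ext_gen \<inter> {p. snd p \<in> ?c}. ?w d)"
    by (intro sum.cong refl) (auto dest: deg)
  also have "\<dots> = card (Sigma D ext_gen \<inter> {p. snd p \<in> ?c}) * ?w d" by simp
  also have "\<dots> \<le> real d * ?w d"
  proof (rule mult_right_mono)
    have "card (Sigma D ext_gen \<inter> {p. snd p \<in> ?c}) \<le> card ({d} \<times> ?c)"
      using deg by (intro card_mono) auto
    also have "\<dots> = card ?c" by (simp add: card_cartesian_product)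
    also have "\<dots> \<le> d" using card_image_le[of "{..<d}" "\<lambda>i. x ^ (CARD('a) ^ i)"] by simp
    finally show "real (card (Sigma D ext_gen \<inter> {p. snd p \<in> ?c})) \<le> real d" by simp
    show "?w d \<ge> 0" using weight_bounds(1)[OF d0, where 'a='a] by simp
  qed
  finally show ?thesis .
qed

text \<open>The square of the mean comes from the bound 1 for each pair. For conjugate pairs,
  \<open>weight * q ^ d \<le> 2 / d\<close>, while the weights of the at most \<open>d\<close>
  conjugates add up to at most \<open>d * weight\<close>; their product is at most
  \<open>2 * weight\<close>, whose sum over generators of degree \<open>d\<close> is at most
  \<open>2 / d\<close>.\<close>

lemma sum_gen_count_squared_le:
  assumes D: "finite D" "\<And>d. d \<in> D \<Longrightarrow> 0 < d"
  shows "(\<Sum>g\<in>GL n. (gen_count n D (g :: 'a :: {field, finite} mat))\<^sup>2)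
    \<le> card (GL n :: 'a mat set) * ((\<Sum>(d, x)\<in>Sigma D (ext_gen :: nat \<Rightarrow> 'a alg_closure set). weight (real CARD('a)) d)\<^sup>2
        + 2 * (\<Sum>d\<in>D. 1 / real d))"
proof -
  let ?q = "real CARD('a)"
  let ?I = "Sigma D (ext_gen :: nat \<Rightarrow> 'a alg_closure set)"
  let ?GL = "GL n :: 'a mat set"
  define w where "w p = weight ?q (fst p)" for p :: "nat \<times> 'a alg_closure"
  define Y where "Y p g = real (card (intertwiners n (fst p) (gen_mat (fst p) (snd p)) g))" for p :: "nat \<times> 'a alg_closure" and g
  define con where "con p r \<longleftrightarrow> snd r \<in> (\<lambda>i. snd p ^ (CARD('a) ^ i)) ` {..<fst p}" for p r :: "nat \<times> 'a alg_closure"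
  have wpos: "w p \<ge> 0" if "p \<in> ?I" for p
    using that D weight_bounds(1)[of "fst p", where 'a='a] by (force simp: w_def)
  have gc: "gen_count n D g = (\<Sum>p\<in>?I. w p * Y p g)" for g :: "'a mat"
    by (simp add: gen_count_def w_def Y_def case_prod_unfold)
  have "(\<Sum>g\<in>?GL. (gen_count n D g)\<^sup>2) = (\<Sum>g\<in>?GL. \<Sum>p\<in>?I. \<Sum>r\<in>?I. w p * w r * (Y p g * Y r g))"
    unfolding gc power2_eq_square sum_product by (simp add: mult_ac)
  also have "\<dots> = (\<Sum>p\<in>?I. \<Sum>r\<in>?I. \<Sum>g\<in>?GL. w p * w r * (Y p g * Y r g))"
    by (subst sum.swap, rule sum.cong[OF refl], rule sum.swap)
  also have "\<dots> = (\<Sum>p\<in>?I. \<Sum>r\<in>?I. w p * w r * (\<Sum>g\<in>?GL. Y p g * Y r g))"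
    by (simp add: sum_distrib_left)
  also have "\<dots> \<le> (\<Sum>p\<in>?I. \<Sum>r\<in>?I. w p * w r * (card ?GL * (1 + (if con p r then ?q ^ fst p else 0))))"
  proof (intro sum_mono mult_left_mono)
    fix p r assume pr: "p \<in> ?I" "r \<in> ?I"
    show "(\<Sum>g\<in>?GL. Y p g * Y r g) \<le> card ?GL * (1 + (if con p r then ?q ^ fst p else 0))"
      unfolding Y_def con_def using pr D by (intro sum_card_intertwiners_pair_le) auto
    show "0 \<le> w p * w r" using wpos pr by simp
  qed
  also have "\<dots> = (\<Sum>p\<in>?I. \<Sum>r\<in>?I. card ?GL * (w p * w r) + card ?GL * (w p * ?q ^ fst p * (if con p r then w r else 0)))"
    by (intro sum.cong refl) (simp add: algebra_simps)
  also have "\<dots> = card ?GL * ((\<Sum>p\<in>?I. w p)\<^sup>2 + (\<Sum>p\<in>?I. w p * ?q ^ fst p * (\<Sum>r\<in>?I. if con p r then w r else 0)))"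
    unfolding power2_eq_square sum_product by (simp only: sum.distrib sum_distrib_left distrib_left)
  also have "\<dots> \<le> card ?GL * ((\<Sum>p\<in>?I. w p)\<^sup>2 + 2 * (\<Sum>d\<in>D. 1 / real d))"
  proof (intro mult_left_mono add_left_mono)
    have "(\<Sum>p\<in>?I. w p * ?q ^ fst p * (\<Sum>r\<in>?I. if con p r then w r else 0))
        \<le> (\<Sum>p\<in>?I. w p * ?q ^ fst p * (real (fst p) * w p))"
    proof (intro sum_mono mult_left_mono)
      fix p assume p: "p \<in> ?I"
      show "0 \<le> w p * ?q ^ fst p" using wpos[OF p] by simp
      show "(\<Sum>r\<in>?I. if con p r then w r else 0) \<le> real (fst p) * w p"
        unfolding con_def w_def
        using sum_conjugate_weights[OF D, of "fst p" "snd p"] p by (auto simp: case_prod_unfold)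
    qed
    also have "\<dots> \<le> (\<Sum>p\<in>?I. 2 * w p)"
    proof (intro sum_mono)
      fix p assume p: "p \<in> ?I"
      then have p0: "fst p > 0" using D by auto
      have "w p * ?q ^ fst p * (real (fst p) * w p) \<le> (2 / real (fst p)) * (real (fst p) * w p)"
        using weight_bounds(3)[OF p0, where 'a='a] wpos[OF p] by (intro mult_right_mono) (auto simp: w_def)
      also have "\<dots> = 2 * w p" using p0 by simp
      finally show "w p * ?q ^ fst p * (real (fst p) * w p) \<le> 2 * w p" .
    qed
    also have "\<dots> = 2 * (\<Sum>d\<in>D. \<Sum>x\<in>(ext_gen d :: 'a alg_closure set). weight ?q d)"
      using D finite_ext_gen[where 'a='a] by (subst sum.Sigma) (auto simp: sum_distrib_left w_def case_prod_unfold)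
    also have "\<dots> \<le> 2 * (\<Sum>d\<in>D. 1 / real d)"
    proof (intro mult_left_mono sum_mono)
      fix d assume "d \<in> D"
      then have d: "d > 0" using D by auto
      have "(\<Sum>x\<in>(ext_gen d :: 'a alg_closure set). weight ?q d) = weight ?q d * card (ext_gen d :: 'a alg_closure set)"
        by simp
      also have "\<dots> \<le> weight ?q d * (?q ^ d - 1)"
        using weight_bounds(1)[OF d, where 'a='a] card_ext_gen_bounds(1)[OF d, where 'a='a] by (intro mult_left_mono) auto
      also have "\<dots> = 1 / real d" by (rule weight_bounds(2)[OF d])
      finally show "(\<Sum>x\<in>(ext_gen d :: 'a alg_closure set). weight ?q d) \<le> 1 / real d" .
    qed simp
    finally show "(\<Sum>p\<in>?I. w p * ?q ^ fst p * (\<Sum>r\<in>?I. if con p r then w r else 0)) \<le> 2 * (\<Sum>d\<in>D. 1 / real d)" .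
  qed simp
  finally show ?thesis by (simp add: w_def case_prod_unfold)
qed

text \<open>Under the weighted law the trace splits as a companion part plus the trace of
  \<open>h ^ k\<close>. For each fixed \<open>h\<close>, near uniformity of the first part over the
  generators suffices, whatever value the second part takes.\<close>

lemma sum_gen_count_trace:
  fixes t :: "'a :: {field, finite}" and \<epsilon> :: "nat \<Rightarrow> real"
  assumes D: "finite D" "\<And>d. d \<in> D \<Longrightarrow> 0 < d \<and> d \<le> n"
    and \<epsilon>: "\<And>d s. d \<in> D \<Longrightarrow> \<bar>real (card {x \<in> ext_gen d. trace_mat (gen_mat d x ^\<^sub>m k) = (s :: 'a)})
      - (real CARD('a) ^ d - 1) / real CARD('a)\<bar> \<le> \<epsilon> d"
  shows "\<bar>(\<Sum>g\<in>GL n. gen_count n D g * (if trace_mat (g ^\<^sub>m k) = t then 1 else 0))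
      - card (GL n :: 'a mat set) * ((\<Sum>d\<in>D. 1 / real d) / real CARD('a))\<bar>
    \<le> card (GL n :: 'a mat set) * (\<Sum>d\<in>D. weight (real CARD('a)) d * \<epsilon> d)"
proof -
  let ?q = "real CARD('a)"
  let ?N = "real (card (GL n :: 'a mat set))"
  define F where "F u = (if u = t then 1 else 0 :: real)" for u
  define S where "S d = (\<Sum>x\<in>ext_gen d. \<Sum>g\<in>GL n. real (card (intertwiners n d (gen_mat d x) g)) * F (trace_mat (g ^\<^sub>m k)))" for d
  define c where "c d = (?q ^ d - 1) / ?q" for d
  have S: "\<bar>S d - ?N * c d\<bar> \<le> ?N * \<epsilon> d" if d: "d \<in> D" for d
  proof -
    have d0: "d > 0" "d \<le> n" using D d by auto
    define m where "m = n - d"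
    have n: "n = d + m" using d0 by (simp add: m_def)
    let ?M = "real (card (GL m :: 'a mat set))"
    define \<nu> where "\<nu> s = real (card {x \<in> ext_gen d. trace_mat (gen_mat d x ^\<^sub>m k) = (s :: 'a)})" for s
    have M: "?M > 0" using card_GL_pos[of m, where 'a='a] by simp
    have "S d * ?M = (\<Sum>x\<in>ext_gen d. (\<Sum>g\<in>GL n. real (card (intertwiners n d (gen_mat d x) g)) * F (trace_mat (g ^\<^sub>m k))) * ?M)"
      unfolding S_def by (rule sum_distrib_right)
    also have "\<dots> = (\<Sum>x\<in>ext_gen d. ?N * (\<Sum>h\<in>GL m. F (trace_mat (gen_mat d x ^\<^sub>m k) + trace_mat (h ^\<^sub>m k))))"
      using sum_intertwiners[OF gen_mat_in_GL[OF d0(1)], of _ m F k]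
      by (intro sum.cong refl) (simp only: n intertwiners_def)
    also have "\<dots> = ?N * (\<Sum>h\<in>GL m. \<Sum>x\<in>ext_gen d. F (trace_mat (gen_mat d x ^\<^sub>m k) + trace_mat (h ^\<^sub>m k)))"
      unfolding sum_distrib_left[symmetric] by (subst sum.swap) (rule refl)
    also have "\<dots> = ?N * (\<Sum>h\<in>GL m. \<nu> (t - trace_mat (h ^\<^sub>m k)))"
    proof -
      have "(\<Sum>x\<in>ext_gen d. F (trace_mat (gen_mat d x ^\<^sub>m k) + b)) = \<nu> (t - b)" for b
      proof -
        have "(\<Sum>x\<in>ext_gen d. F (trace_mat (gen_mat d x ^\<^sub>m k) + b))
            = (\<Sum>x\<in>ext_gen d. if trace_mat (gen_mat d x ^\<^sub>m k) = t - b then 1 else 0)"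
          unfolding F_def by (intro sum.cong) (auto simp: algebra_simps)
        also have "\<dots> = \<nu> (t - b)"
          using finite_ext_gen[OF d0(1), where 'a='a] by (simp add: \<nu>_def sum.If_cases Int_def)
        finally show ?thesis .
      qed
      then show ?thesis by simp
    qed
    finally have "(S d - ?N * c d) * ?M = ?N * (\<Sum>h\<in>(GL m :: 'a mat set). \<nu> (t - trace_mat (h ^\<^sub>m k)) - c d)"
      by (simp add: sum_subtractf algebra_simps)
    then have "\<bar>S d - ?N * c d\<bar> * ?M = ?N * \<bar>\<Sum>h\<in>(GL m :: 'a mat set). \<nu> (t - trace_mat (h ^\<^sub>m k)) - c d\<bar>"
      using M by (metis abs_mult abs_of_nat)
    also have "\<dots> \<le> ?N * (\<Sum>h\<in>(GL m :: 'a mat set). \<epsilon> d)"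
      using \<epsilon>[OF d] unfolding \<nu>_def c_def
      by (intro mult_left_mono order_trans[OF sum_abs] sum_mono) auto
    also have "\<dots> = ?N * \<epsilon> d * ?M" by simp
    finally show ?thesis using M by (simp add: mult_le_cancel_right)
  qed
  have w: "weight ?q d \<ge> 0" "weight ?q d * c d = 1 / real d / ?q" if "d \<in> D" for d
    using weight_bounds(1,2)[of d, where 'a='a] D(2)[OF that] by (auto simp: c_def less_imp_le)
  have "(\<Sum>g\<in>GL n. gen_count n D g * (if trace_mat (g ^\<^sub>m k) = t then 1 else 0))
      = (\<Sum>g\<in>GL n. \<Sum>p\<in>Sigma D ext_gen. weight ?q (fst p) * (real (card (intertwiners n (fst p) (gen_mat (fst p) (snd p)) g)) * F (trace_mat (g ^\<^sub>m k))))"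
    by (simp only: gen_count_def F_def case_prod_unfold sum_distrib_right mult.assoc)
  also have "\<dots> = (\<Sum>p\<in>Sigma D ext_gen. weight ?q (fst p) * (\<Sum>g\<in>GL n. real (card (intertwiners n (fst p) (gen_mat (fst p) (snd p)) g)) * F (trace_mat (g ^\<^sub>m k))))"
    by (subst sum.swap) (simp only: sum_distrib_left)
  also have "\<dots> = (\<Sum>d\<in>D. \<Sum>x\<in>ext_gen d. weight ?q d * (\<Sum>g\<in>GL n. real (card (intertwiners n d (gen_mat d x) g)) * F (trace_mat (g ^\<^sub>m k))))"
    using D finite_ext_gen[where 'a='a] by (subst sum.Sigma) (auto simp: case_prod_unfold)
  also have "\<dots> = (\<Sum>d\<in>D. weight ?q d * S d)"
    by (simp only: S_def sum_distrib_left)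
  finally have 1: "(\<Sum>g\<in>GL n. gen_count n D g * (if trace_mat (g ^\<^sub>m k) = t then 1 else 0)) = (\<Sum>d\<in>D. weight ?q d * S d)" .
  have "?N * ((\<Sum>d\<in>D. 1 / real d) / ?q) = (\<Sum>d\<in>D. ?N * (1 / real d / ?q))"
    by (simp only: sum_divide_distrib sum_distrib_left)
  also have "\<dots> = (\<Sum>d\<in>D. weight ?q d * (?N * c d))"
    by (intro sum.cong refl) (simp only: w(2)[symmetric] mult_ac)
  finally have "(\<Sum>d\<in>D. weight ?q d * S d) - ?N * ((\<Sum>d\<in>D. 1 / real d) / ?q) = (\<Sum>d\<in>D. weight ?q d * (S d - ?N * c d))"
    by (simp add: sum_subtractf right_diff_distrib)
  also have "\<bar>\<dots>\<bar> \<le> (\<Sum>d\<in>D. weight ?q d * (?N * \<epsilon> d))"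
    using S w by (intro order_trans[OF sum_abs] sum_mono) (auto simp: abs_mult intro!: mult_left_mono)
  also have "\<dots> = ?N * (\<Sum>d\<in>D. weight ?q d * \<epsilon> d)"
    by (simp add: sum_distrib_left mult_ac)
  finally show ?thesis unfolding 1 .
qed

text \<open>With \<open>I\<close> the indicator of the trace event, \<open>L * I\<close> is split as
  \<open>(L - Z) * I + Z * I\<close>. Cauchy-Schwarz bounds the first part and weighted
  equidistribution evaluates the second. Centring at \<open>L\<close> rather than at the mean
  \<open>P\<close> of \<open>Z\<close> produces the term \<open>(L - P)\<^sup>2\<close>.\<close>

lemma trace_frequency_estimate:
  fixes t :: "'a :: {field, finite}" and \<epsilon> :: "nat \<Rightarrow> real" and D :: "nat set" and n k :: nat
  defines "L \<equiv> \<Sum>d\<in>D. 1 / real d"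
    and "P \<equiv> \<Sum>(d, x)\<in>Sigma D (ext_gen :: nat \<Rightarrow> 'a alg_closure set). weight (real CARD('a)) d"
    and "\<mu> \<equiv> real (card {g \<in> GL n. trace_mat (g ^\<^sub>m k) = t}) / real (card (GL n :: 'a mat set))"
  assumes D: "finite D" "\<And>d. d \<in> D \<Longrightarrow> 0 < d \<and> d \<le> n"
    and \<epsilon>: "\<And>d s. d \<in> D \<Longrightarrow> \<bar>real (card {x \<in> ext_gen d. trace_mat (gen_mat d x ^\<^sub>m k) = (s :: 'a)})
      - (real CARD('a) ^ d - 1) / real CARD('a)\<bar> \<le> \<epsilon> d"
  shows "\<bar>L * \<mu> - L / real CARD('a)\<bar> \<le> sqrt ((L - P)\<^sup>2 + 2 * L) + (\<Sum>d\<in>D. weight (real CARD('a)) d * \<epsilon> d)"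
proof -
  let ?GL = "GL n :: 'a mat set"
  let ?N = "real (card ?GL)"
  let ?R = "\<Sum>d\<in>D. weight (real CARD('a)) d * \<epsilon> d"
  define Z where "Z = (gen_count n D :: 'a mat \<Rightarrow> real)"
  define I where "I g = (if trace_mat (g ^\<^sub>m k) = t then 1 else 0 :: real)" for g
  have N: "?N > 0" using card_GL_pos[of n, where 'a='a] by simp
  have L0: "L \<ge> 0" unfolding L_def by (intro sum_nonneg) auto
  have sumI: "(\<Sum>g\<in>?GL. I g) = ?N * \<mu>"
    using N finite_GL[of n, where 'a='a] by (simp add: I_def \<mu>_def sum.If_cases Int_def)
  have "(\<Sum>g\<in>?GL. (L - Z g)\<^sup>2) = (\<Sum>g\<in>?GL. L\<^sup>2 - 2 * L * Z g + (Z g)\<^sup>2)"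
    by (intro sum.cong refl) (simp add: power2_diff)
  also have "\<dots> = ?N * L\<^sup>2 - 2 * L * (\<Sum>g\<in>?GL. Z g) + (\<Sum>g\<in>?GL. (Z g)\<^sup>2)"
    by (simp add: sum.distrib sum_subtractf sum_distrib_left)
  \<comment> \<open>The linear term has a negative coefficient, so the mean of \<open>Z\<close> must
    be known exactly; for the square an upper bound is enough.\<close>
  also have "\<dots> \<le> ?N * L\<^sup>2 - 2 * L * (?N * P) + ?N * (P\<^sup>2 + 2 * L)"
    using sum_gen_count[OF D, where 'a='a] sum_gen_count_squared_le[OF D(1), of n, where 'a='a] D(2)
    unfolding Z_def P_def L_def by simp
  also have "\<dots> = ?N * ((L - P)\<^sup>2 + 2 * L)"
    by (simp add: power2_diff algebra_simps)
  finally have var: "(\<Sum>g\<in>?GL. (L - Z g)\<^sup>2) \<le> ?N * ((L - P)\<^sup>2 + 2 * L)" .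
  have "(\<Sum>g\<in>?GL. (L - Z g) * I g)\<^sup>2 \<le> (\<Sum>g\<in>?GL. (L - Z g)\<^sup>2) * (\<Sum>g\<in>?GL. (I g)\<^sup>2)"
    by (rule Cauchy_Schwarz_ineq_sum)
  also have "\<dots> \<le> (?N * ((L - P)\<^sup>2 + 2 * L)) * ?N"
  proof (rule mult_mono[OF var])
    have "(\<Sum>g\<in>?GL. (I g)\<^sup>2) \<le> (\<Sum>g\<in>?GL. 1)" by (intro sum_mono) (simp add: I_def)
    then show "(\<Sum>g\<in>?GL. (I g)\<^sup>2) \<le> ?N" by simp
  qed (use L0 in \<open>auto intro: sum_nonneg\<close>)
  also have "\<dots> = (?N * sqrt ((L - P)\<^sup>2 + 2 * L))\<^sup>2"
    using L0 by (simp add: power_mult_distrib power2_eq_square[of ?N])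
  finally have "\<bar>\<Sum>g\<in>?GL. (L - Z g) * I g\<bar> \<le> ?N * sqrt ((L - P)\<^sup>2 + 2 * L)"
    by (rule abs_le_square_iff[THEN iffD2, THEN order_trans]) (use L0 in simp)
  moreover have "\<bar>(\<Sum>g\<in>?GL. Z g * I g) - ?N * (L / real CARD('a))\<bar> \<le> ?N * ?R"
    unfolding Z_def I_def L_def by (rule sum_gen_count_trace[OF D \<epsilon>])
  moreover have "(\<Sum>g\<in>?GL. (L - Z g) * I g) = L * (?N * \<mu>) - (\<Sum>g\<in>?GL. Z g * I g)"
    unfolding sumI[symmetric] by (simp add: left_diff_distrib sum_subtractf sum_distrib_left)
  ultimately have "\<bar>L * (?N * \<mu>) - ?N * (L / real CARD('a))\<bar> \<le> ?N * sqrt ((L - P)\<^sup>2 + 2 * L) + ?N * ?R"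
    by linarith
  moreover have "L * (?N * \<mu>) - ?N * (L / real CARD('a)) = ?N * (L * \<mu> - L / real CARD('a))"
    by (simp add: algebra_simps)
  ultimately have "?N * \<bar>L * \<mu> - L / real CARD('a)\<bar> \<le> ?N * (sqrt ((L - P)\<^sup>2 + 2 * L) + ?R)"
    using N by (simp only: abs_mult abs_of_nat distrib_left)
  then show ?thesis using N by (rule mult_left_le_imp_le)
qed


section \<open>Equidistribution\<close>

lemma pmf_trace_power:
  fixes t :: "'a :: {field, finite}"
  shows "pmf (trace_power_pmf n k) t
    = real (card {g \<in> GL n. trace_mat (g ^\<^sub>m k) = t}) / real (card (GL n :: 'a mat set))"
proof -
  have "GL n \<inter> (\<lambda>g. trace_mat (g ^\<^sub>m k)) -` {t} = {g \<in> GL n. trace_mat (g ^\<^sub>m k) = t}"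
    by auto
  then show ?thesis
    unfolding trace_power_pmf_def pmf_map
    by (subst measure_pmf_of_set[OF GL_nonempty finite_GL]) simp
qed

lemma sum_weight_ext_gen:
  assumes D: "finite D" "\<And>d. d \<in> D \<Longrightarrow> 0 < d"
  shows "(\<Sum>(d, x)\<in>Sigma D (ext_gen :: nat \<Rightarrow> 'a :: {field, finite} alg_closure set). weight (real CARD('a)) d)
    = (\<Sum>d\<in>D. weight (real CARD('a)) d * card (ext_gen d :: 'a alg_closure set))"
  using D finite_ext_gen[where 'a='a] by (subst sum.Sigma[symmetric]) (auto simp: mult.commute)

text \<open>Every per-degree error is at most a constant over \<open>n\<close>, and there are at
  most \<open>n\<close> degrees. The 6 collects the equidistribution errors, and 16 is the square of
  the bound 4 on \<open>L - P\<close>.\<close>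

lemma trace_frequency_bound:
  fixes t :: "'a :: {field, finite}" and n k :: nat
  defines "q \<equiv> CARD('a)"
  defines "D \<equiv> {d. 12 * log (real q) (real n) < real d \<and> d \<le> n \<and>
                 real (gcd k (q ^ d - 1)) < real q powr (real d / 3)}"
  defines "L \<equiv> \<Sum>d\<in>D. 1 / real d"
  assumes n: "n \<ge> 1" and k: "k > 0"
  shows "\<bar>L * pmf (trace_power_pmf n k) t - L / real q\<bar> \<le> sqrt (16 + 2 * L) + 6"
proof -
  let ?\<epsilon> = "\<lambda>d. (real (gcd k (q ^ d - 1)) + 2) * sqrt (real q ^ d)"
  define P where "P = (\<Sum>(d, x)\<in>Sigma D (ext_gen :: nat \<Rightarrow> 'a alg_closure set). weight (real q) d)"
  have q: "real q > 1" unfolding q_def using finite_field_card_gt_1[where 'a='a] by simp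
  have D: "finite D" "\<And>d. d \<in> D \<Longrightarrow> 0 < d \<and> d \<le> n"
  proof -
    have "D \<subseteq> {..n}" by (auto simp: D_def)
    then show "finite D" by (rule finite_subset) simp
    have "log (real q) (real n) \<ge> 0" using q n by simp
    then show "\<And>d. d \<in> D \<Longrightarrow> 0 < d \<and> d \<le> n" unfolding D_def by force
  qed
  have "card D \<le> card {1..n}" using D by (intro card_mono) (auto simp: Suc_le_eq)
  then have cardD: "real (card D) \<le> real n" by simp
  have bounds: "weight (real q) d * ?\<epsilon> d \<le> 6 / real n" "weight (real q) d * (2 * sqrt (real q ^ d)) \<le> 4 / real n"
    if d: "d \<in> D" for d
  proof -
    have d0: "d > 0" using D d by auto
    \<comment> \<open>The common scale: \<open>q ^ d = w ^ 6\<close>, its square root is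
      \<open>w ^ 3\<close>, and the gcd is below \<open>w\<^sup>2\<close>. The error is thus of
      order \<open>w ^ 5\<close> against a weight of order \<open>1 / w ^ 6\<close>, and the lower
      bound on \<open>d\<close> gives \<open>n \<le> w\<close>.\<close>
    define w where "w = real q powr (real d / 6)"
    have "real n = real q powr (log (real q) (real n))" using q n by simp
    also have "\<dots> \<le> w"
    proof -
      have "log (real q) (real n) \<ge> 0" using q n by simp
      moreover have "12 * log (real q) (real n) < real d" using d by (simp add: D_def)
      ultimately have "log (real q) (real n) \<le> real d / 6" by simp
      then show ?thesis unfolding w_def using q by (intro powr_mono) auto
    qed
    finally have wn: "real n \<le> w" .
    then have w1: "w \<ge> 1" using n by linarith
    have "w ^ 6 = real q powr (real d)"
      unfolding w_def using q by (simp add: powr_power)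
    then have w6: "real q ^ d = w ^ 6" using q by (simp add: powr_realpow)
    have w3: "sqrt (real q ^ d) = w ^ 3"
      unfolding w6 using w1 by (intro real_sqrt_unique) (auto simp flip: power_mult)
    have w2: "real q powr (real d / 3) = w\<^sup>2"
      unfolding w_def using q by (simp add: powr_power)
    have wt0: "weight (real q) d > 0" unfolding q_def by (rule weight_bounds(1)[OF d0])
    have "weight (real q) d * w ^ 6 \<le> 2 / real d"
      using weight_bounds(3)[OF d0, where 'a='a] unfolding w6[symmetric] q_def .
    also have "\<dots> \<le> 2" using d0 by (simp add: field_simps)
    finally have wt: "weight (real q) d * w ^ 6 \<le> 2" .
    \<comment> \<open>One factor of \<open>w\<close> is left in the denominator, and it is exchanged
      for \<open>n\<close>.\<close>
    have scale: "weight (real q) d * (c * w ^ 5) \<le> 2 * c / real n" if "c \<ge> 0" for c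
    proof -
      have "weight (real q) d * (c * w ^ 5) = c * (weight (real q) d * w ^ 6) / w"
        using w1 by (simp add: power_eq_if)
      also have "\<dots> \<le> c * 2 / w"
        using wt that w1 by (intro divide_right_mono mult_left_mono) auto
      also have "\<dots> \<le> c * 2 / real n"
        using wn n that by (intro divide_left_mono) auto
      finally show ?thesis by (simp add: mult.commute)
    qed
    have p: "w ^ 3 \<le> w ^ 5" using w1 by (intro power_increasing) auto
    have "?\<epsilon> d \<le> (w\<^sup>2 + 2) * w ^ 3"
      using d w1 unfolding w3 by (intro mult_right_mono) (auto simp: D_def w2)
    also have "\<dots> = w ^ 5 + 2 * w ^ 3"
      by (simp add: distrib_right flip: power_add)
    also have "\<dots> \<le> 3 * w ^ 5" using p by simp
    finally have "weight (real q) d * ?\<epsilon> d \<le> weight (real q) d * (3 * w ^ 5)"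
      using wt0 by (intro mult_left_mono) auto
    also have "\<dots> \<le> 6 / real n" using scale[of 3] by simp
    finally show "weight (real q) d * ?\<epsilon> d \<le> 6 / real n" .
    have "weight (real q) d * (2 * sqrt (real q ^ d)) \<le> weight (real q) d * (2 * w ^ 5)"
      unfolding w3 using wt0 p by (intro mult_left_mono) auto
    also have "\<dots> \<le> 4 / real n" using scale[of 2] by simp
    finally show "weight (real q) d * (2 * sqrt (real q ^ d)) \<le> 4 / real n" .
  qed
  have total: "(\<Sum>d\<in>D. f d) \<le> c" if "\<And>d. d \<in> D \<Longrightarrow> f d \<le> c / real n" "c \<ge> 0" for f :: "nat \<Rightarrow> real" and c
  proof -
    have "(\<Sum>d\<in>D. f d) \<le> card D * (c / real n)" using sum_bounded_above[of D f "c / real n"] that by simp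
    also have "\<dots> \<le> real n * (c / real n)" using cardD that by (intro mult_right_mono) auto
    also have "\<dots> = c" using n by simp
    finally show ?thesis .
  qed
  have R: "(\<Sum>d\<in>D. weight (real q) d * ?\<epsilon> d) \<le> 6"
    using bounds(1) by (intro total) auto
  have P_eq: "P = (\<Sum>d\<in>D. weight (real q) d * card (ext_gen d :: 'a alg_closure set))"
    unfolding P_def q_def using D by (intro sum_weight_ext_gen) auto
  have L_eq: "L = (\<Sum>d\<in>D. weight (real q) d * (real q ^ d - 1))"
    unfolding L_def q_def using D by (intro sum.cong refl) (simp add: weight_bounds(2))
  have LP: "L - P = (\<Sum>d\<in>D. weight (real q) d * (real q ^ d - 1 - card (ext_gen d :: 'a alg_closure set)))"
    unfolding L_eq P_eq by (simp add: sum_subtractf right_diff_distrib)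
  have "L - P \<ge> 0"
    unfolding LP
  proof (intro sum_nonneg mult_nonneg_nonneg)
    fix d assume "d \<in> D"
    then have d: "d > 0" using D by auto
    show "0 \<le> weight (real q) d" unfolding q_def using weight_bounds(1)[OF d, where 'a='a] by simp
    show "0 \<le> real q ^ d - 1 - card (ext_gen d :: 'a alg_closure set)"
      unfolding q_def using card_ext_gen_bounds(1)[OF d, where 'a='a] by simp
  qed
  moreover have "L - P \<le> 4"
    unfolding LP
  proof (intro total)
    fix d assume d: "d \<in> D"
    then have d0: "d > 0" using D by auto
    have "weight (real q) d * (real q ^ d - 1 - card (ext_gen d :: 'a alg_closure set))
        \<le> weight (real q) d * (2 * sqrt (real q ^ d))"
      unfolding q_def using card_ext_gen_bounds(2)[OF d0, where 'a='a] weight_bounds(1)[OF d0, where 'a='a]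
      by (intro mult_left_mono) auto
    also have "\<dots> \<le> 4 / real n" by (rule bounds(2)[OF d])
    finally show "weight (real q) d * (real q ^ d - 1 - card (ext_gen d :: 'a alg_closure set)) \<le> 4 / real n" .
  qed simp
  ultimately have "(L - P)\<^sup>2 \<le> 4\<^sup>2" by (intro power_mono)
  then have "sqrt ((L - P)\<^sup>2 + 2 * L) \<le> sqrt (16 + 2 * L)" by simp
  moreover have "\<bar>L * pmf (trace_power_pmf n k) t - L / real q\<bar>
      \<le> sqrt ((L - P)\<^sup>2 + 2 * L) + (\<Sum>d\<in>D. weight (real q) d * ?\<epsilon> d)"
    unfolding pmf_trace_power L_def P_def q_def using D k
    by (intro trace_frequency_estimate trace_gen_mat_equidistribution) auto
  ultimately show ?thesis using R by linarith
qed

theorem theorem1p3: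
  fixes k :: "nat \<Rightarrow> nat" and q :: nat
  defines "q \<equiv> CARD('a :: {field, finite})"
  assumes k_pos: "\<And>n. n \<ge> 1 \<Longrightarrow> k n > 0"
    and sum_diverges: "filterlim
      (\<lambda>n. \<Sum>d | 12 * log (real q) (real n) < real d \<and> d \<le> n \<and>
                 real (gcd (k n) (q ^ d - 1)) < real q powr (real d / 3). 1 / real d)
      at_top sequentially"
  shows "\<forall>x :: 'a. (\<lambda>n. pmf (trace_power_pmf n (k n)) x)
           \<longlonglongrightarrow> pmf (pmf_of_set (UNIV :: 'a set)) x"
proof
  fix x :: 'a
  define L where "L n = (\<Sum>d | 12 * log (real q) (real n) < real d \<and> d \<le> n \<and>
                 real (gcd (k n) (q ^ d - 1)) < real q powr (real d / 3). 1 / real d)" for n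
  have L: "filterlim L at_top sequentially"
    using sum_diverges unfolding L_def .
  \<comment> \<open>After division by \<open>L\<close> the error decays like the inverse square root
    of \<open>L\<close>.\<close>
  have "((\<lambda>u :: real. (sqrt (16 + 2 * u) + 6) / u) \<longlongrightarrow> 0) at_top"
    by real_asymp
  from filterlim_compose[OF this L]
  have lim: "(\<lambda>n. (sqrt (16 + 2 * L n) + 6) / L n) \<longlonglongrightarrow> 0" .
  have "(\<lambda>n. pmf (trace_power_pmf n (k n)) x - 1 / real q) \<longlonglongrightarrow> 0"
  proof (rule Lim_null_comparison[OF _ lim])
    have "eventually (\<lambda>n. L n > 0) sequentially"
      using L by (simp add: filterlim_at_top_dense)
    then show "eventually (\<lambda>n. norm (pmf (trace_power_pmf n (k n)) x - 1 / real q) \<le> (sqrt (16 + 2 * L n) + 6) / L n) sequentially"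
      using eventually_ge_at_top[of 1]
    proof eventually_elim
      case (elim n)
      let ?p = "pmf (trace_power_pmf n (k n)) x"
      have "L n * \<bar>?p - 1 / real q\<bar> = \<bar>L n * ?p - L n / real q\<bar>"
        using elim by (simp add: abs_mult_pos' right_diff_distrib)
      also have "\<dots> \<le> sqrt (16 + 2 * L n) + 6"
        unfolding L_def q_def using elim k_pos by (intro trace_frequency_bound) auto
      finally show ?case using elim by (simp add: pos_le_divide_eq mult.commute)
    qed
  qed
  then have "(\<lambda>n. pmf (trace_power_pmf n (k n)) x) \<longlonglongrightarrow> 1 / real q"
    by (simp add: LIM_zero_iff)
  then show "(\<lambda>n. pmf (trace_power_pmf n (k n)) x) \<longlonglongrightarrow> pmf (pmf_of_set (UNIV :: 'a set)) x"
    by (simp add: q_def)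
qed

end
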